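(* Let $q\in\mathbb{C}\setminus\{0\}$ be not a root of unity. Let $\mathcal{S}$ be the set of all $U_q(\mathfrak{sl}_2)$-module algebra structures on the quantum plane $\mathbb{C}_q[x,y]$ such that $$(\mathsf{e}(x))_0\ne 0,\quad(\mathsf{e}(y))_0=0,\quad(\mathsf{f}(x))_0=0,\quad(\mathsf{f}(y))_0=0,$$ $$(\mathsf{e}(x))_1=(\mathsf{e}(y))_1=(\mathsf{f}(x))_1=(\mathsf{f}(y))_1=0 .$$ Then $\mathcal{S}$ consists of exactly the three-parameter family, indexed by $(a_0,s,t)$ with $a_0\in\mathbb{C}\setminus\{0\}$, $s,t\in\mathbb{C}$, of structures given by $$\mathsf{k}(x)=q^{-2}x,\quad \mathsf{k}(y)=q^{-1}y,\quad \mathsf{e}(x)=a_0,\quad \mathsf{e}(y)=0,$$ $$\mathsf{f}(x)=-qa_0^{-1}x^2+ty^4,\quad \mathsf{f}(y)=-qa_0^{-1}xy+sy^3$$ (each such triple gives a well-defined structure). The domain $\{(a_0,s,t)\mid s\ne 0,\ t\ne 0\}$ splits into the uncountably many disjoint subsets $\{(a_0,s,t)\mid s\ne 0,\ t\ne 0,\ \varphi=\mathrm{const}\}$, where $\varphi=\dfrac{t}{a_0s^2}$, and each of those subsets corresponds to exactly one isomorphism class of $U_q(\mathfrak{sl}_2)$-module algebra structures. Additionally, there exist exactly three more isomorphism classes in $\mathcal{S}$, corresponding to the subsets $$\{(a_0,s,t)\mid s\ne 0,\ t=0\},\quad\{(a_0,s,t)\mid s=0,\ t\ne 0\},\quad\{(a_0,s,t)\mid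 s=0,\ t=0\}.$$
   Context: The quantum plane $\mathbb{C}_q[x,y]$ is the unital associative $\mathbb{C}$-algebra with generators $x,y$ and the single relation $yx=qxy$; the monomials $x^my^n$ ($m,n\ge 0$) form a basis. Its $i$-th homogeneous component is the linear span of the $x^my^n$ with $m+n=i$; for a polynomial $p$, $(p)_i$ denotes the projection of $p$ to the $i$-th homogeneous component (parallel to the other components). $U_q(\mathfrak{sl}_2)$ is the unital associative $\mathbb{C}$-algebra with generators $\mathsf{k},\mathsf{k}^{-1},\mathsf{e},\mathsf{f}$ and relations $\mathsf{k}^{-1}\mathsf{k}=\mathsf{k}\mathsf{k}^{-1}=\mathbf{1}$, $\mathsf{k}\mathsf{e}=q^2\mathsf{e}\mathsf{k}$, $\mathsf{k}\mathsf{f}=q^{-2}\mathsf{f}\mathsf{k}$, $\mathsf{e}\mathsf{f}-\mathsf{f}\mathsf{e}=\frac{\mathsf{k}-\mathsf{k}^{-1}}{q-q^{-1}}$, with Hopf algebra structure $\Delta(\mathsf{k})=\mathsf{k}\otimes\mathsf{k}$, $\Delta(\mathsf{e})=\mathbf{1}\otimes\mathsf{e}+\mathsf{e}\otimes\mathsf{k}$, $\Delta(\mathsf{f})=\mathsf{f}\otimes\mathbf{1}+\mathsf{k}^{-1}\otimes\mathsf{f}$, $\varepsilon(\mathsf{k})=1$, $\varepsilon(\mathsf{e})=\varepsilon(\mathsf{f})=0$, $S(\mathsf{k})=\mathsf{k}^{-1}$, $S(\mathsf{e})=-\mathsf{e}\mathsf{k}^{-1}$, $S(\mathsf{f})=-\mathsf{k}\mathsf{f}$.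 For a Hopf algebra $H$ and a unital algebra $A$, a structure of $H$-module algebra on $A$ is an algebra homomorphism $\pi:H\to\operatorname{End}_{\mathbb{C}}A$ such that $\pi(h)(ab)=\sum_i\pi(h_i')(a)\,\pi(h_i'')(b)$ (where $\Delta(h)=\sum_i h_i'\otimes h_i''$) and $\pi(h)(\mathbf{1})=\varepsilon(h)\mathbf{1}$ for all $h\in H$, $a,b\in A$. One writes $h(a)$ for $\pi(h)(a)$. A structure on $\mathbb{C}_q[x,y]$ is uniquely determined by the values of $\mathsf{k},\mathsf{e},\mathsf{f}$ on $x,y$. Structures $\pi_1,\pi_2$ are isomorphic if there is an algebra automorphism $\Psi$ of $A$ with $\Psi\pi_1(h)\Psi^{-1}=\pi_2(h)$ for all $h\in H$. In all parameter subsets, $a_0$ ranges over $\mathbb{C}\setminus\{0\}$ and $s,t$ over $\mathbb{C}$. "A subset corresponds to an isomorphism class" means that two structures of the family are isomorphic if and only if their parameter triples lie in the same one of the listed subsets. *)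

theory Defs
  imports
    Complex_Main
    "HOL-Library.Poly_Mapping"
    "HOL-Library.Product_Plus"
    "HOL-Library.Countable_Set"
    "HOL-Library.Disjoint_Sets"
    "HOL-Algebra.Module"
    "HOL-Algebra.QuotRing"
begin

text \<open>A complex algebra is given by a record of type \<open>(complex, 'a) module\<close> of HOL-Algebra;
  its multiplication need not be commutative.\<close>

definition alg_hom ::
  "(complex, 'a, 'm) module_scheme \<Rightarrow> (complex, 'b, 'n) module_scheme \<Rightarrow> ('a \<Rightarrow> 'b) set" where
  "alg_hom A B = {h \<in> ring_hom A B. \<forall>c. \<forall>x \<in> carrier A. h (c \<odot>\<^bsub>A\<^esub> x) = c \<odot>\<^bsub>B\<^esub> h x}"

definition alg_aut :: "(complex, 'a, 'm) module_scheme \<Rightarrow> ('a \<Rightarrow> 'a) set" where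
  "alg_aut A = {h \<in> alg_hom A A. bij_betw h (carrier A) (carrier A)}"

text \<open>Endomorphisms are restricted to the carrier (value \<open>undefined\<close> outside), so that equality of
  functions is equality of endomorphisms.\<close>

definition End_algebra ::
  "(complex, 'a, 'm) module_scheme \<Rightarrow> (complex, 'a \<Rightarrow> 'a) module" where
  "End_algebra A =
    \<lparr>carrier = {g \<in> carrier A \<rightarrow>\<^sub>E carrier A.
        (\<forall>x \<in> carrier A. \<forall>y \<in> carrier A. g (x \<oplus>\<^bsub>A\<^esub> y) = g x \<oplus>\<^bsub>A\<^esub> g y) \<and>
        (\<forall>c. \<forall>x \<in> carrier A. g (c \<odot>\<^bsub>A\<^esub> x) = c \<odot>\<^bsub>A\<^esub> g x)},
     mult = compose (carrier A),
     one = (\<lambda>x \<in> carrier A. x),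
     zero = (\<lambda>x \<in> carrier A. \<zero>\<^bsub>A\<^esub>),
     add = (\<lambda>g h. \<lambda>x \<in> carrier A. g x \<oplus>\<^bsub>A\<^esub> h x),
     smult = (\<lambda>c g. \<lambda>x \<in> carrier A. c \<odot>\<^bsub>A\<^esub> g x)\<rparr>"

definition quotient_algebra ::
  "(complex, 'a, 'm) module_scheme \<Rightarrow> 'a set \<Rightarrow> (complex, 'a set) module" where
  "quotient_algebra A I =
    \<lparr>carrier = carrier (A Quot I),
     mult = monoid.mult (A Quot I),
     one = monoid.one (A Quot I),
     zero = ring.zero (A Quot I),
     add = ring.add (A Quot I),
     smult = (\<lambda>c X. \<Union>x \<in> X. I +>\<^bsub>A\<^esub> (c \<odot>\<^bsub>A\<^esub> x))\<rparr>"

text \<open>Words form the free monoid, written additively, so that the convolution product of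
  \<open>Poly_Mapping\<close> makes \<open>'g list \<Rightarrow>\<^sub>0 complex\<close> the free algebra on \<open>'g\<close>. Likewise
  \<open>('g list \<times> 'g list) \<Rightarrow>\<^sub>0 complex\<close> is the tensor square of that free algebra, with
  \<open>single (u, v) 1\<close> in the role of \<open>u \<otimes> v\<close>.\<close>

instantiation list :: (type) monoid_add
begin

definition zero_list :: "'a list" where "zero_list = []"

definition plus_list :: "'a list \<Rightarrow> 'a list \<Rightarrow> 'a list" where "plus_list u v = u @ v"

instance by standard (simp_all add: zero_list_def plus_list_def)

end

abbreviation scalar :: "complex \<Rightarrow> ('m::monoid_add \<Rightarrow>\<^sub>0 complex)" where
  "scalar c \<equiv> Poly_Mapping.single 0 c"

abbreviation word :: "'g list \<Rightarrow> ('g list \<Rightarrow>\<^sub>0 complex)" where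
  "word w \<equiv> Poly_Mapping.single w 1"

definition free_algebra :: "(complex, 'g list \<Rightarrow>\<^sub>0 complex) module" where
  "free_algebra =
    \<lparr>carrier = UNIV, mult = (*), one = 1, zero = 0, add = (+),
     smult = (\<lambda>c p. scalar c * p)\<rparr>"

definition rel_ideal :: "('g list \<Rightarrow>\<^sub>0 complex) set \<Rightarrow> ('g list \<Rightarrow>\<^sub>0 complex) set" where
  "rel_ideal R = Idl\<^bsub>free_algebra\<^esub> R"

definition presented_algebra ::
  "('g list \<Rightarrow>\<^sub>0 complex) set \<Rightarrow> (complex, ('g list \<Rightarrow>\<^sub>0 complex) set) module" where
  "presented_algebra R = quotient_algebra free_algebra (rel_ideal R)"

definition rel_class ::
  "('g list \<Rightarrow>\<^sub>0 complex) set \<Rightarrow> ('g list \<Rightarrow>\<^sub>0 complex) \<Rightarrow> ('g list \<Rightarrow>\<^sub>0 complex) set" where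
  "rel_class R p = rel_ideal R +>\<^bsub>free_algebra\<^esub> p"

text \<open>The (anti)homomorphism from the free algebra to an algebra with unit map \<open>\<iota>\<close>
  that extends \<open>\<phi>\<close>.\<close>

definition free_ext ::
  "(complex \<Rightarrow> 'b::ring_1) \<Rightarrow> ('g \<Rightarrow> 'b) \<Rightarrow> ('g list \<Rightarrow>\<^sub>0 complex) \<Rightarrow> 'b" where
  "free_ext \<iota> \<phi> p =
    (\<Sum>w \<in> Poly_Mapping.keys p. \<iota> (Poly_Mapping.lookup p w) * prod_list (map \<phi> w))"

definition free_anti_ext ::
  "(complex \<Rightarrow> 'b::ring_1) \<Rightarrow> ('g \<Rightarrow> 'b) \<Rightarrow> ('g list \<Rightarrow>\<^sub>0 complex) \<Rightarrow> 'b" where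
  "free_anti_ext \<iota> \<phi> p =
    (\<Sum>w \<in> Poly_Mapping.keys p. \<iota> (Poly_Mapping.lookup p w) * prod_list (map \<phi> (rev w)))"

datatype qp_gen = Gx | Gy

definition qp_relators :: "complex \<Rightarrow> (qp_gen list \<Rightarrow>\<^sub>0 complex) set" where
  "qp_relators q = {word [Gy, Gx] - scalar q * word [Gx, Gy]}"

definition qplane :: "complex \<Rightarrow> (complex, (qp_gen list \<Rightarrow>\<^sub>0 complex) set) module" where
  "qplane q = presented_algebra (qp_relators q)"

definition qp_x :: "complex \<Rightarrow> (qp_gen list \<Rightarrow>\<^sub>0 complex) set" where
  "qp_x q = rel_class (qp_relators q) (word [Gx])"

definition qp_y :: "complex \<Rightarrow> (qp_gen list \<Rightarrow>\<^sub>0 complex) set" where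
  "qp_y q = rel_class (qp_relators q) (word [Gy])"

definition qp_mon :: "complex \<Rightarrow> nat \<Rightarrow> nat \<Rightarrow> (qp_gen list \<Rightarrow>\<^sub>0 complex) set" where
  "qp_mon q m n = (qp_x q [^]\<^bsub>qplane q\<^esub> m) \<otimes>\<^bsub>qplane q\<^esub> (qp_y q [^]\<^bsub>qplane q\<^esub> n)"

definition degree_span :: "complex \<Rightarrow> nat set \<Rightarrow> (qp_gen list \<Rightarrow>\<^sub>0 complex) set set" where
  "degree_span q D =
    {finsum (qplane q) (\<lambda>(m, n). c m n \<odot>\<^bsub>qplane q\<^esub> qp_mon q m n) M | M c.
       finite M \<and> M \<subseteq> {(m, n). m + n \<in> D}}"

text \<open>\<open>hpart q i p\<close> is \<open>(p)\<^sub>i\<close>, the projection to the span of the monomials of degree \<open>i\<close>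
  parallel to the span of all other monomials.\<close>

definition hpart ::
  "complex \<Rightarrow> nat \<Rightarrow> (qp_gen list \<Rightarrow>\<^sub>0 complex) set \<Rightarrow> (qp_gen list \<Rightarrow>\<^sub>0 complex) set" where
  "hpart q i p =
    (THE r. r \<in> degree_span q {i} \<and> p \<ominus>\<^bsub>qplane q\<^esub> r \<in> degree_span q (- {i}))"

text \<open>The tensor square of \<open>A\<close> is the free vector space on pairs of elements of \<open>A\<close> modulo the
  subspace \<open>tensor_null A\<close> of bilinearity relations; its elements are cosets \<open>tensor_class A t\<close>.\<close>

inductive_set tensor_null ::
  "(complex, 'a, 'm) module_scheme \<Rightarrow> (('a \<times> 'a) \<Rightarrow>\<^sub>0 complex) set"
  for A :: "(complex, 'a, 'm) module_scheme" where
  null_zero: "0 \<in> tensor_null A"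
| null_add: "s \<in> tensor_null A \<Longrightarrow> t \<in> tensor_null A \<Longrightarrow> s + t \<in> tensor_null A"
| null_add_left: "\<lbrakk>a \<in> carrier A; b \<in> carrier A; c \<in> carrier A\<rbrakk> \<Longrightarrow>
    Poly_Mapping.single (a \<oplus>\<^bsub>A\<^esub> b, c) z - Poly_Mapping.single (a, c) z
      - Poly_Mapping.single (b, c) z \<in> tensor_null A"
| null_add_right: "\<lbrakk>a \<in> carrier A; b \<in> carrier A; c \<in> carrier A\<rbrakk> \<Longrightarrow>
    Poly_Mapping.single (a, b \<oplus>\<^bsub>A\<^esub> c) z - Poly_Mapping.single (a, b) z
      - Poly_Mapping.single (a, c) z \<in> tensor_null A"
| null_smult_left: "\<lbrakk>a \<in> carrier A; b \<in> carrier A\<rbrakk> \<Longrightarrow>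
    Poly_Mapping.single (w \<odot>\<^bsub>A\<^esub> a, b) z - Poly_Mapping.single (a, b) (w * z) \<in> tensor_null A"
| null_smult_right: "\<lbrakk>a \<in> carrier A; b \<in> carrier A\<rbrakk> \<Longrightarrow>
    Poly_Mapping.single (a, w \<odot>\<^bsub>A\<^esub> b) z - Poly_Mapping.single (a, b) (w * z) \<in> tensor_null A"

definition tensor_class ::
  "(complex, 'a, 'm) module_scheme \<Rightarrow> (('a \<times> 'a) \<Rightarrow>\<^sub>0 complex) \<Rightarrow> (('a \<times> 'a) \<Rightarrow>\<^sub>0 complex) set" where
  "tensor_class A t = {t'. t' - t \<in> tensor_null A}"

record 'h hopf_alg = "(complex, 'h) module" +
  comult :: "'h \<Rightarrow> (('h \<times> 'h) \<Rightarrow>\<^sub>0 complex) set"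
  counit :: "'h \<Rightarrow> complex"
  antipode :: "'h \<Rightarrow> 'h"

datatype uq_gen = Gk | Gki | Ge | Gf

definition uq_relators :: "complex \<Rightarrow> (uq_gen list \<Rightarrow>\<^sub>0 complex) set" where
  "uq_relators q =
    {word [Gki, Gk] - 1,
     word [Gk, Gki] - 1,
     word [Gk, Ge] - scalar (q\<^sup>2) * word [Ge, Gk],
     word [Gk, Gf] - scalar (inverse (q\<^sup>2)) * word [Gf, Gk],
     word [Ge, Gf] - word [Gf, Ge] - scalar (1 / (q - inverse q)) * (word [Gk] - word [Gki])}"

abbreviation uq_class ::
  "complex \<Rightarrow> (uq_gen list \<Rightarrow>\<^sub>0 complex) \<Rightarrow> (uq_gen list \<Rightarrow>\<^sub>0 complex) set" where
  "uq_class q \<equiv> rel_class (uq_relators q)"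

definition uq_algebra :: "complex \<Rightarrow> (complex, (uq_gen list \<Rightarrow>\<^sub>0 complex) set) module" where
  "uq_algebra q = presented_algebra (uq_relators q)"

primrec gen_comult :: "uq_gen \<Rightarrow> ((uq_gen list \<times> uq_gen list) \<Rightarrow>\<^sub>0 complex)" where
  "gen_comult Gk = Poly_Mapping.single ([Gk], [Gk]) 1"
| "gen_comult Gki = Poly_Mapping.single ([Gki], [Gki]) 1"
| "gen_comult Ge = Poly_Mapping.single ([], [Ge]) 1 + Poly_Mapping.single ([Ge], [Gk]) 1"
| "gen_comult Gf = Poly_Mapping.single ([Gf], []) 1 + Poly_Mapping.single ([Gki], [Gf]) 1"

primrec gen_counit :: "uq_gen \<Rightarrow> complex" where
  "gen_counit Gk = 1"
| "gen_counit Gki = 1"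
| "gen_counit Ge = 0"
| "gen_counit Gf = 0"

primrec gen_antipode :: "uq_gen \<Rightarrow> (uq_gen list \<Rightarrow>\<^sub>0 complex)" where
  "gen_antipode Gk = word [Gki]"
| "gen_antipode Gki = word [Gk]"
| "gen_antipode Ge = - word [Ge, Gki]"
| "gen_antipode Gf = - word [Gk, Gf]"

definition uq_tensor ::
  "complex \<Rightarrow> ((uq_gen list \<times> uq_gen list) \<Rightarrow>\<^sub>0 complex) \<Rightarrow>
    (((uq_gen list \<Rightarrow>\<^sub>0 complex) set \<times> (uq_gen list \<Rightarrow>\<^sub>0 complex) set) \<Rightarrow>\<^sub>0 complex)" where
  "uq_tensor q t =
    (\<Sum>(u, v) \<in> Poly_Mapping.keys t.
       Poly_Mapping.single (uq_class q (word u), uq_class q (word v)) (Poly_Mapping.lookup t (u, v)))"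

text \<open>The structure maps are those induced on cosets by the (anti)homomorphic extensions to the
  free algebra of the maps given on generators: the unions below, over the representatives of a
  coset, are unions of equal cosets.\<close>

definition uq_sl2 :: "complex \<Rightarrow> (uq_gen list \<Rightarrow>\<^sub>0 complex) set hopf_alg" where
  "uq_sl2 q = module.extend (uq_algebra q)
    (hopf_alg.fields
      (\<lambda>h. \<Union>p \<in> h. tensor_class (uq_algebra q) (uq_tensor q (free_ext scalar gen_comult p)))
      (\<lambda>h. the_elem (free_ext (\<lambda>c. c) gen_counit ` h))
      (\<lambda>h. \<Union>p \<in> h. uq_class q (free_anti_ext scalar gen_antipode p)))"

definition uq_k :: "complex \<Rightarrow> (uq_gen list \<Rightarrow>\<^sub>0 complex) set" where
  "uq_k q = uq_class q (word [Gk])"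

definition uq_e :: "complex \<Rightarrow> (uq_gen list \<Rightarrow>\<^sub>0 complex) set" where
  "uq_e q = uq_class q (word [Ge])"

definition uq_f :: "complex \<Rightarrow> (uq_gen list \<Rightarrow>\<^sub>0 complex) set" where
  "uq_f q = uq_class q (word [Gf])"

text \<open>In the first condition \<open>t\<close> runs over all expressions \<open>\<Sum>\<^sub>i z\<^sub>i (h'\<^sub>i \<otimes> h''\<^sub>i)\<close> that
  represent \<open>\<Delta>(h)\<close>.\<close>

definition module_algebra_structures ::
  "'h hopf_alg \<Rightarrow> (complex, 'a, 'm) module_scheme \<Rightarrow> ('h \<Rightarrow> 'a \<Rightarrow> 'a) set" where
  "module_algebra_structures H A =
    {\<pi> \<in> alg_hom H (End_algebra A) \<inter> extensional (carrier H).
      (\<forall>h \<in> carrier H. \<forall>t \<in> comult H h. \<forall>a \<in> carrier A. \<forall>b \<in> carrier A.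
         \<pi> h (a \<otimes>\<^bsub>A\<^esub> b) =
           finsum A
             (\<lambda>(h', h''). Poly_Mapping.lookup t (h', h'') \<odot>\<^bsub>A\<^esub> (\<pi> h' a \<otimes>\<^bsub>A\<^esub> \<pi> h'' b))
             (Poly_Mapping.keys t)) \<and>
      (\<forall>h \<in> carrier H. \<pi> h \<one>\<^bsub>A\<^esub> = counit H h \<odot>\<^bsub>A\<^esub> \<one>\<^bsub>A\<^esub>)}"

definition isomorphic_structures ::
  "'h hopf_alg \<Rightarrow> (complex, 'a, 'm) module_scheme \<Rightarrow>
    ('h \<Rightarrow> 'a \<Rightarrow> 'a) \<Rightarrow> ('h \<Rightarrow> 'a \<Rightarrow> 'a) \<Rightarrow> bool" where
  "isomorphic_structures H A \<pi>\<^sub>1 \<pi>\<^sub>2 \<longleftrightarrow>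
    (\<exists>\<Psi> \<in> alg_aut A. \<forall>h \<in> carrier H. \<forall>a \<in> carrier A.
       \<Psi> (\<pi>\<^sub>1 h (inv_into (carrier A) \<Psi> a)) = \<pi>\<^sub>2 h a)"

type_synonym qp_structure =
  "(uq_gen list \<Rightarrow>\<^sub>0 complex) set \<Rightarrow> (qp_gen list \<Rightarrow>\<^sub>0 complex) set \<Rightarrow> (qp_gen list \<Rightarrow>\<^sub>0 complex) set"

abbreviation qp_structures :: "complex \<Rightarrow> qp_structure set" where
  "qp_structures q \<equiv> module_algebra_structures (uq_sl2 q) (qplane q)"

definition struct_S :: "complex \<Rightarrow> qp_structure set" where
  "struct_S q =
    {\<pi> \<in> qp_structures q.
      hpart q 0 (\<pi> (uq_e q) (qp_x q)) \<noteq> \<zero>\<^bsub>qplane q\<^esub> \<and>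
      hpart q 0 (\<pi> (uq_e q) (qp_y q)) = \<zero>\<^bsub>qplane q\<^esub> \<and>
      hpart q 0 (\<pi> (uq_f q) (qp_x q)) = \<zero>\<^bsub>qplane q\<^esub> \<and>
      hpart q 0 (\<pi> (uq_f q) (qp_y q)) = \<zero>\<^bsub>qplane q\<^esub> \<and>
      hpart q 1 (\<pi> (uq_e q) (qp_x q)) = \<zero>\<^bsub>qplane q\<^esub> \<and>
      hpart q 1 (\<pi> (uq_e q) (qp_y q)) = \<zero>\<^bsub>qplane q\<^esub> \<and>
      hpart q 1 (\<pi> (uq_f q) (qp_x q)) = \<zero>\<^bsub>qplane q\<^esub> \<and>
      hpart q 1 (\<pi> (uq_f q) (qp_y q)) = \<zero>\<^bsub>qplane q\<^esub>}"

definition iso_rel_S :: "complex \<Rightarrow> (qp_structure \<times> qp_structure) set" where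
  "iso_rel_S q =
    {(\<pi>\<^sub>1, \<pi>\<^sub>2). \<pi>\<^sub>1 \<in> struct_S q \<and> \<pi>\<^sub>2 \<in> struct_S q \<and>
       isomorphic_structures (uq_sl2 q) (qplane q) \<pi>\<^sub>1 \<pi>\<^sub>2}"

definition has_values :: "complex \<Rightarrow> complex \<times> complex \<times> complex \<Rightarrow> qp_structure \<Rightarrow> bool" where
  "has_values q = (\<lambda>(a\<^sub>0, s, t) \<pi>.
    \<pi> (uq_k q) (qp_x q) = inverse (q\<^sup>2) \<odot>\<^bsub>qplane q\<^esub> qp_x q \<and>
    \<pi> (uq_k q) (qp_y q) = inverse q \<odot>\<^bsub>qplane q\<^esub> qp_y q \<and>
    \<pi> (uq_e q) (qp_x q) = a\<^sub>0 \<odot>\<^bsub>qplane q\<^esub> \<one>\<^bsub>qplane q\<^esub> \<and>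
    \<pi> (uq_e q) (qp_y q) = \<zero>\<^bsub>qplane q\<^esub> \<and>
    \<pi> (uq_f q) (qp_x q) =
      ((- q * inverse a\<^sub>0) \<odot>\<^bsub>qplane q\<^esub> qp_mon q 2 0) \<oplus>\<^bsub>qplane q\<^esub> (t \<odot>\<^bsub>qplane q\<^esub> qp_mon q 0 4) \<and>
    \<pi> (uq_f q) (qp_y q) =
      ((- q * inverse a\<^sub>0) \<odot>\<^bsub>qplane q\<^esub> qp_mon q 1 1) \<oplus>\<^bsub>qplane q\<^esub> (s \<odot>\<^bsub>qplane q\<^esub> qp_mon q 0 3))"

definition params :: "(complex \<times> complex \<times> complex) set" where
  "params = {(a\<^sub>0, s, t). a\<^sub>0 \<noteq> 0}"

definition family :: "complex \<Rightarrow> complex \<times> complex \<times> complex \<Rightarrow> qp_structure" where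
  "family q p = (THE \<pi>. \<pi> \<in> qp_structures q \<and> has_values q p \<pi>)"

definition phi :: "complex \<times> complex \<times> complex \<Rightarrow> complex" where
  "phi = (\<lambda>(a\<^sub>0, s, t). t / (a\<^sub>0 * s\<^sup>2))"

definition generic_domain :: "(complex \<times> complex \<times> complex) set" where
  "generic_domain = {(a\<^sub>0, s, t) \<in> params. s \<noteq> 0 \<and> t \<noteq> 0}"

definition generic_subsets :: "(complex \<times> complex \<times> complex) set set" where
  "generic_subsets = {{p \<in> generic_domain. phi p = c} | c. c \<in> phi ` generic_domain}"

definition special_subsets :: "(complex \<times> complex \<times> complex) set set" where
  "special_subsets =
    {{(a\<^sub>0, s, t) \<in> params. s \<noteq> 0 \<and> t = 0},
     {(a\<^sub>0, s, t) \<in> params. s = 0 \<and> t \<noteq> 0},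
     {(a\<^sub>0, s, t) \<in> params. s = 0 \<and> t = 0}}"

end

theory Submission
  imports Defs "HOL-Library.Product_Lexorder" "HOL-Analysis.Continuum_Not_Denumerable"
begin

text \<open>
  In the basis of monomials \<open>x\<^sup>m y\<^sup>n\<close> the quantum plane becomes the space of finitely supported
  functions on \<open>\<nat> \<times> \<nat>\<close> with a twisted product. The coproduct is multiplicative, so a module algebra
  structure amounts to linear operators \<open>k, k\<inverse>, e, f\<close> on this space that satisfy the relations of
  the Hopf algebra, are algebra endomorphisms (\<open>k, k\<inverse>\<close>) or obey the skew Leibniz rules
  \<open>e(ab) = a e(b) + e(a) k(b)\<close> and \<open>f(ab) = f(a) b + k\<inverse>(a) f(b)\<close>. This dictionary consists of
  \<open>structure_of_action\<close>, \<open>action_of_structure\<close> and \<open>structure_eqI\<close>. By the Leibniz rules the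
  operators are determined by their values on \<open>x\<close> and \<open>y\<close> (\<open>uq_action_eqI\<close>).

  The operator \<open>k\<close> is an automorphism. When \<open>q\<close> is not a root of unity, every automorphism only
  rescales \<open>x\<close> and \<open>y\<close> (\<open>automorphism_diagonal\<close>): it preserves normal elements, \<open>x\<close> and \<open>y\<close> are
  normal, and a nonzero normal element is a multiple of a single monomial. Hence monomials are
  weight vectors for \<open>k\<close>. A nonzero constant term of \<open>e(x)\<close> forces the weight of \<open>x\<close> to be
  \<open>q\<^sup>-\<^sup>2\<close>, and \<open>e(yx) = q e(xy)\<close> forces that of \<open>y\<close> to be \<open>q\<^sup>-\<^sup>1\<close>, as \<open>e(y)\<close> has no constant
  term. Now \<open>e\<close> multiplies weights by
  \<open>q\<^sup>2\<close> and \<open>f\<close> divides them by \<open>q\<^sup>2\<close>, so only finitely many monomials can occur in \<open>e(x), e(y), f(x), f(y)\<close>,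
  and the relations \<open>f(yx) = q f(xy)\<close> and \<open>ef - fe = (k - k\<inverse>)/(q - q\<inverse>)\<close> leave the three
  parameters \<open>a\<^sub>0, s, t\<close> (\<open>classification\<close>). Conversely, each triple gives operators with closed
  formulas on monomials, for which the relations are identities between rational functions of
  \<open>q, q\<^sup>m, q\<^sup>n\<close> (\<open>uq_action_fam\<close>).

  An isomorphism is again a rescaling \<open>x \<mapsto> \<alpha> x, y \<mapsto> \<beta> y\<close>, and it carries \<open>(a\<^sub>0, s, t)\<close> to
  \<open>(a\<^sub>0/\<alpha>, s \<beta>\<^sup>2, t \<beta>\<^sup>4/\<alpha>)\<close> (\<open>intertwiner_iff\<close>). The orbits are read off from this
  (\<open>orbit_iff\<close>): the vanishing of \<open>s\<close> and of \<open>t\<close> is invariant, so is \<open>t/(a\<^sub>0 s\<^sup>2)\<close> when \<open>s \<noteq> 0\<close>,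
  and square roots of complex numbers connect any two triples with the same invariants.
\<close>

section \<open>Linear extension from a basis\<close>

text \<open>Extension from a basis is needed with values in a free algebra or its tensor square, where the
  scalar \<open>c\<close> is \<open>c\<close> times the unit, and with values in the complex numbers themselves, for the
  counit. The parameter \<open>\<iota>\<close> covers these cases at once.\<close>

locale unit_map =
  fixes \<iota> :: "complex \<Rightarrow> 'b::ring_1"
  assumes unit_add: "\<iota> (a + b) = \<iota> a + \<iota> b"
    and unit_mult: "\<iota> (a * b) = \<iota> a * \<iota> b"
    and unit_central: "\<iota> a * z = z * \<iota> a"
begin

lemma unit_left_commute: "a * (\<iota> c * b) = \<iota> c * (a * b)"
  using unit_central[of c a] by (metis mult.assoc)

lemma unit_zero: "\<iota> 0 = 0"
  using unit_add[of 0 0] by simp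

end

lemma poly_mapping_expand: "p = (\<Sum>i\<in>Poly_Mapping.keys p. Poly_Mapping.single i (Poly_Mapping.lookup p i))"
  by (rule poly_mapping_eqI)
    (simp add: lookup_sum lookup_single when_def not_in_keys_iff_lookup_eq_zero)

lemma poly_mapping_additive_induct [case_names single add]:
  assumes "\<And>i c. Q (Poly_Mapping.single i (c::complex))"
    and "\<And>p r. Q p \<Longrightarrow> Q r \<Longrightarrow> Q (p + r)"
  shows "Q p"
proof -
  have "Q (\<Sum>i\<in>I. Poly_Mapping.single i (Poly_Mapping.lookup p i))" if "finite I" for I
    using that
  proof (induction I)
    case empty
    show ?case using assms(1)[of undefined 0] by simp
  next
    case (insert i I)
    then show ?case by (simp add: assms)
  qed
  then show ?thesis
    by (subst poly_mapping_expand) simp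
qed

lemma scalar_mult_single:
  "scalar c * Poly_Mapping.single i d = Poly_Mapping.single i (c * d)"
  by (simp add: mult_single)

lemma lookup_scalar_mult:
  "Poly_Mapping.lookup (scalar c * p) i = c * Poly_Mapping.lookup p i"
proof (induction p rule: poly_mapping_additive_induct)
  case (single j d)
  then show ?case by (simp add: mult_single lookup_single when_def)
next
  case (add p r)
  then show ?case by (simp add: distrib_left lookup_add)
qed

lemma scalar_unit_map: "unit_map (Poly_Mapping.single (0::'m::monoid_add))"
proof
  fix a :: complex and z :: "'m \<Rightarrow>\<^sub>0 complex"
  show "scalar a * z = z * scalar a"
  proof (induction z rule: poly_mapping_additive_induct)
    case (single i d)
    then show ?case by (simp add: mult_single mult.commute)
  next
    case (add p r)
    then show ?case by (simp add: distrib_left distrib_right)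
  qed
qed (simp_all add: single_add mult_single)

lemma scalar_scalar: "scalar c * (scalar d * p) = scalar (c * d) * p"
  by (simp add: mult.assoc[symmetric] mult_single)

lemma complex_unit_map: "unit_map (\<lambda>c::complex. c)"
  unfolding unit_map_def by auto

definition lin_ext :: "(complex \<Rightarrow> 'b::ring_1) \<Rightarrow> ('i \<Rightarrow> 'b) \<Rightarrow> ('i \<Rightarrow>\<^sub>0 complex) \<Rightarrow> 'b" where
  "lin_ext \<iota> g p = (\<Sum>i\<in>Poly_Mapping.keys p. \<iota> (Poly_Mapping.lookup p i) * g i)"

context unit_map
begin

lemma lin_ext_superset:
  assumes "finite I" "Poly_Mapping.keys p \<subseteq> I"
  shows "lin_ext \<iota> g p = (\<Sum>i\<in>I. \<iota> (Poly_Mapping.lookup p i) * g i)"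
  unfolding lin_ext_def
  by (rule sum.mono_neutral_left[OF assms])
    (simp add: unit_zero in_keys_iff)

lemma lin_ext_add: "lin_ext \<iota> g (p + r) = lin_ext \<iota> g p + lin_ext \<iota> g r"
proof -
  let ?I = "Poly_Mapping.keys p \<union> Poly_Mapping.keys r"
  have "lin_ext \<iota> g (p + r) = (\<Sum>i\<in>?I. \<iota> (Poly_Mapping.lookup (p + r) i) * g i)"
    by (rule lin_ext_superset) (simp_all add: keys_add)
  also have "\<dots> = (\<Sum>i\<in>?I. \<iota> (Poly_Mapping.lookup p i) * g i)
      + (\<Sum>i\<in>?I. \<iota> (Poly_Mapping.lookup r i) * g i)"
    by (simp add: lookup_add unit_add distrib_right sum.distrib)
  also have "\<dots> = lin_ext \<iota> g p + lin_ext \<iota> g r"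
    using lin_ext_superset[of ?I p g] lin_ext_superset[of ?I r g] by simp
  finally show ?thesis .
qed

lemma lin_ext_zero [simp]: "lin_ext \<iota> g 0 = 0"
  by (simp add: lin_ext_def)

lemma lin_ext_single: "lin_ext \<iota> g (Poly_Mapping.single i c) = \<iota> c * g i"
  by (simp add: lin_ext_def unit_zero)

lemma lin_ext_uminus: "lin_ext \<iota> g (- p) = - lin_ext \<iota> g p"
  using lin_ext_add[of g p "- p"] by (simp add: eq_neg_iff_add_eq_0 add.commute)

lemma lin_ext_diff: "lin_ext \<iota> g (p - r) = lin_ext \<iota> g p - lin_ext \<iota> g r"
  using lin_ext_add[of g p "- r"] by (simp add: lin_ext_uminus)

lemma lin_ext_sum: "lin_ext \<iota> g (sum f I) = (\<Sum>i\<in>I. lin_ext \<iota> g (f i))"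
  by (induction I rule: infinite_finite_induct) (simp_all add: lin_ext_add)

lemma lin_ext_scalar: "lin_ext \<iota> g (scalar c * p) = \<iota> c * lin_ext \<iota> g p"
proof (induction p rule: poly_mapping_additive_induct)
  case (single i d)
  then show ?case by (simp add: scalar_mult_single lin_ext_single unit_mult mult.assoc)
next
  case (add p r)
  then show ?case by (simp add: distrib_left lin_ext_add)
qed

lemma lin_ext_plus_fun: "lin_ext \<iota> (\<lambda>i. g i + h i) p = lin_ext \<iota> g p + lin_ext \<iota> h p"
  by (simp add: lin_ext_def distrib_left sum.distrib)

lemma lin_ext_mult_fun: "lin_ext \<iota> (\<lambda>i. \<iota> c * g i) p = \<iota> c * lin_ext \<iota> g p"
  by (simp add: lin_ext_def sum_distrib_left unit_left_commute[of _ c])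

lemma free_ext_lin_ext: "free_ext \<iota> \<phi> p = lin_ext \<iota> (\<lambda>w. prod_list (map \<phi> w)) p"
  by (simp add: free_ext_def lin_ext_def)

lemma free_ext_mult: "free_ext \<iota> \<phi> (p * r) = free_ext \<iota> \<phi> p * free_ext \<iota> \<phi> r"
proof (induction p rule: poly_mapping_additive_induct)
  case (single u c)
  show ?case
  proof (induction r rule: poly_mapping_additive_induct)
    case (single v d)
    show ?case
      by (simp add: free_ext_lin_ext mult_single lin_ext_single plus_list_def unit_mult mult.assoc
          unit_left_commute[of _ d])
  next
    case (add r s)
    then show ?case by (simp add: free_ext_lin_ext distrib_left lin_ext_add)
  qed
next
  case (add p s)
  then show ?case by (simp add: free_ext_lin_ext distrib_right lin_ext_add)
qed

end

interpretation scalar: unit_map "Poly_Mapping.single (0::'m::monoid_add)"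
  by (rule scalar_unit_map)

definition clinear :: "(('m::monoid_add \<Rightarrow>\<^sub>0 complex) \<Rightarrow> ('n::monoid_add \<Rightarrow>\<^sub>0 complex)) \<Rightarrow> bool" where
  "clinear f \<longleftrightarrow> (\<forall>a b. f (a + b) = f a + f b) \<and> (\<forall>c a. f (scalar c * a) = scalar c * f a)"

lemma clinear_add: "clinear f \<Longrightarrow> f (a + b) = f a + f b"
  and clinear_scalar: "clinear f \<Longrightarrow> f (scalar c * a) = scalar c * f a"
  by (simp_all add: clinear_def)

lemma clinear_zero: "clinear f \<Longrightarrow> f 0 = 0"
  using clinear_scalar[of f 0 0] by simp

lemma clinear_uminus: "clinear f \<Longrightarrow> f (- a) = - f a"
  using clinear_add[of f a "- a"] clinear_zero[of f] by (simp add: eq_neg_iff_add_eq_0 add.commute)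

lemma clinear_diff: "clinear f \<Longrightarrow> f (a - b) = f a - f b"
  using clinear_add[of f a "- b"] clinear_uminus[of f b] by simp

lemma clinear_sum: "clinear f \<Longrightarrow> f (sum g I) = (\<Sum>i\<in>I. f (g i))"
  by (induction I rule: infinite_finite_induct) (simp_all add: clinear_zero clinear_add)

lemma clinear_single:
  assumes "clinear f"
  shows "f (Poly_Mapping.single i c) = scalar c * f (Poly_Mapping.single i 1)"
  using clinear_scalar[OF assms, of c "Poly_Mapping.single i 1"] by (simp add: scalar_mult_single)

lemma clinear_lin_ext: "clinear (lin_ext (Poly_Mapping.single 0) g)"
  by (simp add: clinear_def scalar.lin_ext_add scalar.lin_ext_scalar)

lemma clinear_eqI:
  assumes "clinear f" "clinear g"
    and "\<And>i. f (Poly_Mapping.single i 1) = g (Poly_Mapping.single i 1)"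
  shows "f a = g a"
proof (induction a rule: poly_mapping_additive_induct)
  case (single i c)
  show ?case
    unfolding clinear_single[OF assms(1), of i c] clinear_single[OF assms(2), of i c] assms(3) ..
next
  case (add a b)
  then show ?case using assms by (simp add: clinear_add)
qed

lemma clinear_lin_ext_commute:
  assumes "clinear f"
  shows "f (lin_ext (Poly_Mapping.single 0) g p) = lin_ext (Poly_Mapping.single 0) (\<lambda>i. f (g i)) p"
  by (simp add: lin_ext_def clinear_sum[OF assms] clinear_scalar[OF assms])

lemma clinear_comp: "clinear f \<Longrightarrow> clinear g \<Longrightarrow> clinear (\<lambda>a. f (g a))"
  by (simp add: clinear_def)

lemma clinear_id: "clinear (\<lambda>a. a)"
  by (simp add: clinear_def)

lemma clinear_minus: "clinear f \<Longrightarrow> clinear g \<Longrightarrow> clinear (\<lambda>a. f a - g a)"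
  by (simp add: clinear_def algebra_simps)

lemma clinear_times: "clinear f \<Longrightarrow> clinear (\<lambda>a. scalar c * f a)"
  by (simp add: clinear_def distrib_left scalar_scalar mult.commute)

section \<open>Presented algebras\<close>

lemma free_algebra_sel [simp]:
  "carrier free_algebra = UNIV" "x \<otimes>\<^bsub>free_algebra\<^esub> y = x * y" "\<one>\<^bsub>free_algebra\<^esub> = 1"
  "\<zero>\<^bsub>free_algebra\<^esub> = 0" "x \<oplus>\<^bsub>free_algebra\<^esub> y = x + y" "c \<odot>\<^bsub>free_algebra\<^esub> x = scalar c * x"
  by (simp_all add: free_algebra_def)

lemma free_algebra_ring: "ring (free_algebra :: (complex, 'g list \<Rightarrow>\<^sub>0 complex) module)"
proof (rule ringI)
  show "abelian_group (free_algebra :: (complex, 'g list \<Rightarrow>\<^sub>0 complex) module)"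
    proof (rule abelian_groupI)
    fix x :: "'g list \<Rightarrow>\<^sub>0 complex"
    show "\<exists>y\<in>carrier free_algebra. y \<oplus>\<^bsub>free_algebra\<^esub> x = \<zero>\<^bsub>free_algebra\<^esub>"
      by (rule bexI[of _ "- x"]) simp_all
  qed (simp_all add: ac_simps)
  show "Group.monoid (free_algebra :: (complex, 'g list \<Rightarrow>\<^sub>0 complex) module)"
    by (rule monoidI) (auto simp: mult.assoc)
qed (auto simp: distrib_left distrib_right)

lemma rel_ideal_ideal: "ideal (rel_ideal R) free_algebra"
  unfolding rel_ideal_def by (rule ring.genideal_ideal[OF free_algebra_ring]) simp

lemma free_algebra_uminus [simp]: "\<ominus>\<^bsub>free_algebra\<^esub> x = - x"
proof -
  interpret ring "free_algebra" by (rule free_algebra_ring)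
  show ?thesis using minus_equality[of "- x" x] by simp
qed

lemma rel_ideal_superset: "R \<subseteq> rel_ideal R"
  unfolding rel_ideal_def by (rule ring.genideal_self[OF free_algebra_ring]) simp

lemma rel_ideal_add: "p \<in> rel_ideal R \<Longrightarrow> r \<in> rel_ideal R \<Longrightarrow> p + r \<in> rel_ideal R"
  using additive_subgroup.a_closed[OF ideal.axioms(1)[OF rel_ideal_ideal], of p R r] by simp

lemma rel_ideal_zero: "0 \<in> rel_ideal R"
  using additive_subgroup.zero_closed[OF ideal.axioms(1)[OF rel_ideal_ideal], of R] by simp

lemma rel_ideal_mult_left: "p \<in> rel_ideal R \<Longrightarrow> r * p \<in> rel_ideal R"
  and rel_ideal_mult_right: "p \<in> rel_ideal R \<Longrightarrow> p * r \<in> rel_ideal R"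
proof -
  interpret ideal "rel_ideal R" free_algebra by (rule rel_ideal_ideal)
  show "p \<in> rel_ideal R \<Longrightarrow> r * p \<in> rel_ideal R" "p \<in> rel_ideal R \<Longrightarrow> p * r \<in> rel_ideal R"
    using I_l_closed[of p r] I_r_closed[of p r] by simp_all
qed

lemma rel_ideal_uminus: "p \<in> rel_ideal R \<Longrightarrow> - p \<in> rel_ideal R"
  using rel_ideal_mult_left[of p R "- 1"] by simp

lemma rel_ideal_diff: "p \<in> rel_ideal R \<Longrightarrow> r \<in> rel_ideal R \<Longrightarrow> p - r \<in> rel_ideal R"
  using rel_ideal_add[of p R "- r"] rel_ideal_uminus[of r R] by simp

text \<open>The way to show that a linear functional or an action vanishes on the ideal of relations:
  its zero set is an ideal that contains the relators.\<close>

lemma rel_ideal_least: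
  assumes "R \<subseteq> S" "0 \<in> S" "\<And>p r. p \<in> S \<Longrightarrow> r \<in> S \<Longrightarrow> p + r \<in> S"
    and "\<And>p r. p \<in> S \<Longrightarrow> r * p \<in> S" "\<And>p r. p \<in> S \<Longrightarrow> p * r \<in> S"
  shows "rel_ideal R \<subseteq> S"
proof -
  have "- p \<in> S" if "p \<in> S" for p
    using assms(4)[OF that, of "- 1"] by simp
  then have "inv\<^bsub>add_monoid free_algebra\<^esub> p \<in> S" if "p \<in> S" for p
    using that by (simp only: a_inv_def[symmetric] free_algebra_uminus)
  then have "additive_subgroup S free_algebra"
    using assms by (intro additive_subgroup.intro subgroup.intro) auto
  then have "ideal S free_algebra"
    using assms by (intro idealI free_algebra_ring additive_subgroup.a_subgroup) auto
  then show ?thesis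
    unfolding rel_ideal_def by (rule ring.genideal_minimal[OF free_algebra_ring]) (rule assms)
qed

lemma mem_rel_class: "p \<in> rel_class R r \<longleftrightarrow> p - r \<in> rel_ideal R"
  unfolding rel_class_def a_r_coset_def' by (auto intro: bexI[of _ "p - r"])

lemma rel_class_eq_iff: "rel_class R p = rel_class R r \<longleftrightarrow> p - r \<in> rel_ideal R"
proof
  assume "rel_class R p = rel_class R r"
  then show "p - r \<in> rel_ideal R"
    using mem_rel_class[of p R r] mem_rel_class[of p R p] rel_ideal_zero by simp
next
  assume *: "p - r \<in> rel_ideal R"
  have "x - r \<in> rel_ideal R" if "x - p \<in> rel_ideal R" for x
    using rel_ideal_add[OF that *] by simp
  moreover have "x - p \<in> rel_ideal R" if "x - r \<in> rel_ideal R" for x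
    using rel_ideal_diff[OF that *] by simp
  ultimately show "rel_class R p = rel_class R r"
    by (auto simp: mem_rel_class)
qed

lemma rel_class_eqI: "p - r \<in> rel_ideal R \<Longrightarrow> rel_class R p = rel_class R r"
  by (simp add: rel_class_eq_iff)

text \<open>All later computations in a presented algebra are done on representatives, through these
  equations.\<close>

lemma presented_algebra_sel:
  shows presented_carrier: "carrier (presented_algebra R) = range (rel_class R)"
    and presented_mult: "rel_class R p \<otimes>\<^bsub>presented_algebra R\<^esub> rel_class R r = rel_class R (p * r)"
    and presented_add: "rel_class R p \<oplus>\<^bsub>presented_algebra R\<^esub> rel_class R r = rel_class R (p + r)"
    and presented_one: "\<one>\<^bsub>presented_algebra R\<^esub> = rel_class R 1"
    and presented_zero: "\<zero>\<^bsub>presented_algebra R\<^esub> = rel_class R 0"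
    and presented_smult: "c \<odot>\<^bsub>presented_algebra R\<^esub> rel_class R p = rel_class R (scalar c * p)"
proof -
  interpret ideal "rel_ideal R" free_algebra by (rule rel_ideal_ideal)
  note defs = presented_algebra_def quotient_algebra_def FactRing_def rel_class_def
  show "carrier (presented_algebra R) = range (rel_class R)"
    by (auto simp: defs A_RCOSETS_def' rel_class_def[abs_def])
  show "rel_class R p \<otimes>\<^bsub>presented_algebra R\<^esub> rel_class R r = rel_class R (p * r)"
    using rcoset_mult_add[of p r] by (simp add: defs)
  show "rel_class R p \<oplus>\<^bsub>presented_algebra R\<^esub> rel_class R r = rel_class R (p + r)"
    using a_rcos_sum[of p r] by (simp add: defs)
  show "\<one>\<^bsub>presented_algebra R\<^esub> = rel_class R 1"
    by (simp add: defs)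
  show "\<zero>\<^bsub>presented_algebra R\<^esub> = rel_class R 0"
    by (auto simp: defs a_r_coset_def')
  have "rel_class R (scalar c * x) = rel_class R (scalar c * p)" if "x \<in> rel_class R p" for x
    using that rel_ideal_mult_left[of "x - p" R "scalar c"]
    by (intro rel_class_eqI) (simp add: mem_rel_class right_diff_distrib)
  moreover have "p \<in> rel_class R p"
    by (simp add: mem_rel_class rel_ideal_zero)
  ultimately have "(\<Union>x\<in>rel_class R p. rel_class R (scalar c * x)) = rel_class R (scalar c * p)"
    by blast
  then show "c \<odot>\<^bsub>presented_algebra R\<^esub> rel_class R p = rel_class R (scalar c * p)"
    by (simp add: presented_algebra_def quotient_algebra_def rel_class_def[symmetric])
qed

lemma presented_algebra_ring: "ring (presented_algebra R)"
proof -
  interpret ideal "rel_ideal R" free_algebra by (rule rel_ideal_ideal)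
  have "ring (free_algebra Quot rel_ideal R)" by (rule quotient_is_ring)
  then interpret Q: ring "free_algebra Quot rel_ideal R" .
  have eq: "carrier (presented_algebra R) = carrier (free_algebra Quot rel_ideal R)"
    "monoid.mult (presented_algebra R) = monoid.mult (free_algebra Quot rel_ideal R)"
    "monoid.one (presented_algebra R) = monoid.one (free_algebra Quot rel_ideal R)"
    "ring.add (presented_algebra R) = ring.add (free_algebra Quot rel_ideal R)"
    "ring.zero (presented_algebra R) = ring.zero (free_algebra Quot rel_ideal R)"
    by (simp_all add: presented_algebra_def quotient_algebra_def)
  show ?thesis
  proof (rule ringI)
    show "abelian_group (presented_algebra R)"
      proof (rule abelian_groupI)
      fix x assume "x \<in> carrier (presented_algebra R)"
      then show "\<exists>y\<in>carrier (presented_algebra R). y \<oplus>\<^bsub>presented_algebra R\<^esub> x = \<zero>\<^bsub>presented_algebra R\<^esub>"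
        unfolding eq by (intro bexI[of _ "\<ominus>\<^bsub>free_algebra Quot rel_ideal R\<^esub> x"]) (auto simp: Q.l_neg)
    qed (auto simp: eq Q.a_ac)
    show "Group.monoid (presented_algebra R)"
      by (rule monoidI) (auto simp: eq Q.m_assoc)
  qed (auto simp: eq Q.l_distr Q.r_distr)
qed

lemma presented_minus:
  "rel_class R p \<ominus>\<^bsub>presented_algebra R\<^esub> rel_class R r = rel_class R (p - r)"
proof -
  interpret ring "presented_algebra R" by (rule presented_algebra_ring)
  have "\<ominus>\<^bsub>presented_algebra R\<^esub> rel_class R r = rel_class R (- r)"
    by (rule minus_equality) (simp_all add: presented_algebra_sel)
  then show ?thesis
    by (simp add: a_minus_def presented_algebra_sel)
qed

section \<open>The monomial basis of the quantum plane\<close>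

type_synonym qpoly = "nat \<times> nat \<Rightarrow>\<^sub>0 complex"

text \<open>The product of the quantum plane in coordinates: moving \<open>y\<^sup>n\<close> past \<open>x\<^sup>k\<close> costs the factor
  \<open>q\<^sup>n\<^sup>k\<close>. The product \<open>*\<close> that this type already carries is that of commuting variables; it is
  used only for multiplication by scalars.\<close>

definition qmul :: "complex \<Rightarrow> qpoly \<Rightarrow> qpoly \<Rightarrow> qpoly" where
  "qmul q a b = lin_ext (Poly_Mapping.single 0)
    (\<lambda>i. lin_ext (Poly_Mapping.single 0) (\<lambda>j. Poly_Mapping.single (i + j) (q ^ (snd i * fst j))) b) a"

lemma clinear_qmul_left: "clinear (\<lambda>a. qmul q a b)"
  unfolding qmul_def by (rule clinear_lin_ext)

lemma clinear_qmul_right: "clinear (qmul q a)"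
  unfolding clinear_def qmul_def
  by (simp add: scalar.lin_ext_add scalar.lin_ext_scalar scalar.lin_ext_plus_fun scalar.lin_ext_mult_fun)

lemma qmul_single:
  "qmul q (Poly_Mapping.single (m, n) c) (Poly_Mapping.single (k, l) d) =
    Poly_Mapping.single (m + k, n + l) (c * d * q ^ (n * k))"
  by (simp add: qmul_def scalar.lin_ext_single scalar_mult_single mult.assoc)

lemmas qmul_linear =
  clinear_add[OF clinear_qmul_left] clinear_add[OF clinear_qmul_right]
  clinear_scalar[OF clinear_qmul_left] clinear_scalar[OF clinear_qmul_right]
  clinear_diff[OF clinear_qmul_left] clinear_diff[OF clinear_qmul_right]
  clinear_zero[OF clinear_qmul_left] clinear_zero[OF clinear_qmul_right]

lemma clinear2_eqI:
  assumes "\<And>b. clinear (\<lambda>a. f a b)" "\<And>b. clinear (\<lambda>a. g a b)" "\<And>a. clinear (f a)" "\<And>a. clinear (g a)"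
    and "\<And>i j. f (Poly_Mapping.single i 1) (Poly_Mapping.single j 1)
      = g (Poly_Mapping.single i 1) (Poly_Mapping.single j 1)"
  shows "f a b = g a b"
proof -
  have "f (Poly_Mapping.single i 1) b = g (Poly_Mapping.single i 1) b" for i
    by (rule clinear_eqI[of "f (Poly_Mapping.single i 1)" "g (Poly_Mapping.single i 1)"])
      (rule assms)+
  then show ?thesis
    by (rule clinear_eqI[of "\<lambda>a. f a b" "\<lambda>a. g a b", OF assms(1,2)])
qed

lemma qmul_assoc: "qmul q (qmul q a b) c = qmul q a (qmul q b c)"
proof (rule clinear2_eqI[of "\<lambda>a b. qmul q (qmul q a b) c" "\<lambda>a b. qmul q a (qmul q b c)"])
  fix i j :: "nat \<times> nat"
  show "qmul q (qmul q (Poly_Mapping.single i 1) (Poly_Mapping.single j 1)) c =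
    qmul q (Poly_Mapping.single i 1) (qmul q (Poly_Mapping.single j 1) c)"
  proof (rule clinear_eqI[of "qmul q (qmul q (Poly_Mapping.single i 1) (Poly_Mapping.single j 1))"
        "\<lambda>c. qmul q (Poly_Mapping.single i 1) (qmul q (Poly_Mapping.single j 1) c)"])
    fix k :: "nat \<times> nat"
    show "qmul q (qmul q (Poly_Mapping.single i 1) (Poly_Mapping.single j 1)) (Poly_Mapping.single k 1) =
      qmul q (Poly_Mapping.single i 1) (qmul q (Poly_Mapping.single j 1) (Poly_Mapping.single k 1))"
      by (cases i; cases j; cases k) (simp add: qmul_single power_add algebra_simps)
  qed (simp_all add: clinear_def qmul_linear)
qed (simp_all add: clinear_def qmul_linear)

lemma qpoly_one: "(1::qpoly) = Poly_Mapping.single (0, 0) 1"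
  by (simp add: zero_prod_def[symmetric])

lemma qmul_one_left: "qmul q 1 a = a"
proof (rule clinear_eqI[of "qmul q 1" "\<lambda>a. a", OF clinear_qmul_right clinear_id])
  fix i :: "nat \<times> nat"
  show "qmul q 1 (Poly_Mapping.single i 1) = Poly_Mapping.single i 1"
    unfolding qpoly_one by (cases i) (simp add: qmul_single)
qed

lemma qmul_one_right: "qmul q a 1 = a"
proof (rule clinear_eqI[of "\<lambda>a. qmul q a 1" "\<lambda>a. a", OF clinear_qmul_left clinear_id])
  fix i :: "nat \<times> nat"
  show "qmul q (Poly_Mapping.single i 1) 1 = Poly_Mapping.single i 1"
    unfolding qpoly_one by (cases i) (simp add: qmul_single)
qed

text \<open>Normal ordering: the coordinates of a word, obtained by moving every \<open>y\<close> to the right.\<close>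

primrec nf_word :: "complex \<Rightarrow> qp_gen list \<Rightarrow> qpoly" where
  "nf_word q [] = 1"
| "nf_word q (g # w) =
    qmul q (Poly_Mapping.single (case g of Gx \<Rightarrow> (1, 0) | Gy \<Rightarrow> (0, 1)) 1) (nf_word q w)"

definition nf :: "complex \<Rightarrow> (qp_gen list \<Rightarrow>\<^sub>0 complex) \<Rightarrow> qpoly" where
  "nf q = lin_ext (Poly_Mapping.single 0) (nf_word q)"

lemma clinear_nf: "clinear (nf q)"
  unfolding nf_def by (rule clinear_lin_ext)

lemma nf_word_append: "nf_word q (u @ v) = qmul q (nf_word q u) (nf_word q v)"
  by (induction u) (simp_all add: qmul_one_left qmul_assoc)

lemma nf_single: "nf q (Poly_Mapping.single w c) = scalar c * nf_word q w"
  by (simp add: nf_def scalar.lin_ext_single)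

lemma nf_mult: "nf q (p * r) = qmul q (nf q p) (nf q r)"
proof (rule clinear2_eqI[of "\<lambda>p r. nf q (p * r)" "\<lambda>p r. qmul q (nf q p) (nf q r)"])
  fix i j :: "qp_gen list"
  show "nf q (Poly_Mapping.single i 1 * Poly_Mapping.single j 1) =
    qmul q (nf q (Poly_Mapping.single i 1)) (nf q (Poly_Mapping.single j 1))"
    by (simp add: mult_single plus_list_def nf_single nf_word_append)
qed (simp_all add: clinear_def qmul_linear clinear_add[OF clinear_nf] clinear_scalar[OF clinear_nf]
    distrib_left distrib_right mult.assoc scalar.unit_left_commute)

lemma nf_rel_ideal:
  assumes "p \<in> rel_ideal (qp_relators q)"
  shows "nf q p = 0"
proof -
  have "rel_ideal (qp_relators q) \<subseteq> {p. nf q p = 0}"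
  proof (rule rel_ideal_least)
    show "qp_relators q \<subseteq> {p. nf q p = 0}"
      by (simp add: qp_relators_def clinear_diff[OF clinear_nf] clinear_scalar[OF clinear_nf]
          nf_single qmul_one_right qmul_single scalar_mult_single)
  qed (simp_all add: clinear_zero[OF clinear_nf] clinear_add[OF clinear_nf] nf_mult qmul_linear)
  then show ?thesis using assms by blast
qed

definition mono_word :: "nat \<times> nat \<Rightarrow> qp_gen list" where
  "mono_word = (\<lambda>(m, n). replicate m Gx @ replicate n Gy)"

definition lift_mono :: "qpoly \<Rightarrow> (qp_gen list \<Rightarrow>\<^sub>0 complex)" where
  "lift_mono = lin_ext (Poly_Mapping.single 0) (\<lambda>i. word (mono_word i))"

lemma clinear_lift_mono: "clinear lift_mono"
  unfolding lift_mono_def by (rule clinear_lin_ext)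

lemma lift_mono_single: "lift_mono (Poly_Mapping.single i c) = Poly_Mapping.single (mono_word i) c"
  by (simp add: lift_mono_def scalar.lin_ext_single scalar_mult_single)

lemma nf_mono_word: "nf_word q (mono_word i) = Poly_Mapping.single i 1"
proof -
  have "nf_word q (replicate m Gx) = Poly_Mapping.single (m, 0) 1" for m
    by (induction m) (simp_all add: qmul_single qpoly_one)
  moreover have "nf_word q (replicate m Gy) = Poly_Mapping.single (0, m) 1" for m
    by (induction m) (simp_all add: qmul_single qpoly_one)
  ultimately show ?thesis
    by (cases i) (simp add: mono_word_def nf_word_append qmul_single)
qed

lemma nf_lift_mono: "nf q (lift_mono a) = a"
  by (rule clinear_eqI[of "\<lambda>a. nf q (lift_mono a)" "\<lambda>a. a"])
    (simp_all add: clinear_comp[OF clinear_nf clinear_lift_mono] clinear_id lift_mono_single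
      nf_single nf_mono_word)

lemma y_past_x_power:
  "word (Gy # replicate m Gx) - scalar (q ^ m) * word (replicate m Gx @ [Gy])
    \<in> rel_ideal (qp_relators q)"
proof (induction m)
  case 0
  then show ?case by (simp add: rel_ideal_zero)
next
  case (Suc m)
  let ?I = "rel_ideal (qp_relators q)"
  have "word [Gy, Gx] - scalar q * word [Gx, Gy] \<in> ?I"
    using rel_ideal_superset[of "qp_relators q"] by (auto simp: qp_relators_def)
  then have 1: "(word [Gy, Gx] - scalar q * word [Gx, Gy]) * word (replicate m Gx) \<in> ?I"
    by (rule rel_ideal_mult_right)
  have 2: "scalar q * (word [Gx] * (word (Gy # replicate m Gx)
      - scalar (q ^ m) * word (replicate m Gx @ [Gy]))) \<in> ?I"
    by (intro rel_ideal_mult_left Suc)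
  show ?case
    using rel_ideal_add[OF 1 2]
    by (simp add: left_diff_distrib right_diff_distrib mult_single plus_list_def zero_list_def)
qed

text \<open>The monomials span the quotient. Together with \<open>nf_rel_ideal\<close>, which gives their independence,
  this makes \<open>nf\<close> an isomorphism from the quotient onto the coordinate space.\<close>

lemma lift_mono_nf: "lift_mono (nf q p) - p \<in> rel_ideal (qp_relators q)"
proof -
  let ?I = "rel_ideal (qp_relators q)"
  have step: "lift_mono (qmul q (Poly_Mapping.single (case g of Gx \<Rightarrow> (1, 0) | Gy \<Rightarrow> (0, 1)) 1) a)
      - word [g] * lift_mono a \<in> ?I" for g a
  proof (induction a rule: poly_mapping_additive_induct)
    case (single i c)
    obtain m n where i: "i = (m, n)" by (cases i)
    show ?case
    proof (cases g)
      case Gx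
      then show ?thesis
        by (simp add: i qmul_single lift_mono_single mono_word_def mult_single plus_list_def rel_ideal_zero)
    next
      case Gy
      have "- (scalar c * (word (Gy # replicate m Gx) - scalar (q ^ m) * word (replicate m Gx @ [Gy]))
          * word (replicate n Gy)) \<in> ?I"
        by (intro rel_ideal_uminus rel_ideal_mult_left rel_ideal_mult_right y_past_x_power)
      then show ?thesis
        by (simp add: Gy i qmul_single lift_mono_single mono_word_def mult_single plus_list_def zero_list_def
            left_diff_distrib right_diff_distrib)
    qed
  next
    case (add a b)
    then show ?case
      using rel_ideal_add[OF add] by (simp add: qmul_linear clinear_add[OF clinear_lift_mono] algebra_simps)
  qed
  have word: "lift_mono (nf_word q w) - word w \<in> ?I" for w
  proof (induction w)
    case Nil
    show ?case
      unfolding nf_word.simps qpoly_one by (simp add: lift_mono_single mono_word_def rel_ideal_zero)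
  next
    case (Cons g w)
    have "word [g] * (lift_mono (nf_word q w) - word w) \<in> ?I"
      by (intro rel_ideal_mult_left Cons)
    from rel_ideal_add[OF step[of g "nf_word q w"] this] show ?case
      by (simp add: right_diff_distrib mult_single plus_list_def zero_list_def)
  qed
  show ?thesis
  proof (induction p rule: poly_mapping_additive_induct)
    case (single w c)
    have "scalar c * (lift_mono (nf_word q w) - word w) \<in> ?I"
      by (intro rel_ideal_mult_left word)
    then show ?case
      by (simp add: nf_single clinear_scalar[OF clinear_lift_mono] right_diff_distrib mult_single)
  next
    case (add p r)
    then show ?case
      using rel_ideal_add[OF add]
      by (simp add: clinear_add[OF clinear_nf] clinear_add[OF clinear_lift_mono] algebra_simps)
  qed
qed

definition emb :: "complex \<Rightarrow> qpoly \<Rightarrow> (qp_gen list \<Rightarrow>\<^sub>0 complex) set" where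
  "emb q a = rel_class (qp_relators q) (lift_mono a)"

definition coord :: "complex \<Rightarrow> (qp_gen list \<Rightarrow>\<^sub>0 complex) set \<Rightarrow> qpoly" where
  "coord q = inv_into UNIV (emb q)"

lemma rel_class_emb: "rel_class (qp_relators q) p = emb q (nf q p)"
  unfolding emb_def rel_class_eq_iff using rel_ideal_uminus[OF lift_mono_nf[of q p]] by simp

lemma emb_eq_iff: "emb q a = emb q b \<longleftrightarrow> a = b"
proof
  assume "emb q a = emb q b"
  then have "nf q (lift_mono a - lift_mono b) = 0"
    unfolding emb_def rel_class_eq_iff by (rule nf_rel_ideal)
  then show "a = b"
    by (simp add: clinear_diff[OF clinear_nf] nf_lift_mono)
qed simp

lemma coord_emb [simp]: "coord q (emb q a) = a"
  unfolding coord_def by (rule inv_f_f) (simp add: inj_def emb_eq_iff)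

lemma qplane_carrier: "carrier (qplane q) = range (emb q)"
proof -
  have "range (rel_class (qp_relators q)) = range (emb q)"
  proof (rule equalityI)
    show "range (rel_class (qp_relators q)) \<subseteq> range (emb q)" by (auto simp: rel_class_emb)
    show "range (emb q) \<subseteq> range (rel_class (qp_relators q))" by (auto simp: emb_def)
  qed
  then show ?thesis by (simp add: qplane_def presented_carrier)
qed

lemma emb_carrier [simp]: "emb q a \<in> carrier (qplane q)"
  by (simp add: qplane_carrier)

lemma emb_coord: "X \<in> carrier (qplane q) \<Longrightarrow> emb q (coord q X) = X"
  by (auto simp: qplane_carrier)

lemma emb_mult: "emb q a \<otimes>\<^bsub>qplane q\<^esub> emb q b = emb q (qmul q a b)"
  using presented_mult[of "qp_relators q" "lift_mono a" "lift_mono b"]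
  by (simp add: qplane_def rel_class_emb nf_mult nf_lift_mono)

lemma emb_add: "emb q a \<oplus>\<^bsub>qplane q\<^esub> emb q b = emb q (a + b)"
  by (simp add: qplane_def emb_def presented_add clinear_add[OF clinear_lift_mono])

lemma emb_minus: "emb q a \<ominus>\<^bsub>qplane q\<^esub> emb q b = emb q (a - b)"
  by (simp add: qplane_def emb_def presented_minus clinear_diff[OF clinear_lift_mono])

lemma emb_smult: "c \<odot>\<^bsub>qplane q\<^esub> emb q a = emb q (scalar c * a)"
  by (simp add: qplane_def emb_def presented_smult clinear_scalar[OF clinear_lift_mono])

lemma nf_one: "nf q 1 = 1"
proof -
  have "nf_word q 0 = 1" by (simp add: zero_list_def)
  then show ?thesis using nf_single[of q 0 1] by simp
qed

lemma emb_one: "\<one>\<^bsub>qplane q\<^esub> = emb q 1"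
  by (simp add: qplane_def presented_one rel_class_emb nf_one)

lemma emb_zero: "\<zero>\<^bsub>qplane q\<^esub> = emb q 0"
  by (simp add: qplane_def presented_zero emb_def clinear_zero[OF clinear_lift_mono])

lemmas emb_ops = emb_mult emb_add emb_minus emb_smult emb_one emb_zero

lemma qplane_ring: "ring (qplane q)"
  unfolding qplane_def by (rule presented_algebra_ring)

lemma emb_finsum: "finsum (qplane q) (\<lambda>i. emb q (g i)) I = emb q (sum g I)"
proof -
  interpret ring "qplane q" by (rule qplane_ring)
  show ?thesis
    by (induction I rule: infinite_finite_induct) (simp_all add: emb_ops Pi_def)
qed

lemma emb_x: "qp_x q = emb q (Poly_Mapping.single (1, 0) 1)"
  and emb_y: "qp_y q = emb q (Poly_Mapping.single (0, 1) 1)"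
  by (simp_all add: qp_x_def qp_y_def rel_class_emb nf_single qmul_one_right)

lemma emb_monomial: "qp_mon q m n = emb q (Poly_Mapping.single (m, n) 1)"
proof -
  interpret ring "qplane q" by (rule qplane_ring)
  have "qp_x q [^]\<^bsub>qplane q\<^esub> m = emb q (Poly_Mapping.single (m, 0) 1)"
    by (induction m) (simp_all add: emb_x emb_ops qpoly_one qmul_single)
  moreover have "qp_y q [^]\<^bsub>qplane q\<^esub> n = emb q (Poly_Mapping.single (0, n) 1)"
    by (induction n) (simp_all add: emb_y emb_ops qpoly_one qmul_single)
  ultimately show ?thesis
    by (simp add: qp_mon_def emb_ops qmul_single)
qed

subsection \<open>Homogeneous components\<close>

lemma degree_span_eq:
  "degree_span q D = emb q ` {a. \<forall>m n. Poly_Mapping.lookup a (m, n) \<noteq> 0 \<longrightarrow> m + n \<in> D}"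
proof (intro equalityI subsetI)
  fix X assume "X \<in> degree_span q D"
  then obtain M c where M: "finite M" "M \<subseteq> {(m, n). m + n \<in> D}"
    and X: "X = finsum (qplane q) (\<lambda>(m, n). c m n \<odot>\<^bsub>qplane q\<^esub> qp_mon q m n) M"
    unfolding degree_span_def by blast
  have "(\<lambda>(m, n). c m n \<odot>\<^bsub>qplane q\<^esub> qp_mon q m n)
      = (\<lambda>i. emb q (Poly_Mapping.single i (c (fst i) (snd i))))"
    by (auto simp: emb_monomial emb_ops scalar_mult_single)
  then have "X = emb q (\<Sum>i\<in>M. Poly_Mapping.single i (c (fst i) (snd i)))"
    by (simp add: X emb_finsum)
  moreover have "m + n \<in> D"
    if "Poly_Mapping.lookup (\<Sum>i\<in>M. Poly_Mapping.single i (c (fst i) (snd i))) (m, n) \<noteq> 0" for m n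
  proof -
    have "\<exists>i\<in>M. Poly_Mapping.lookup (Poly_Mapping.single i (c (fst i) (snd i))) (m, n) \<noteq> 0"
      using that unfolding lookup_sum by (auto dest: sum.not_neutral_contains_not_neutral)
    then show ?thesis
      using M by (auto simp: lookup_single when_def split: if_splits)
  qed
  ultimately show "X \<in> emb q ` {a. \<forall>m n. Poly_Mapping.lookup a (m, n) \<noteq> 0 \<longrightarrow> m + n \<in> D}"
    by blast
next
  fix X assume "X \<in> emb q ` {a. \<forall>m n. Poly_Mapping.lookup a (m, n) \<noteq> 0 \<longrightarrow> m + n \<in> D}"
  then obtain a where a: "X = emb q a" "\<forall>m n. Poly_Mapping.lookup a (m, n) \<noteq> 0 \<longrightarrow> m + n \<in> D"
    by blast
  let ?c = "\<lambda>m n. Poly_Mapping.lookup a (m, n)"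
  have eq: "(\<lambda>(m, n). ?c m n \<odot>\<^bsub>qplane q\<^esub> qp_mon q m n)
      = (\<lambda>i. emb q (Poly_Mapping.single i (Poly_Mapping.lookup a i)))"
    by (auto simp: emb_monomial emb_ops scalar_mult_single)
  have "X = finsum (qplane q) (\<lambda>(m, n). ?c m n \<odot>\<^bsub>qplane q\<^esub> qp_mon q m n) (Poly_Mapping.keys a)"
    unfolding a(1) eq emb_finsum by (rule arg_cong[OF poly_mapping_expand])
  moreover have "Poly_Mapping.keys a \<subseteq> {(m, n). m + n \<in> D}"
    using a(2) by (auto simp: in_keys_iff)
  ultimately show "X \<in> degree_span q D"
    unfolding degree_span_def
    by (intro CollectI exI[of _ "Poly_Mapping.keys a"] exI[of _ ?c] conjI finite_keys)
qed

lemma emb_in_degree_span: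
  "emb q a \<in> degree_span q D \<longleftrightarrow> (\<forall>m n. Poly_Mapping.lookup a (m, n) \<noteq> 0 \<longrightarrow> m + n \<in> D)"
  by (simp add: degree_span_eq image_iff emb_eq_iff)

lemma hpart_eq_zero_iff:
  "hpart q i (emb q a) = \<zero>\<^bsub>qplane q\<^esub> \<longleftrightarrow> (\<forall>m n. m + n = i \<longrightarrow> Poly_Mapping.lookup a (m, n) = 0)"
proof -
  let ?r = "\<Sum>k\<in>{k \<in> Poly_Mapping.keys a. fst k + snd k = i}. Poly_Mapping.single k (Poly_Mapping.lookup a k)"
  have r: "Poly_Mapping.lookup ?r k = (if fst k + snd k = i then Poly_Mapping.lookup a k else 0)" for k
    by (auto simp: lookup_sum lookup_single when_def in_keys_iff)
  have "hpart q i (emb q a) = emb q ?r"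
    unfolding hpart_def
  proof (rule the_equality)
    show "emb q ?r \<in> degree_span q {i} \<and> emb q a \<ominus>\<^bsub>qplane q\<^esub> emb q ?r \<in> degree_span q (- {i})"
      by (simp add: emb_ops emb_in_degree_span r lookup_minus)
  next
    fix X assume X: "X \<in> degree_span q {i} \<and> emb q a \<ominus>\<^bsub>qplane q\<^esub> X \<in> degree_span q (- {i})"
    then obtain b where b: "X = emb q b" "\<forall>m n. Poly_Mapping.lookup b (m, n) \<noteq> 0 \<longrightarrow> m + n = i"
      by (auto simp: degree_span_eq)
    with X have *: "\<forall>m n. Poly_Mapping.lookup (a - b) (m, n) \<noteq> 0 \<longrightarrow> m + n \<noteq> i"
      by (simp add: emb_ops emb_in_degree_span)
    have "b = ?r"
    proof (rule poly_mapping_eqI)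
      fix k
      show "Poly_Mapping.lookup b k = Poly_Mapping.lookup ?r k"
        using b(2)[rule_format, of "fst k" "snd k"] *[rule_format, of "fst k" "snd k"]
        by (cases "Poly_Mapping.lookup a k = Poly_Mapping.lookup b k") (auto simp: r lookup_minus)
    qed
    then show "X = emb q ?r" unfolding b(1) by (rule arg_cong)
  qed
  then have "hpart q i (emb q a) = \<zero>\<^bsub>qplane q\<^esub> \<longleftrightarrow> ?r = 0"
    by (simp add: emb_ops emb_eq_iff)
  also have "\<dots> \<longleftrightarrow> (\<forall>k. Poly_Mapping.lookup ?r k = 0)"
    by (simp only: poly_mapping_eq_iff fun_eq_iff lookup_zero)
  also have "\<dots> \<longleftrightarrow> (\<forall>m n. m + n = i \<longrightarrow> Poly_Mapping.lookup a (m, n) = 0)"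
    by (auto simp: r)
  finally show ?thesis .
qed

section \<open>Actions given by operators for the generators\<close>

definition act :: "(uq_gen \<Rightarrow> qpoly \<Rightarrow> qpoly) \<Rightarrow> (uq_gen list \<Rightarrow>\<^sub>0 complex) \<Rightarrow> qpoly \<Rightarrow> qpoly" where
  "act T p a = lin_ext (Poly_Mapping.single 0) (\<lambda>w. foldr T w a) p"

text \<open>The action of \<open>\<Sum> u \<otimes> v\<close> on \<open>a \<otimes> b\<close>, followed by multiplication.\<close>

definition act_tensor :: "complex \<Rightarrow> (uq_gen \<Rightarrow> qpoly \<Rightarrow> qpoly) \<Rightarrow>
    ((uq_gen list \<times> uq_gen list) \<Rightarrow>\<^sub>0 complex) \<Rightarrow> qpoly \<Rightarrow> qpoly \<Rightarrow> qpoly" where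
  "act_tensor q T t a b =
    lin_ext (Poly_Mapping.single 0) (\<lambda>(u, v). qmul q (foldr T u a) (foldr T v b)) t"

text \<open>Only generators and relators occur here. That the module algebra axioms then hold for all
  elements is the content of \<open>act_rel_ideal\<close>, \<open>act_qmul\<close> and \<open>act_unit\<close>.\<close>

definition uq_action :: "complex \<Rightarrow> (uq_gen \<Rightarrow> qpoly \<Rightarrow> qpoly) \<Rightarrow> bool" where
  "uq_action q T \<longleftrightarrow> (\<forall>g. clinear (T g)) \<and> (\<forall>r \<in> uq_relators q. \<forall>a. act T r a = 0) \<and>
    (\<forall>g a b. T g (qmul q a b) = act_tensor q T (gen_comult g) a b) \<and>
    (\<forall>g. T g 1 = scalar (gen_counit g))"

lemma act_add: "act T (p + r) a = act T p a + act T r a"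
  and act_diff: "act T (p - r) a = act T p a - act T r a"
  and act_zero: "act T 0 a = 0"
  and act_single: "act T (Poly_Mapping.single w c) a = scalar c * foldr T w a"
  and act_scalar: "act T (scalar c * p) a = scalar c * act T p a"
  by (simp_all add: act_def scalar.lin_ext_add scalar.lin_ext_diff scalar.lin_ext_single
      scalar.lin_ext_scalar)

lemma word_Nil: "word [] = 1"
  by (simp add: zero_list_def[symmetric])

lemma act_one: "act T 1 a = a"
  using act_single[of T "[]" 1 a] unfolding word_Nil by simp

lemma clinear_foldr: "(\<And>g. clinear (T g)) \<Longrightarrow> clinear (foldr T w)"
  by (induction w) (simp_all add: clinear_def)

lemma clinear_act:
  assumes "\<And>g. clinear (T g)"
  shows "clinear (act T p)"
  unfolding clinear_def act_def
  by (simp add: clinear_add[OF clinear_foldr[OF assms]] clinear_scalar[OF clinear_foldr[OF assms]]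
      scalar.lin_ext_plus_fun scalar.lin_ext_mult_fun)

lemma act_mult:
  assumes "\<And>g. clinear (T g)"
  shows "act T (p * r) a = act T p (act T r a)"
proof (induction p rule: poly_mapping_additive_induct)
  case (single u c)
  show ?case
  proof (induction r rule: poly_mapping_additive_induct)
    case (single v d)
    then show ?case
      by (simp add: mult_single plus_list_def act_single clinear_scalar[OF clinear_foldr[OF assms]]
          scalar_scalar)
  next
    case (add r s)
    then show ?case
      by (simp add: distrib_left act_add clinear_add[OF clinear_act[OF assms]])
  qed
next
  case (add p s)
  then show ?case by (simp add: distrib_right act_add)
qed

lemma act_rel_ideal:
  assumes "uq_action q T" "p \<in> rel_ideal (uq_relators q)"
  shows "act T p a = 0"
proof -
  have lin: "\<And>g. clinear (T g)" using assms(1) by (simp add: uq_action_def)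
  have "rel_ideal (uq_relators q) \<subseteq> {p. \<forall>a. act T p a = 0}"
    using assms(1)
    by (intro rel_ideal_least)
      (auto simp: uq_action_def act_zero act_add act_mult[OF lin] clinear_zero[OF clinear_act[OF lin]])
  then show ?thesis using assms(2) by blast
qed

lemma act_tensor_add: "act_tensor q T (s + t) a b = act_tensor q T s a b + act_tensor q T t a b"
  and act_tensor_single: "act_tensor q T (Poly_Mapping.single (u, v) c) a b
      = scalar c * qmul q (foldr T u a) (foldr T v b)"
  and act_tensor_scalar: "act_tensor q T (scalar c * t) a b = scalar c * act_tensor q T t a b"
  by (simp_all add: act_tensor_def scalar.lin_ext_add scalar.lin_ext_single scalar.lin_ext_scalar)

text \<open>Multiplication in the tensor square of the free algebra is composition of the actions on
  the two tensor factors; this is where multiplicativity of the coproduct enters.\<close>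

lemma act_tensor_mult:
  "act_tensor q T (s * t) a b =
    lin_ext (Poly_Mapping.single 0) (\<lambda>(u, v). act_tensor q T s (foldr T u a) (foldr T v b)) t"
proof (induction s rule: poly_mapping_additive_induct)
  case (single i c)
  obtain u v where i: "i = (u, v)" by (cases i)
  show ?case
  proof (induction t rule: poly_mapping_additive_induct)
    case (single j d)
    then show ?case
      by (cases j) (simp add: i mult_single plus_list_def act_tensor_single scalar.lin_ext_single
          scalar_scalar mult.commute)
  next
    case (add s t)
    then show ?case by (simp add: distrib_left act_tensor_add scalar.lin_ext_add)
  qed
next
  case (add p r)
  then show ?case
    by (simp add: distrib_right act_tensor_add case_prod_unfold scalar.lin_ext_plus_fun)
qed

text \<open>The product rule propagates from the generators to words, since applying one more generator
  multiplies the coproduct by one more factor.\<close>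

lemma act_qmul:
  assumes "uq_action q T"
  shows "act T p (qmul q a b) = act_tensor q T (free_ext (Poly_Mapping.single 0) gen_comult p) a b"
proof -
  have lin: "\<And>g. clinear (T g)" using assms by (simp add: uq_action_def)
  have word: "foldr T w (qmul q a b) = act_tensor q T (prod_list (map gen_comult w)) a b" for w
  proof (induction w)
    case Nil
    have "(1 :: (uq_gen list \<times> uq_gen list) \<Rightarrow>\<^sub>0 complex) = Poly_Mapping.single ([], []) 1"
      by (simp add: zero_list_def[symmetric] zero_prod_def[symmetric])
    then have "act_tensor q T 1 a b = act_tensor q T (Poly_Mapping.single ([], []) 1) a b"
      by (rule arg_cong)
    then show ?case by (simp add: act_tensor_single)
  next
    case (Cons g w)
    have "T g (act_tensor q T (prod_list (map gen_comult w)) a b) =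
        act_tensor q T (gen_comult g * prod_list (map gen_comult w)) a b"
      unfolding act_tensor_mult
      using assms by (simp add: act_tensor_def[of q T "prod_list _"] clinear_lin_ext_commute[OF lin]
          case_prod_unfold uq_action_def)
    then show ?case by (simp add: Cons)
  qed
  show ?thesis
  proof (induction p rule: poly_mapping_additive_induct)
    case (single w c)
    show ?case
      by (simp add: act_single word scalar.free_ext_lin_ext scalar.lin_ext_single act_tensor_scalar)
  next
    case (add p r)
    then show ?case
      by (simp add: act_add scalar.free_ext_lin_ext scalar.lin_ext_add act_tensor_add)
  qed
qed

interpretation counit: unit_map "\<lambda>c::complex. c"
  by (rule complex_unit_map)

lemma counit_single:
  "free_ext (\<lambda>c. c) gen_counit (Poly_Mapping.single w c) = c * prod_list (map gen_counit w)"
  by (simp add: counit.free_ext_lin_ext counit.lin_ext_single)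

lemma counit_rel_ideal:
  assumes "p \<in> rel_ideal (uq_relators q)"
  shows "free_ext (\<lambda>c. c) gen_counit p = 0"
proof -
  have one: "free_ext (\<lambda>c. c) gen_counit 1 = 1"
    using counit_single[of "[]" 1] unfolding word_Nil by simp
  have lin: "free_ext (\<lambda>c. c) gen_counit (p + r) = free_ext (\<lambda>c. c) gen_counit p + free_ext (\<lambda>c. c) gen_counit r"
    "free_ext (\<lambda>c. c) gen_counit (p - r) = free_ext (\<lambda>c. c) gen_counit p - free_ext (\<lambda>c. c) gen_counit r"
    "free_ext (\<lambda>c. c) gen_counit 0 = 0" for p r
    by (simp_all add: counit.free_ext_lin_ext counit.lin_ext_add counit.lin_ext_diff)
  have "rel_ideal (uq_relators q) \<subseteq> {p. free_ext (\<lambda>c. c) gen_counit p = 0}"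
  proof (rule rel_ideal_least)
    show "uq_relators q \<subseteq> {p. free_ext (\<lambda>c. c) gen_counit p = 0}"
      unfolding uq_relators_def
      by (auto simp: scalar_mult_single right_diff_distrib one counit_single
          lin)
  qed (simp_all add: counit.free_ext_mult lin)
  then show ?thesis using assms by blast
qed

lemma act_unit:
  assumes "uq_action q T"
  shows "act T p 1 = scalar (free_ext (\<lambda>c. c) gen_counit p)"
proof (induction p rule: poly_mapping_additive_induct)
  case (single w c)
  have lin: "\<And>g. clinear (T g)" and unit: "\<And>g. T g 1 = scalar (gen_counit g)"
    using assms by (simp_all add: uq_action_def)
  have T: "T g (scalar c) = scalar (c * gen_counit g)" for g c
    using clinear_scalar[OF lin, of g c 1] by (simp add: unit mult_single)
  have "foldr T w 1 = scalar (prod_list (map gen_counit w))"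
    by (induction w) (simp_all add: T mult.commute)
  then show ?case by (simp add: act_single counit_single mult_single)
next
  case (add p r)
  then show ?case
    by (simp add: act_add counit.free_ext_lin_ext counit.lin_ext_add single_add)
qed

section \<open>Module algebra structures and operators\<close>

lemma uq_sl2_sel:
  "carrier (uq_sl2 q) = range (uq_class q)"
  "\<one>\<^bsub>uq_sl2 q\<^esub> = uq_class q 1"
  "uq_class q p \<otimes>\<^bsub>uq_sl2 q\<^esub> uq_class q r = uq_class q (p * r)"
  "uq_class q p \<oplus>\<^bsub>uq_sl2 q\<^esub> uq_class q r = uq_class q (p + r)"
  "c \<odot>\<^bsub>uq_sl2 q\<^esub> uq_class q p = uq_class q (scalar c * p)"
  "comult (uq_sl2 q) h =
    (\<Union>p \<in> h. tensor_class (uq_algebra q) (uq_tensor q (free_ext scalar gen_comult p)))"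
  "counit (uq_sl2 q) h = the_elem (free_ext (\<lambda>c. c) gen_counit ` h)"
  by (simp_all add: uq_sl2_def uq_algebra_def module.defs hopf_alg.defs presented_algebra_sel)

lemma uq_algebra_sel:
  "carrier (uq_algebra q) = range (uq_class q)"
  "uq_class q p \<oplus>\<^bsub>uq_algebra q\<^esub> uq_class q r = uq_class q (p + r)"
  "c \<odot>\<^bsub>uq_algebra q\<^esub> uq_class q p = uq_class q (scalar c * p)"
  by (simp_all add: uq_algebra_def presented_algebra_sel)

lemma counit_class: "counit (uq_sl2 q) (uq_class q p) = free_ext (\<lambda>c. c) gen_counit p"
proof -
  have "free_ext (\<lambda>c. c) gen_counit r = free_ext (\<lambda>c. c) gen_counit p" if "r \<in> uq_class q p" for r
    using that counit_rel_ideal[of "r - p" q]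
    by (simp add: mem_rel_class counit.free_ext_lin_ext counit.lin_ext_diff)
  moreover have "p \<in> uq_class q p"
    by (simp add: mem_rel_class rel_ideal_zero)
  ultimately have "free_ext (\<lambda>c. c) gen_counit ` uq_class q p = {free_ext (\<lambda>c. c) gen_counit p}"
    by blast
  then show ?thesis by (simp add: uq_sl2_sel)
qed

lemma keys_diff_subset:
  "Poly_Mapping.keys p \<subseteq> K \<Longrightarrow> Poly_Mapping.keys r \<subseteq> K \<Longrightarrow> Poly_Mapping.keys (p - r) \<subseteq> K"
  using keys_diff[of p r] by blast

lemma keys_single_subset: "k \<in> K \<Longrightarrow> Poly_Mapping.keys (Poly_Mapping.single k c) \<subseteq> K"
  by simp

lemma tensor_null_keys:
  assumes "t \<in> tensor_null (uq_algebra q)"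
  shows "Poly_Mapping.keys t \<subseteq> range (uq_class q) \<times> range (uq_class q)"
  using assms
proof (induction t)
  case (null_add s t)
  then show ?case using keys_add[of s t] by blast
qed (simp, (intro keys_diff_subset keys_single_subset; auto simp: uq_algebra_sel)+)

text \<open>Evaluation of an element of the tensor square on a pair \<open>(a, b)\<close> is bilinear in the tensor
  factors. It therefore does not depend on the expression that represents a coproduct.\<close>

lemma tensor_eval_null:
  fixes M :: "(uq_gen list \<Rightarrow>\<^sub>0 complex) set \<Rightarrow> qpoly \<Rightarrow> qpoly"
  assumes M: "\<And>p a. M (uq_class q p) a = act T p a"
    and "t \<in> tensor_null (uq_algebra q)"
  shows "lin_ext (Poly_Mapping.single 0) (\<lambda>(h, h'). qmul q (M h a) (M h' b)) t = 0"
  using assms(2)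
  by (induction t) (auto simp: scalar.lin_ext_add scalar.lin_ext_diff scalar.lin_ext_single
      uq_algebra_sel M act_add act_scalar qmul_linear scalar_scalar distrib_left mult.commute)

lemma tensor_eval:
  assumes M: "\<And>p a. M (uq_class q p) a = act T p a"
  shows "lin_ext (Poly_Mapping.single 0) (\<lambda>(h, h'). qmul q (M h a) (M h' b)) (uq_tensor q t)
    = act_tensor q T t a b"
proof -
  have 1: "act T (word u) a = foldr T u a" for u a
    by (simp add: act_single)
  show ?thesis
    by (simp add: uq_tensor_def act_tensor_def scalar.lin_ext_sum case_prod_unfold scalar.lin_ext_single
        M 1 lin_ext_def[of _ _ t])
qed

text \<open>The operators \<open>T\<close> act on coordinates as \<open>\<pi>\<close> acts on the quantum plane. Quantifying over
  representatives \<open>p\<close> avoids any choice of representatives of classes.\<close>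

definition represents ::
  "complex \<Rightarrow> (uq_gen \<Rightarrow> qpoly \<Rightarrow> qpoly) \<Rightarrow> qp_structure \<Rightarrow> bool" where
  "represents q T \<pi> \<longleftrightarrow> (\<forall>p a. \<pi> (uq_class q p) (emb q a) = emb q (act T p a))"

lemma representsD: "represents q T \<pi> \<Longrightarrow> \<pi> (uq_class q p) (emb q a) = emb q (act T p a)"
  by (simp add: represents_def)

lemma tensor_finsum:
  assumes "represents q T \<pi>" and "Poly_Mapping.keys t \<subseteq> range (uq_class q) \<times> range (uq_class q)"
  shows "finsum (qplane q)
      (\<lambda>(h', h''). Poly_Mapping.lookup t (h', h'') \<odot>\<^bsub>qplane q\<^esub>
        (\<pi> h' (emb q a) \<otimes>\<^bsub>qplane q\<^esub> \<pi> h'' (emb q b))) (Poly_Mapping.keys t) =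
    emb q (lin_ext (Poly_Mapping.single 0)
      (\<lambda>(h, h'). qmul q (coord q (\<pi> h (emb q a))) (coord q (\<pi> h' (emb q b)))) t)"
proof -
  interpret ring "qplane q" by (rule qplane_ring)
  let ?g = "\<lambda>(h, h'). scalar (Poly_Mapping.lookup t (h, h')) *
    qmul q (coord q (\<pi> h (emb q a))) (coord q (\<pi> h' (emb q b)))"
  have "finsum (qplane q)
      (\<lambda>(h', h''). Poly_Mapping.lookup t (h', h'') \<odot>\<^bsub>qplane q\<^esub>
        (\<pi> h' (emb q a) \<otimes>\<^bsub>qplane q\<^esub> \<pi> h'' (emb q b))) (Poly_Mapping.keys t) =
      finsum (qplane q) (\<lambda>i. emb q (?g i)) (Poly_Mapping.keys t)"
  proof (rule finsum_cong')
    fix i assume "i \<in> Poly_Mapping.keys t"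
    then obtain p r where i: "i = (uq_class q p, uq_class q r)"
      using assms(2) by blast
    show "(case i of (h', h'') \<Rightarrow> Poly_Mapping.lookup t (h', h'') \<odot>\<^bsub>qplane q\<^esub>
        (\<pi> h' (emb q a) \<otimes>\<^bsub>qplane q\<^esub> \<pi> h'' (emb q b))) = emb q (?g i)"
      by (simp add: i representsD[OF assms(1)] emb_ops)
  qed auto
  then show ?thesis
    unfolding emb_finsum by (simp add: lin_ext_def case_prod_unfold)
qed

lemma uq_tensor_keys:
  "Poly_Mapping.keys (uq_tensor q t) \<subseteq> range (uq_class q) \<times> range (uq_class q)"
  unfolding uq_tensor_def
  by (rule order_trans[OF keys_sum]) (auto split: if_splits)

text \<open>The representative \<open>p\<close> depends on the choice of \<open>t\<close>: the comultiplication of a class is the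
  union over all of its representatives.\<close>

lemma comult_eval:
  assumes rep: "represents q T \<pi>" and t: "t \<in> comult (uq_sl2 q) (uq_class q r)"
  shows "\<exists>p. uq_class q p = uq_class q r \<and> finsum (qplane q)
      (\<lambda>(h', h''). Poly_Mapping.lookup t (h', h'') \<odot>\<^bsub>qplane q\<^esub>
        (\<pi> h' (emb q a) \<otimes>\<^bsub>qplane q\<^esub> \<pi> h'' (emb q b))) (Poly_Mapping.keys t) =
    emb q (act_tensor q T (free_ext scalar gen_comult p) a b)"
proof -
  obtain p where p: "p \<in> uq_class q r"
    and n: "t - uq_tensor q (free_ext scalar gen_comult p) \<in> tensor_null (uq_algebra q)"
    using t by (auto simp: uq_sl2_sel tensor_class_def)
  let ?u = "uq_tensor q (free_ext scalar gen_comult p)"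
  define M where "M h a = coord q (\<pi> h (emb q a))" for h a
  have M: "M (uq_class q p) a = act T p a" for p a
    by (simp add: M_def representsD[OF rep])
  have "Poly_Mapping.keys (t - ?u + ?u) \<subseteq> range (uq_class q) \<times> range (uq_class q)"
    by (rule order_trans[OF keys_add]) (use tensor_null_keys[OF n] uq_tensor_keys[of q] in blast)
  then have keys: "Poly_Mapping.keys t \<subseteq> range (uq_class q) \<times> range (uq_class q)"
    by simp
  let ?ev = "lin_ext (Poly_Mapping.single 0) (\<lambda>(h, h'). qmul q (M h a) (M h' b))"
  have "?ev (t - ?u) = 0"
    using M n by (rule tensor_eval_null)
  then have "?ev t = ?ev ?u"
    by (simp add: scalar.lin_ext_diff)
  also have "\<dots> = act_tensor q T (free_ext scalar gen_comult p) a b"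
    using M by (rule tensor_eval)
  finally show ?thesis
    using p tensor_finsum[OF rep keys, of a b]
    by (intro exI[of _ p]) (simp add: M_def mem_rel_class rel_class_eq_iff)
qed

lemma comult_class: "uq_tensor q (free_ext scalar gen_comult p) \<in> comult (uq_sl2 q) (uq_class q p)"
  unfolding uq_sl2_sel tensor_class_def
  by (rule UN_I[of p]) (simp_all add: mem_rel_class rel_ideal_zero null_zero)

text \<open>The operators act on a class through an arbitrary representative; the relators act as zero, so
  the choice does not matter. Outside the carriers the structure is \<open>undefined\<close>, as extensionality
  demands.\<close>

lemma structure_of_action:
  assumes "uq_action q T"
  shows "\<exists>\<pi> \<in> qp_structures q. represents q T \<pi>"
proof -
  have lin: "\<And>g. clinear (T g)" using assms by (simp add: uq_action_def)
  define \<pi> where "\<pi> = (\<lambda>h \<in> carrier (uq_sl2 q). \<lambda>X \<in> carrier (qplane q).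
    emb q (act T (SOME p. p \<in> h) (coord q X)))"
  have cong: "act T p a = act T r a" if "uq_class q p = uq_class q r" for p r a
    using act_rel_ideal[OF assms, of "p - r" a] that by (simp add: rel_class_eq_iff act_diff)
  have "(SOME r. r \<in> uq_class q p) \<in> uq_class q p" for p
    by (rule someI[of _ p]) (simp add: mem_rel_class rel_ideal_zero)
  then have some: "uq_class q (SOME r. r \<in> uq_class q p) = uq_class q p" for p
    by (simp add: mem_rel_class rel_class_eq_iff)
  have rep: "represents q T \<pi>"
    by (simp add: represents_def \<pi>_def uq_sl2_sel cong[OF some])
  have ext: "\<pi> (uq_class q p) X = undefined" if "X \<notin> carrier (qplane q)" for p X
    using that by (simp add: \<pi>_def uq_sl2_sel)
  note r = representsD[OF rep]
  have eqI: "\<pi> (uq_class q p) = g"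
    if "\<And>a. emb q (act T p a) = g (emb q a)" "\<And>X. X \<notin> carrier (qplane q) \<Longrightarrow> g X = undefined" for p g
  proof
    fix X show "\<pi> (uq_class q p) X = g X"
      using that ext[of X p] by (cases "X \<in> carrier (qplane q)") (auto simp: qplane_carrier r)
  qed
  have "\<pi> \<in> alg_hom (uq_sl2 q) (End_algebra (qplane q))"
    unfolding alg_hom_def
  proof (intro CollectI conjI ballI allI)
    show "\<pi> \<in> ring_hom (uq_sl2 q) (End_algebra (qplane q))"
    proof (rule ring_hom_memI)
      fix x assume "x \<in> carrier (uq_sl2 q)"
      then obtain p where x: "x = uq_class q p" by (auto simp: uq_sl2_sel)
      show "\<pi> x \<in> carrier (End_algebra (qplane q))"
        unfolding x End_algebra_def
        by (auto simp: qplane_carrier r emb_ops clinear_add[OF clinear_act[OF lin]]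
            clinear_scalar[OF clinear_act[OF lin]] ext)
      fix y assume "y \<in> carrier (uq_sl2 q)"
      then obtain s where y: "y = uq_class q s" by (auto simp: uq_sl2_sel)
      show "\<pi> (x \<otimes>\<^bsub>uq_sl2 q\<^esub> y) = \<pi> x \<otimes>\<^bsub>End_algebra (qplane q)\<^esub> \<pi> y"
        unfolding x y uq_sl2_sel
        by (rule eqI) (simp_all add: End_algebra_def compose_def r act_mult[OF lin])
      show "\<pi> (x \<oplus>\<^bsub>uq_sl2 q\<^esub> y) = \<pi> x \<oplus>\<^bsub>End_algebra (qplane q)\<^esub> \<pi> y"
        unfolding x y uq_sl2_sel
        by (rule eqI) (simp_all add: End_algebra_def r act_add emb_ops)
    next
      show "\<pi> \<one>\<^bsub>uq_sl2 q\<^esub> = \<one>\<^bsub>End_algebra (qplane q)\<^esub>"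
        unfolding uq_sl2_sel by (rule eqI) (simp_all add: End_algebra_def act_one)
    qed
    fix c x assume "x \<in> carrier (uq_sl2 q)"
    then obtain p where x: "x = uq_class q p" by (auto simp: uq_sl2_sel)
    show "\<pi> (c \<odot>\<^bsub>uq_sl2 q\<^esub> x) = c \<odot>\<^bsub>End_algebra (qplane q)\<^esub> \<pi> x"
      unfolding x uq_sl2_sel
      by (rule eqI) (simp_all add: End_algebra_def r act_scalar emb_ops)
  qed
  moreover have "\<pi> \<in> extensional (carrier (uq_sl2 q))"
    by (simp add: \<pi>_def)
  moreover have "\<pi> (uq_class q p) (emb q a \<otimes>\<^bsub>qplane q\<^esub> emb q b) = finsum (qplane q)
      (\<lambda>(h', h''). Poly_Mapping.lookup t (h', h'') \<odot>\<^bsub>qplane q\<^esub>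
        (\<pi> h' (emb q a) \<otimes>\<^bsub>qplane q\<^esub> \<pi> h'' (emb q b))) (Poly_Mapping.keys t)"
    if "t \<in> comult (uq_sl2 q) (uq_class q p)" for p t a b
  proof -
    note t = that
    obtain p' where p': "uq_class q p' = uq_class q p" and eq: "finsum (qplane q)
        (\<lambda>(h', h''). Poly_Mapping.lookup t (h', h'') \<odot>\<^bsub>qplane q\<^esub>
          (\<pi> h' (emb q a) \<otimes>\<^bsub>qplane q\<^esub> \<pi> h'' (emb q b))) (Poly_Mapping.keys t)
        = emb q (act_tensor q T (free_ext scalar gen_comult p') a b)"
      using comult_eval[OF rep t] by blast
    show ?thesis
      unfolding eq using cong[OF p', of "qmul q a b"] by (simp add: emb_mult r act_qmul[OF assms])
  qed
  moreover have "\<pi> (uq_class q p) \<one>\<^bsub>qplane q\<^esub> = counit (uq_sl2 q) (uq_class q p) \<odot>\<^bsub>qplane q\<^esub> \<one>\<^bsub>qplane q\<^esub>" for p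
    by (simp add: emb_one r act_unit[OF assms] counit_class emb_smult)
  ultimately have "\<pi> \<in> qp_structures q"
    unfolding module_algebra_structures_def by (auto simp: uq_sl2_sel(1) qplane_carrier)
  with rep show ?thesis by blast
qed

text \<open>The operators are read off on the generators; the axioms of \<open>uq_action\<close> are the module algebra
  axioms for the canonical expressions of the coproducts of the generators.\<close>

lemma action_of_structure:
  assumes "\<pi> \<in> qp_structures q"
  shows "\<exists>T. uq_action q T \<and> represents q T \<pi>"
proof -
  have hom: "\<pi> \<in> ring_hom (uq_sl2 q) (End_algebra (qplane q))"
    and smult: "\<And>c x. x \<in> carrier (uq_sl2 q) \<Longrightarrow>
      \<pi> (c \<odot>\<^bsub>uq_sl2 q\<^esub> x) = c \<odot>\<^bsub>End_algebra (qplane q)\<^esub> \<pi> x"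
    and leibniz: "\<And>h t a b. h \<in> carrier (uq_sl2 q) \<Longrightarrow> t \<in> comult (uq_sl2 q) h \<Longrightarrow>
      \<pi> h (emb q a \<otimes>\<^bsub>qplane q\<^esub> emb q b) = finsum (qplane q)
        (\<lambda>(h', h''). Poly_Mapping.lookup t (h', h'') \<odot>\<^bsub>qplane q\<^esub>
          (\<pi> h' (emb q a) \<otimes>\<^bsub>qplane q\<^esub> \<pi> h'' (emb q b))) (Poly_Mapping.keys t)"
    and unit: "\<And>h. h \<in> carrier (uq_sl2 q) \<Longrightarrow>
      \<pi> h \<one>\<^bsub>qplane q\<^esub> = counit (uq_sl2 q) h \<odot>\<^bsub>qplane q\<^esub> \<one>\<^bsub>qplane q\<^esub>"
    using assms unfolding module_algebra_structures_def alg_hom_def by auto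
  define M where "M p a = coord q (\<pi> (uq_class q p) (emb q a))" for p a
  have carr: "uq_class q p \<in> carrier (uq_sl2 q)" for p
    by (simp add: uq_sl2_sel)
  have E: "\<pi> (uq_class q p) \<in> carrier (End_algebra (qplane q))" for p
    using ring_hom_closed[OF hom carr] .
  have \<pi>: "\<pi> (uq_class q p) (emb q a) = emb q (M p a)" for p a
    unfolding M_def by (rule emb_coord[symmetric]) (use E[of p] in \<open>auto simp: End_algebra_def\<close>)
  have clin: "clinear (M p)" for p
  proof -
    have "emb q (M p (a + b)) = emb q (M p a + M p b)" for a b
    proof -
      have "\<pi> (uq_class q p) (emb q a \<oplus>\<^bsub>qplane q\<^esub> emb q b) =
          \<pi> (uq_class q p) (emb q a) \<oplus>\<^bsub>qplane q\<^esub> \<pi> (uq_class q p) (emb q b)"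
        using E[of p] by (simp add: End_algebra_def)
      then show ?thesis by (simp add: emb_ops \<pi>)
    qed
    moreover have "emb q (M p (scalar c * a)) = emb q (scalar c * M p a)" for c a
    proof -
      have "\<pi> (uq_class q p) (c \<odot>\<^bsub>qplane q\<^esub> emb q a) = c \<odot>\<^bsub>qplane q\<^esub> \<pi> (uq_class q p) (emb q a)"
        using E[of p] by (simp add: End_algebra_def)
      then show ?thesis by (simp add: emb_ops \<pi>)
    qed
    ultimately show ?thesis by (simp add: clinear_def emb_eq_iff)
  qed
  have M_add: "M (p + r) a = M p a + M r a" for p r a
  proof -
    have "\<pi> (uq_class q (p + r)) (emb q a) = emb q (M p a + M r a)"
      using ring_hom_add[OF hom carr carr, of p r] by (simp add: uq_sl2_sel End_algebra_def \<pi> emb_ops)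
    then show ?thesis by (simp add: \<pi> emb_eq_iff)
  qed
  have M_mult: "M (p * r) a = M p (M r a)" for p r a
  proof -
    have "\<pi> (uq_class q (p * r)) (emb q a) = emb q (M p (M r a))"
      using ring_hom_mult[OF hom carr carr, of p r]
      by (simp add: uq_sl2_sel End_algebra_def compose_def \<pi>)
    then show ?thesis by (simp add: \<pi> emb_eq_iff)
  qed
  have M_one: "M 1 a = a" for a
  proof -
    have "\<pi> (uq_class q 1) (emb q a) = emb q a"
      using ring_hom_one[OF hom] by (simp add: uq_sl2_sel End_algebra_def)
    then show ?thesis by (simp add: \<pi> emb_eq_iff)
  qed
  have M_scalar: "M (scalar c * p) a = scalar c * M p a" for c p a
  proof -
    have "\<pi> (uq_class q (scalar c * p)) (emb q a) = emb q (scalar c * M p a)"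
      using smult[OF carr, of c p] by (simp add: uq_sl2_sel End_algebra_def \<pi> emb_ops)
    then show ?thesis by (simp add: \<pi> emb_eq_iff)
  qed
  define T where "T g = M (word [g])" for g
  have word: "M (word w) a = foldr T w a" for w a
  proof (induction w)
    case Nil
    then show ?case unfolding word_Nil by (simp add: M_one)
  next
    case (Cons g w)
    have "word (g # w) = word [g] * word w" by (simp add: mult_single plus_list_def)
    then show ?case using Cons by (simp only: M_mult T_def foldr_Cons o_apply)
  qed
  have M_act: "M p a = act T p a" for p a
  proof (induction p rule: poly_mapping_additive_induct)
    case (single w c)
    then show ?case using M_scalar[of c "word w" a] by (simp add: scalar_mult_single word act_single)
  next
    case (add p r)
    then show ?case by (simp add: M_add act_add)
  qed
  have rep: "represents q T \<pi>"
    by (simp add: represents_def \<pi> M_act)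
  have "uq_action q T"
    unfolding uq_action_def
  proof (intro conjI allI ballI)
    show "clinear (T g)" for g unfolding T_def by (rule clin)
  next
    fix r a assume "r \<in> uq_relators q"
    then have "uq_class q r = uq_class q 0"
      using rel_ideal_superset by (auto simp: rel_class_eq_iff)
    then have "M r a = M 0 a" by (simp add: M_def)
    then show "act T r a = 0" by (simp add: M_act act_zero)
  next
    fix g a b
    define M' where "M' h a = coord q (\<pi> h (emb q a))" for h a
    have M': "M' (uq_class q p) a = act T p a" for p a
      by (simp add: M'_def \<pi> M_act)
    have g: "free_ext scalar gen_comult (word [g]) = gen_comult g"
      by (simp add: scalar.free_ext_lin_ext scalar.lin_ext_single)
    have t: "uq_tensor q (gen_comult g) \<in> comult (uq_sl2 q) (uq_class q (word [g]))"
      using comult_class[of q "word [g]"] unfolding g .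
    have "emb q (T g (qmul q a b)) = emb q (lin_ext (Poly_Mapping.single 0)
        (\<lambda>(h, h'). qmul q (M' h a) (M' h' b)) (uq_tensor q (gen_comult g)))"
      using leibniz[OF carr t, of a b] tensor_finsum[OF rep uq_tensor_keys, of "gen_comult g" a b]
      by (simp add: emb_mult \<pi> T_def M'_def)
    also have "\<dots> = emb q (act_tensor q T (gen_comult g) a b)"
      by (simp add: tensor_eval[OF M'])
    finally show "T g (qmul q a b) = act_tensor q T (gen_comult g) a b"
      by (simp add: emb_eq_iff)
  next
    fix g
    have "emb q (M (word [g]) 1) = emb q (scalar (gen_counit g))"
      using unit[OF carr, of "word [g]"]
      by (simp add: emb_one \<pi> counit_class counit_single emb_smult)
    then show "T g 1 = scalar (gen_counit g)"
      by (simp add: emb_eq_iff T_def)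
  qed
  with rep show ?thesis by blast
qed

lemma structure_eqI:
  assumes "\<pi> \<in> qp_structures q" "\<pi>' \<in> qp_structures q" "represents q T \<pi>" "represents q T \<pi>'"
  shows "\<pi> = \<pi>'"
proof (rule extensionalityI)
  show "\<pi> \<in> extensional (carrier (uq_sl2 q))" "\<pi>' \<in> extensional (carrier (uq_sl2 q))"
    using assms by (simp_all add: module_algebra_structures_def)
  fix h assume h: "h \<in> carrier (uq_sl2 q)"
  then obtain p where p: "h = uq_class q p" by (auto simp: uq_sl2_sel)
  have "\<pi> h \<in> carrier (End_algebra (qplane q))" "\<pi>' h \<in> carrier (End_algebra (qplane q))"
    using assms h by (auto simp: module_algebra_structures_def alg_hom_def dest: ring_hom_closed)
  then have "\<pi> h \<in> extensional (carrier (qplane q))" "\<pi>' h \<in> extensional (carrier (qplane q))"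
    by (auto simp: End_algebra_def PiE_def)
  then show "\<pi> h = \<pi>' h"
    by (rule extensionalityI)
      (auto simp: qplane_carrier p representsD[OF assms(3)] representsD[OF assms(4)])
qed

section \<open>Automorphisms of the quantum plane\<close>

abbreviation coeff :: "qpoly \<Rightarrow> nat \<Rightarrow> nat \<Rightarrow> complex" where
  "coeff a m n \<equiv> Poly_Mapping.lookup a (m, n)"

abbreviation qmono :: "nat \<Rightarrow> nat \<Rightarrow> qpoly" where
  "qmono m n \<equiv> Poly_Mapping.single (m, n) 1"

lemma clinear_qmono_eqI:
  assumes "clinear f" "clinear g"
    and "\<And>m n. f (qmono m n) = g (qmono m n)"
  shows "f a = g a"
  by (rule clinear_eqI[OF assms(1,2)]) (metis assms(3) prod.exhaust)

lemma lookup_qmul: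
  "Poly_Mapping.lookup (qmul q a b) k =
    (\<Sum>i\<in>Poly_Mapping.keys a. \<Sum>j\<in>Poly_Mapping.keys b. if i + j = k
      then Poly_Mapping.lookup a i * Poly_Mapping.lookup b j * q ^ (snd i * fst j) else 0)"
  by (simp add: qmul_def lin_ext_def lookup_sum lookup_scalar_mult lookup_single when_def
      sum_distrib_left mult.assoc if_distrib cong: if_cong)

lemma qmul_keys:
  "k \<in> Poly_Mapping.keys (qmul q a b) \<Longrightarrow>
    \<exists>i\<in>Poly_Mapping.keys a. \<exists>j\<in>Poly_Mapping.keys b. k = i + j"
proof (rule ccontr)
  assume "\<not> (\<exists>i\<in>Poly_Mapping.keys a. \<exists>j\<in>Poly_Mapping.keys b. k = i + j)"
  then have "Poly_Mapping.lookup (qmul q a b) k = 0"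
    unfolding lookup_qmul by (intro sum.neutral ballI) auto
  then show "k \<in> Poly_Mapping.keys (qmul q a b) \<Longrightarrow> False"
    by (simp add: in_keys_iff)
qed

lemma coeff_x_mult: "coeff (qmul q (qmono 1 0) a) (Suc m) n = coeff a m n"
  and coeff_mult_x: "coeff (qmul q a (qmono 1 0)) (Suc m) n = q ^ n * coeff a m n"
  and coeff_y_mult: "coeff (qmul q (qmono 0 1) a) m (Suc n) = q ^ m * coeff a m n"
  and coeff_mult_y: "coeff (qmul q a (qmono 0 1)) m (Suc n) = coeff a m n"
  by (induction a rule: poly_mapping_additive_induct)
    (auto simp: qmul_linear lookup_add qmul_single lookup_single when_def distrib_left split: if_splits)

lemma keys_x_mult: "Poly_Mapping.keys (qmul q (qmono 1 0) a) = (+) (1, 0) ` Poly_Mapping.keys a"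
  and keys_y_mult: "q \<noteq> 0 \<Longrightarrow> Poly_Mapping.keys (qmul q (qmono 0 1) a) = (+) (0, 1) ` Poly_Mapping.keys a"
proof -
  have "k \<in> Poly_Mapping.keys (qmul q (qmono 1 0) a)" if "k \<in> (+) (1, 0) ` Poly_Mapping.keys a" for k
    using that coeff_x_mult[of q a] by (auto simp: in_keys_iff)
  then show "Poly_Mapping.keys (qmul q (qmono 1 0) a) = (+) (1, 0) ` Poly_Mapping.keys a"
    using qmul_keys[of _ q "qmono 1 0" a] by (intro equalityI subsetI) (simp, blast, blast)
  have "k \<in> Poly_Mapping.keys (qmul q (qmono 0 1) a)" if "k \<in> (+) (0, 1) ` Poly_Mapping.keys a" "q \<noteq> 0" for k
    using that coeff_y_mult[of q a] by (auto simp: in_keys_iff)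
  then show "q \<noteq> 0 \<Longrightarrow> Poly_Mapping.keys (qmul q (qmono 0 1) a) = (+) (0, 1) ` Poly_Mapping.keys a"
    using qmul_keys[of _ q "qmono 0 1" a] by (intro equalityI subsetI) (simp, blast, blast)
qed

text \<open>A coefficient of a product can cancel only if its exponent is a sum in several ways. The sum of
  the largest exponents of the two factors, and that of the smallest, is a sum in just one way.\<close>

lemma extremal_key:
  assumes "q \<noteq> 0" "i \<in> Poly_Mapping.keys a" "j \<in> Poly_Mapping.keys b"
    and "\<And>i' j'. i' \<in> Poly_Mapping.keys a \<Longrightarrow> j' \<in> Poly_Mapping.keys b \<Longrightarrow> i' + j' = i + j \<Longrightarrow>
      i' = i \<and> j' = j"
  shows "i + j \<in> Poly_Mapping.keys (qmul q a b)"
proof -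
  let ?t = "\<lambda>i j. Poly_Mapping.lookup a i * Poly_Mapping.lookup b j * q ^ (snd i * fst j)"
  have "Poly_Mapping.lookup (qmul q a b) (i + j) =
      (\<Sum>i'\<in>Poly_Mapping.keys a. \<Sum>j'\<in>Poly_Mapping.keys b. if i' = i then if j' = j then ?t i j else 0 else 0)"
    unfolding lookup_qmul using assms(4) by (intro sum.cong refl) auto
  also have "\<dots> = (\<Sum>i'\<in>Poly_Mapping.keys a. if i' = i then ?t i j else 0)"
    using assms(3) by (intro sum.cong refl) (auto simp: sum.delta)
  also have "\<dots> = ?t i j"
    using assms(2) by (simp add: sum.delta)
  finally show ?thesis
    using assms by (simp add: in_keys_iff)
qed

lemma prod_add_mono: "(i::nat \<times> nat) \<le> i' \<Longrightarrow> j \<le> j' \<Longrightarrow> i + j = i' + j' \<Longrightarrow> i = i' \<and> j = j'"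
  by (cases i; cases j; cases i'; cases j') auto

lemma prod_add_cancel: "(i::nat \<times> nat) + j \<le> k + i \<Longrightarrow> j \<le> k" "k + i \<le> (i::nat \<times> nat) + j \<Longrightarrow> k \<le> j"
  by (cases i; cases j; cases k; auto)+

lemma prod_add_left_mono: "(j::nat \<times> nat) \<le> k \<Longrightarrow> i + j \<le> i + k"
  by (cases i; cases j; cases k) auto

text \<open>The lexicographic order on exponents is total and compatible with addition. Comparing the largest
  exponents on both sides bounds the exponents of \<open>c\<close> by \<open>d\<close> from above, and comparing the
  smallest ones bounds them by \<open>d\<close> from below.\<close>

lemma shift_keys_single:
  assumes "q \<noteq> 0" "a \<noteq> 0" "Poly_Mapping.keys (qmul q a c) = (+) d ` Poly_Mapping.keys a"
  shows "Poly_Mapping.keys c = {d}"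
proof -
  let ?A = "Poly_Mapping.keys a" and ?C = "Poly_Mapping.keys c"
  have A: "finite ?A" "?A \<noteq> {}" using assms(2) by auto
  have C: "finite ?C" "?C \<noteq> {}" using A assms(3) by (auto simp: qmul_linear)
  have "Max ?A + Max ?C \<in> Poly_Mapping.keys (qmul q a c)"
  proof (rule extremal_key[OF assms(1)])
    fix i' j' assume "i' \<in> ?A" "j' \<in> ?C" "i' + j' = Max ?A + Max ?C"
    then show "i' = Max ?A \<and> j' = Max ?C"
      using A C by (intro prod_add_mono) simp_all
  qed (use A C in simp_all)
  then obtain k where k: "k \<in> ?A" "Max ?A + Max ?C = d + k"
    using assms(3) by blast
  have "Min ?A + Min ?C \<in> Poly_Mapping.keys (qmul q a c)"
  proof (rule extremal_key[OF assms(1)])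
    fix i' j' assume "i' \<in> ?A" "j' \<in> ?C" "i' + j' = Min ?A + Min ?C"
    then have "Min ?A = i' \<and> Min ?C = j'"
      using A C by (intro prod_add_mono) simp_all
    then show "i' = Min ?A \<and> j' = Min ?C" by simp
  qed (use A C in simp_all)
  then obtain l where l: "l \<in> ?A" "Min ?A + Min ?C = d + l"
    using assms(3) by blast
  have "Max ?A + Max ?C \<le> d + Max ?A"
    unfolding k(2) using k(1) A by (intro prod_add_left_mono) simp
  then have "Max ?C \<le> d" by (rule prod_add_cancel)
  have "d + Min ?A \<le> Min ?A + Min ?C"
    unfolding l(2) using l(1) A by (intro prod_add_left_mono) simp
  then have "d \<le> Min ?C" by (rule prod_add_cancel)
  have "c' = d" if "c' \<in> ?C" for c'
    using that C \<open>d \<le> Min ?C\<close> \<open>Max ?C \<le> d\<close> by (meson Max_ge Min_le antisym order_trans)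
  then show ?thesis using C(2) by blast
qed


lemma poly_mapping_single_key:
  assumes "Poly_Mapping.keys (a :: 'k \<Rightarrow>\<^sub>0 complex) = {i}"
  shows "a = Poly_Mapping.single i (Poly_Mapping.lookup a i)"
  by (subst poly_mapping_expand) (simp add: assms)

lemma power_inj_of_not_root_of_unity:
  fixes q :: complex
  assumes "q \<noteq> 0" "\<forall>n::nat. n > 0 \<longrightarrow> q ^ n \<noteq> 1" "q ^ m = q ^ n"
  shows "m = n"
proof -
  have "\<not> m < n" if "q ^ m = q ^ n" for m n
  proof
    assume "m < n"
    then have "q ^ n = q ^ m * q ^ (n - m)" by (simp flip: power_add)
    then have "q ^ (n - m) = 1" using that assms(1) by simp
    then show False using assms(2) \<open>m < n\<close> by simp
  qed
  from this[OF assms(3)] this[OF assms(3)[symmetric]] show ?thesis by simp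
qed

text \<open>Normality makes \<open>xa\<close> equal to some \<open>ac\<close>, and by \<open>shift_keys_single\<close> this \<open>c\<close> is a multiple of \<open>x\<close>. But
  \<open>ax\<close> rescales the coefficient of \<open>a\<close> at \<open>x\<^sup>m y\<^sup>n\<close> by \<open>q\<^sup>n\<close> in comparison with \<open>xa\<close>, so only one
  value of \<open>n\<close> occurs in \<open>a\<close>. The same argument with \<open>y\<close> leaves one value of \<open>m\<close>.\<close>

lemma normal_element_monomial:
  assumes q: "q \<noteq> 0" "\<forall>n::nat. n > 0 \<longrightarrow> q ^ n \<noteq> 1"
    and "a \<noteq> 0" and normal: "\<And>b. \<exists>c. qmul q b a = qmul q a c"
  shows "\<exists>i c. c \<noteq> 0 \<and> a = Poly_Mapping.single i c"
proof -
  obtain c where c: "qmul q (qmono 1 0) a = qmul q a c" using normal by blast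
  then have "Poly_Mapping.keys c = {(1, 0)}"
    using shift_keys_single[OF q(1) assms(3)] keys_x_mult[of q a] by metis
  then have "c = Poly_Mapping.single (1, 0) (coeff c 1 0)" by (rule poly_mapping_single_key)
  then obtain \<gamma> where \<gamma>: "c = scalar \<gamma> * qmono 1 0"
    by (metis scalar_mult_single mult.right_neutral)
  have 1: "\<gamma> * q ^ n = 1" if "(m, n) \<in> Poly_Mapping.keys a" for m n
  proof -
    have "coeff a m n = \<gamma> * (q ^ n * coeff a m n)"
      using coeff_x_mult[of q a m n] coeff_mult_x[of q a m n]
      by (simp only: c \<gamma> qmul_linear lookup_scalar_mult)
    then show ?thesis using that by (simp add: in_keys_iff)
  qed
  obtain d where d: "qmul q (qmono 0 1) a = qmul q a d" using normal by blast
  then have "Poly_Mapping.keys d = {(0, 1)}"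
    using shift_keys_single[OF q(1) assms(3)] keys_y_mult[OF q(1), of a] by metis
  then have "d = Poly_Mapping.single (0, 1) (coeff d 0 1)" by (rule poly_mapping_single_key)
  then obtain \<delta> where \<delta>: "d = scalar \<delta> * qmono 0 1"
    by (metis scalar_mult_single mult.right_neutral)
  have 2: "q ^ m = \<delta>" if "(m, n) \<in> Poly_Mapping.keys a" for m n
  proof -
    have "q ^ m * coeff a m n = \<delta> * coeff a m n"
      using coeff_y_mult[of q a m n] coeff_mult_y[of q a m n]
      by (simp only: d \<delta> qmul_linear lookup_scalar_mult)
    then show ?thesis using that by (simp add: in_keys_iff)
  qed
  obtain m n where mn: "(m, n) \<in> Poly_Mapping.keys a"
    using assms(3) by (metis all_not_in_conv keys_eq_empty prod.exhaust)
  have "k = (m, n)" if "k \<in> Poly_Mapping.keys a" for k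
  proof -
    obtain m' n' where k: "k = (m', n')" by (cases k)
    have "\<gamma> * q ^ n' = \<gamma> * q ^ n" and "\<gamma> \<noteq> 0"
      using 1[OF mn] 1[of m' n'] that k by auto
    then have "n' = n"
      using power_inj_of_not_root_of_unity[OF q, of n' n] by simp
    moreover have "m' = m"
      using power_inj_of_not_root_of_unity[OF q, of m' m] 2[OF mn] 2[of m' n'] that k by simp
    ultimately show ?thesis by (simp add: k)
  qed
  then have "Poly_Mapping.keys a = {(m, n)}" using mn by blast
  from poly_mapping_single_key[OF this] mn show ?thesis
    by (metis in_keys_iff)
qed

lemma x_normal: "\<exists>c. qmul q b (qmono 1 0) = qmul q (qmono 1 0) c"
proof (induction b rule: poly_mapping_additive_induct)
  case (single i d)
  show ?case
    by (cases i) (auto simp: qmul_single intro!: exI[of _ "Poly_Mapping.single i (d * q ^ snd i)"])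
next
  case (add b b')
  then obtain c c' where "qmul q b (qmono 1 0) = qmul q (qmono 1 0) c"
    "qmul q b' (qmono 1 0) = qmul q (qmono 1 0) c'" by blast
  then show ?case by (intro exI[of _ "c + c'"]) (simp add: qmul_linear)
qed

lemma y_normal:
  assumes "q \<noteq> 0"
  shows "\<exists>c. qmul q b (qmono 0 1) = qmul q (qmono 0 1) c"
proof (induction b rule: poly_mapping_additive_induct)
  case (single i d)
  show ?case
    using assms
    by (cases i) (auto simp: qmul_single intro!: exI[of _ "Poly_Mapping.single i (d / q ^ fst i)"])
next
  case (add b b')
  then obtain c c' where "qmul q b (qmono 0 1) = qmul q (qmono 0 1) c"
    "qmul q b' (qmono 0 1) = qmul q (qmono 0 1) c'" by blast
  then show ?case by (intro exI[of _ "c + c'"]) (simp add: qmul_linear)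
qed

definition qaut :: "complex \<Rightarrow> (qpoly \<Rightarrow> qpoly) \<Rightarrow> bool" where
  "qaut q \<psi> \<longleftrightarrow> clinear \<psi> \<and> (\<forall>a b. \<psi> (qmul q a b) = qmul q (\<psi> a) (\<psi> b)) \<and> \<psi> 1 = 1 \<and> bij \<psi>"

lemma hom_on_monomials:
  assumes "clinear \<psi>" "\<And>a b. \<psi> (qmul q a b) = qmul q (\<psi> a) (\<psi> b)" "\<psi> 1 = 1"
    and x: "\<psi> (qmono 1 0) = Poly_Mapping.single (i1, i2) \<alpha>"
    and y: "\<psi> (qmono 0 1) = Poly_Mapping.single (j1, j2) \<beta>"
  shows "\<exists>c. \<psi> (qmono m n) = Poly_Mapping.single (m * i1 + n * j1, m * i2 + n * j2) c"
proof -
  have X: "\<exists>c. \<psi> (qmono m 0) = Poly_Mapping.single (m * i1, m * i2) c" for m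
  proof (induction m)
    case 0
    then show ?case using assms(3) by (auto simp: qpoly_one)
  next
    case (Suc m)
    have "\<psi> (qmono (Suc m) 0) = qmul q (\<psi> (qmono 1 0)) (\<psi> (qmono m 0))"
      unfolding assms(2)[symmetric] by (simp add: qmul_single)
    then show ?case using Suc unfolding x by (auto simp: qmul_single)
  qed
  have Y: "\<exists>c. \<psi> (qmono 0 n) = Poly_Mapping.single (n * j1, n * j2) c" for n
  proof (induction n)
    case 0
    then show ?case using assms(3) by (auto simp: qpoly_one)
  next
    case (Suc n)
    have "\<psi> (qmono 0 (Suc n)) = qmul q (\<psi> (qmono 0 1)) (\<psi> (qmono 0 n))"
      unfolding assms(2)[symmetric] by (simp add: qmul_single)
    then show ?case using Suc unfolding y by (auto simp: qmul_single)
  qed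
  have "\<psi> (qmono m n) = qmul q (\<psi> (qmono m 0)) (\<psi> (qmono 0 n))"
    unfolding assms(2)[symmetric] by (simp add: qmul_single)
  then show ?thesis using X[of m] Y[of n] by (auto simp: qmul_single)
qed

lemma nat_combination_one:
  assumes "(1::nat) = m * i + n * j"
  shows "m = 1 \<and> i = 1 \<or> n = 1 \<and> j = 1"
proof (cases "m * i = 0")
  case True
  then have "n * j = 1" using assms by simp
  then show ?thesis by simp
next
  case False
  then have "m * i = 1" using assms by linarith
  then show ?thesis by simp
qed

text \<open>The images of \<open>x\<close> and \<open>y\<close> are normal, hence multiples of monomials with exponents \<open>i\<close> and \<open>j\<close>. By
  surjectivity the exponents of \<open>x\<close> and \<open>y\<close> are combinations of \<open>i\<close> and \<open>j\<close> with natural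
  coefficients, so \<open>i\<close> and \<open>j\<close> are \<open>(1, 0)\<close> and \<open>(0, 1)\<close> in some order. Interchanging \<open>x\<close> and \<open>y\<close>
  is excluded because it would give \<open>q\<^sup>2 = 1\<close>.\<close>

theorem automorphism_diagonal:
  assumes q: "q \<noteq> 0" "\<forall>n::nat. n > 0 \<longrightarrow> q ^ n \<noteq> 1" and "qaut q \<psi>"
  obtains \<alpha> \<beta> where "\<alpha> \<noteq> 0" "\<beta> \<noteq> 0"
    "\<psi> (qmono 1 0) = Poly_Mapping.single (1, 0) \<alpha>" "\<psi> (qmono 0 1) = Poly_Mapping.single (0, 1) \<beta>"
proof -
  have lin: "clinear \<psi>" and mult: "\<And>a b. \<psi> (qmul q a b) = qmul q (\<psi> a) (\<psi> b)" and one: "\<psi> 1 = 1"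
    and bij: "bij \<psi>" using assms(3) by (auto simp: qaut_def)
  have nonzero: "\<psi> a \<noteq> 0" if "a \<noteq> 0" for a
    using that bij clinear_zero[OF lin] by (metis bij_pointE)
  have normal: "\<exists>c. qmul q b (\<psi> a) = qmul q (\<psi> a) c" if "\<And>b. \<exists>c. qmul q b a = qmul q a c" for a b
  proof -
    obtain b' where "b = \<psi> b'" using bij by (metis bij_pointE)
    with that[of b'] show ?thesis by (metis mult)
  qed
  have nz: "qmono m n \<noteq> 0" for m n
    by (metis insert_not_empty keys_single keys_zero zero_neq_one)
  obtain i \<alpha> where X: "\<alpha> \<noteq> 0" "\<psi> (qmono 1 0) = Poly_Mapping.single i \<alpha>"
    using normal_element_monomial[OF q nonzero[OF nz] normal[OF x_normal]] by blast
  obtain j \<beta> where Y: "\<beta> \<noteq> 0" "\<psi> (qmono 0 1) = Poly_Mapping.single j \<beta>"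
    using normal_element_monomial[OF q nonzero[OF nz] normal[OF y_normal[OF q(1)]]] by blast
  obtain i1 i2 j1 j2 where ij: "i = (i1, i2)" "j = (j1, j2)" by (cases i; cases j)
  have keys: "\<exists>m n. k = (m * i1 + n * j1, m * i2 + n * j2)" if "k \<in> Poly_Mapping.keys (\<psi> a)" for k a
    using that
  proof (induction a rule: poly_mapping_additive_induct)
    case (single l c)
    obtain m n where l: "l = (m, n)" by (cases l)
    obtain c' where c': "\<psi> (qmono m n) = Poly_Mapping.single (m * i1 + n * j1, m * i2 + n * j2) c'"
      using hom_on_monomials[OF lin mult one X(2)[unfolded ij] Y(2)[unfolded ij]] by blast
    have "\<psi> (Poly_Mapping.single l c) = Poly_Mapping.single (m * i1 + n * j1, m * i2 + n * j2) (c * c')"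
      using clinear_single[OF lin, of l c] by (simp add: l c' scalar_mult_single)
    with single show ?case by (auto split: if_splits)
  next
    case (add a b)
    then show ?case using keys_add[of "\<psi> a" "\<psi> b"] by (auto simp: clinear_add[OF lin])
  qed
  have "\<exists>m n. k = (m * i1 + n * j1, m * i2 + n * j2)" for k
  proof -
    obtain a where "Poly_Mapping.single k 1 = \<psi> a" using bij by (metis bij_pointE)
    with keys[of k a] show ?thesis by (metis insertI1 keys_single zero_neq_one)
  qed
  from this[of "(1, 0)"] this[of "(0, 1)"] obtain m n m' n'
    where *: "1 = m * i1 + n * j1" "0 = m * i2 + n * j2" "0 = m' * i1 + n' * j1" "1 = m' * i2 + n' * j2"
    by auto
  have "i = (1, 0) \<or> j = (1, 0)"
    using nat_combination_one[OF *(1)] *(2) unfolding ij by auto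
  moreover have "i = (0, 1) \<or> j = (0, 1)"
    using nat_combination_one[OF *(4)] *(3) unfolding ij by auto
  ultimately have "i = (1, 0) \<and> j = (0, 1) \<or> i = (0, 1) \<and> j = (1, 0)"
    by auto
  then show ?thesis
  proof
    assume "i = (1, 0) \<and> j = (0, 1)"
    with X Y show ?thesis using that by blast
  next
    assume **: "i = (0, 1) \<and> j = (1, 0)"
    have "qmul q (qmono 0 1) (qmono 1 0) = scalar q * qmul q (qmono 1 0) (qmono 0 1)"
      by (simp add: qmul_single scalar_mult_single)
    from arg_cong[OF this, of \<psi>] have "\<beta> * \<alpha> = q * (\<alpha> * \<beta> * q)"
      unfolding mult clinear_scalar[OF lin] X(2) Y(2)
      using ** by (auto simp: qmul_single scalar_mult_single dest: injD[OF inj_single])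
    then have "q ^ 2 = 1" using X Y by (simp add: power2_eq_square mult.commute)
    then show ?thesis using q(2) by simp
  qed
qed

lemma diagonal_on_monomials:
  assumes "clinear \<psi>" "\<And>a b. \<psi> (qmul q a b) = qmul q (\<psi> a) (\<psi> b)" "\<psi> 1 = 1"
    and x: "\<psi> (qmono 1 0) = Poly_Mapping.single (1, 0) \<alpha>"
    and y: "\<psi> (qmono 0 1) = Poly_Mapping.single (0, 1) \<beta>"
  shows "\<psi> (Poly_Mapping.single (m, n) c) = Poly_Mapping.single (m, n) (c * \<alpha> ^ m * \<beta> ^ n)"
proof -
  have X: "\<psi> (qmono m 0) = Poly_Mapping.single (m, 0) (\<alpha> ^ m)" for m
  proof (induction m)
    case 0
    then show ?case using assms(3) by (simp add: qpoly_one)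
  next
    case (Suc m)
    have "\<psi> (qmono (Suc m) 0) = qmul q (\<psi> (qmono 1 0)) (\<psi> (qmono m 0))"
      unfolding assms(2)[symmetric] by (simp add: qmul_single)
    then show ?case using Suc unfolding x by (simp add: qmul_single)
  qed
  have Y: "\<psi> (qmono 0 n) = Poly_Mapping.single (0, n) (\<beta> ^ n)" for n
  proof (induction n)
    case 0
    then show ?case using assms(3) by (simp add: qpoly_one)
  next
    case (Suc n)
    have "\<psi> (qmono 0 (Suc n)) = qmul q (\<psi> (qmono 0 1)) (\<psi> (qmono 0 n))"
      unfolding assms(2)[symmetric] by (simp add: qmul_single)
    then show ?case using Suc unfolding y by (simp add: qmul_single)
  qed
  have "\<psi> (qmono m n) = qmul q (\<psi> (qmono m 0)) (\<psi> (qmono 0 n))"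
    unfolding assms(2)[symmetric] by (simp add: qmul_single)
  then have "\<psi> (qmono m n) = Poly_Mapping.single (m, n) (\<alpha> ^ m * \<beta> ^ n)"
    by (simp add: X Y qmul_single)
  then show ?thesis
    by (subst clinear_single[OF assms(1)]) (simp add: scalar_mult_single mult.assoc)
qed

section \<open>Explicit operators of the three-parameter family\<close>

lemma all_uq_gen: "(\<forall>g. P g) \<longleftrightarrow> P Gk \<and> P Gki \<and> P Ge \<and> P Gf"
  by (metis uq_gen.exhaust)

lemma uq_action_iff:
  "uq_action q T \<longleftrightarrow> (\<forall>g. clinear (T g)) \<and>
    (\<forall>a. T Gki (T Gk a) = a) \<and> (\<forall>a. T Gk (T Gki a) = a) \<and>
    (\<forall>a. T Gk (T Ge a) = scalar (q\<^sup>2) * T Ge (T Gk a)) \<and>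
    (\<forall>a. T Gk (T Gf a) = scalar (inverse (q\<^sup>2)) * T Gf (T Gk a)) \<and>
    (\<forall>a. T Ge (T Gf a) - T Gf (T Ge a) = scalar (1 / (q - inverse q)) * (T Gk a - T Gki a)) \<and>
    (\<forall>a b. T Gk (qmul q a b) = qmul q (T Gk a) (T Gk b)) \<and>
    (\<forall>a b. T Gki (qmul q a b) = qmul q (T Gki a) (T Gki b)) \<and>
    (\<forall>a b. T Ge (qmul q a b) = qmul q a (T Ge b) + qmul q (T Ge a) (T Gk b)) \<and>
    (\<forall>a b. T Gf (qmul q a b) = qmul q (T Gf a) b + qmul q (T Gki a) (T Gf b)) \<and>
    T Gk 1 = 1 \<and> T Gki 1 = 1 \<and> T Ge 1 = 0 \<and> T Gf 1 = 0"
  unfolding uq_action_def uq_relators_def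
  by (simp add: all_uq_gen[of "\<lambda>g. \<forall>a b. T g (qmul q a b) = act_tensor q T (gen_comult g) a b"]
      all_uq_gen[of "\<lambda>g. T g 1 = scalar (gen_counit g)"] act_diff act_single act_one scalar_mult_single
      right_diff_distrib act_tensor_add act_tensor_single)

text \<open>Every monomial arises from \<open>1\<close> by left multiplications with \<open>x\<close> and \<open>y\<close>.\<close>

lemma qpoly_generated:
  assumes "clinear f" "clinear g" "f 1 = g 1"
    and x: "\<And>a. f a = g a \<Longrightarrow> f (qmul q (qmono 1 0) a) = g (qmul q (qmono 1 0) a)"
    and y: "\<And>a. f a = g a \<Longrightarrow> f (qmul q (qmono 0 1) a) = g (qmul q (qmono 0 1) a)"
  shows "f a = g a"
proof (rule clinear_eqI[OF assms(1,2)])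
  fix i :: "nat \<times> nat"
  have Y: "f (qmono 0 n) = g (qmono 0 n)" for n
  proof (induction n)
    case 0
    then show ?case using assms(3) by (simp add: qpoly_one)
  next
    case (Suc n)
    from y[OF this] show ?case by (simp add: qmul_single)
  qed
  have "f (qmono m n) = g (qmono m n)" for m n
  proof (induction m)
    case 0
    show ?case by (rule Y)
  next
    case (Suc m)
    from x[OF this] show ?case by (simp add: qmul_single)
  qed
  then show "f (Poly_Mapping.single i 1) = g (Poly_Mapping.single i 1)"
    by (cases i) simp
qed

text \<open>The Leibniz rules of \<open>e\<close> (with \<open>L\<close> the identity and \<open>R = k\<close>) and of \<open>f\<close> (with \<open>L = k\<inverse>\<close> and \<open>R\<close> the
  identity) need to be checked only when the left factor is \<open>x\<close> or \<open>y\<close>: the elements \<open>a\<close> for which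
  the rule holds are closed under left multiplication by these.\<close>

lemma twisted_leibniz:
  assumes lin: "clinear D" "clinear L" "clinear R"
    and mult: "\<And>a b. L (qmul q a b) = qmul q (L a) (L b)" "\<And>a b. R (qmul q a b) = qmul q (R a) (R b)"
    and one: "L 1 = 1" "D 1 = 0"
    and x: "\<And>b. D (qmul q (qmono 1 0) b) = qmul q (L (qmono 1 0)) (D b) + qmul q (D (qmono 1 0)) (R b)"
    and y: "\<And>b. D (qmul q (qmono 0 1) b) = qmul q (L (qmono 0 1)) (D b) + qmul q (D (qmono 0 1)) (R b)"
  shows "D (qmul q a b) = qmul q (L a) (D b) + qmul q (D a) (R b)"
proof (rule qpoly_generated[of "\<lambda>a. D (qmul q a b)" "\<lambda>a. qmul q (L a) (D b) + qmul q (D a) (R b)" q])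
  show "clinear (\<lambda>a. D (qmul q a b))" "clinear (\<lambda>a. qmul q (L a) (D b) + qmul q (D a) (R b))"
    using lin by (simp_all add: clinear_def qmul_linear distrib_left)
next
  fix a assume "D (qmul q a b) = qmul q (L a) (D b) + qmul q (D a) (R b)"
  then show "D (qmul q (qmul q (qmono 1 0) a) b) =
      qmul q (L (qmul q (qmono 1 0) a)) (D b) + qmul q (D (qmul q (qmono 1 0) a)) (R b)"
    by (simp only: x mult qmul_assoc qmul_linear add.assoc)
next
  fix a assume "D (qmul q a b) = qmul q (L a) (D b) + qmul q (D a) (R b)"
  then show "D (qmul q (qmul q (qmono 0 1) a) b) =
      qmul q (L (qmul q (qmono 0 1) a)) (D b) + qmul q (D (qmul q (qmono 0 1) a)) (R b)"
    by (simp only: y mult qmul_assoc qmul_linear add.assoc)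
qed (simp add: one qmul_one_left qmul_linear)

text \<open>By the Leibniz rules, \<open>e\<close> sends \<open>x\<^sup>m y\<^sup>n\<close> to a multiple of \<open>x\<^sup>m\<^sup>-\<^sup>1 y\<^sup>n\<close>, and \<open>f\<close> sends it to a combination of
  \<open>x\<^sup>m\<^sup>+\<^sup>1 y\<^sup>n\<close>, \<open>x\<^sup>m y\<^sup>n\<^sup>+\<^sup>2\<close> and \<open>x\<^sup>m\<^sup>-\<^sup>1 y\<^sup>n\<^sup>+\<^sup>4\<close>. The coefficients are the geometric sums
  \<open>a q\<^sup>-\<^sup>n (\<Sum>i<m. q\<^sup>-\<^sup>2\<^sup>i)\<close>, \<open>- q a\<inverse> (\<Sum>i<m+n. q\<^sup>2\<^sup>i)\<close>, \<open>s q\<^sup>2\<^sup>m (\<Sum>i<n. q\<^sup>i)\<close> and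
  \<open>t q\<^sup>2\<^sup>(\<^sup>m\<^sup>-\<^sup>1\<^sup>) (\<Sum>i<m. q\<^sup>2\<^sup>i)\<close>, written in closed form with powers of \<open>q\<^sup>m\<close> and \<open>q\<^sup>n\<close> so that
  identities between them become identities of rational functions.\<close>

definition e_coeff :: "complex \<Rightarrow> complex \<Rightarrow> nat \<Rightarrow> nat \<Rightarrow> complex" where
  "e_coeff q a m n = a * q\<^sup>2 * ((q ^ m)\<^sup>2 - 1) / ((q ^ m)\<^sup>2 * q ^ n * (q\<^sup>2 - 1))"

definition f_coeff_xy :: "complex \<Rightarrow> complex \<Rightarrow> nat \<Rightarrow> nat \<Rightarrow> complex" where
  "f_coeff_xy q a m n = - q / a * ((q ^ m)\<^sup>2 * (q ^ n)\<^sup>2 - 1) / (q\<^sup>2 - 1)"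

definition f_coeff_s :: "complex \<Rightarrow> complex \<Rightarrow> nat \<Rightarrow> nat \<Rightarrow> complex" where
  "f_coeff_s q s m n = s * (q ^ m)\<^sup>2 * (q ^ n - 1) / (q - 1)"

definition f_coeff_t :: "complex \<Rightarrow> complex \<Rightarrow> nat \<Rightarrow> complex" where
  "f_coeff_t q t m = t * (q ^ m)\<^sup>2 * ((q ^ m)\<^sup>2 - 1) / (q\<^sup>2 * (q\<^sup>2 - 1))"

lemma e_coeff_0: "e_coeff q a 0 n = 0" and f_coeff_t_0: "f_coeff_t q t 0 = 0"
  by (simp_all add: e_coeff_def f_coeff_t_def)

lemma f_coeff_0: "f_coeff_xy q a 0 0 = 0" "f_coeff_s q s 0 0 = 0" "f_coeff_s q s m 0 = 0"
  by (simp_all add: f_coeff_xy_def f_coeff_s_def)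

text \<open>The truncated exponent \<open>m - 1\<close> is harmless: for \<open>m = 0\<close> its coefficient vanishes.\<close>

fun fam_mono :: "complex \<Rightarrow> complex \<times> complex \<times> complex \<Rightarrow> uq_gen \<Rightarrow> nat \<times> nat \<Rightarrow> qpoly" where
  "fam_mono q (a, s, t) Gk (m, n) = Poly_Mapping.single (m, n) (1 / ((q ^ m)\<^sup>2 * q ^ n))"
| "fam_mono q (a, s, t) Gki (m, n) = Poly_Mapping.single (m, n) ((q ^ m)\<^sup>2 * q ^ n)"
| "fam_mono q (a, s, t) Ge (m, n) = Poly_Mapping.single (m - 1, n) (e_coeff q a m n)"
| "fam_mono q (a, s, t) Gf (m, n) =
    Poly_Mapping.single (m + 1, n) (f_coeff_xy q a m n) +
    Poly_Mapping.single (m, n + 2) (f_coeff_s q s m n) +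
    Poly_Mapping.single (m - 1, n + 4) (f_coeff_t q t m)"

definition fam :: "complex \<Rightarrow> complex \<times> complex \<times> complex \<Rightarrow> uq_gen \<Rightarrow> qpoly \<Rightarrow> qpoly" where
  "fam q p g = lin_ext (Poly_Mapping.single 0) (fam_mono q p g)"

lemma clinear_fam: "clinear (fam q p g)"
  unfolding fam_def by (rule clinear_lin_ext)

lemma fam_single: "fam q p g (Poly_Mapping.single i c) = scalar c * fam_mono q p g i"
  by (simp add: fam_def scalar.lin_ext_single)

lemmas fam_linear = clinear_add[OF clinear_fam] clinear_scalar[OF clinear_fam]
  clinear_diff[OF clinear_fam] clinear_zero[OF clinear_fam]

lemma add_single_eqI: "c = d \<Longrightarrow> Poly_Mapping.single i c = Poly_Mapping.single i d"
  by simp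

context
  fixes q a s t :: complex
  assumes q: "q \<noteq> 0" "\<forall>n::nat. n > 0 \<longrightarrow> q ^ n \<noteq> 1" and a: "a \<noteq> 0"
begin

lemma q_ne: "q \<noteq> 1" "q\<^sup>2 \<noteq> 1" "q\<^sup>2 - 1 \<noteq> 0" "q - 1 \<noteq> 0"
  using q(2)[rule_format, of 1] q(2)[rule_format, of 2] by simp_all

lemma e_coeff_Suc_left: "e_coeff q a (Suc m) n = e_coeff q a m n + a / ((q ^ m)\<^sup>2 * q ^ n)"
proof -
  have "a * q\<^sup>2 * ((q * u)\<^sup>2 - 1) / ((q * u)\<^sup>2 * v * d) = a * q\<^sup>2 * (u\<^sup>2 - 1) / (u\<^sup>2 * v * d) + a / (u\<^sup>2 * v)"
    if "u \<noteq> 0" "v \<noteq> 0" "d = q\<^sup>2 - 1" "d \<noteq> 0" for u v d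
    using that(1,2,4) q(1) by (simp add: field_simps) (simp add: that(3) algebra_simps power2_eq_square power4_eq_xxxx)
  from this[of "q ^ m" "q ^ n" "q\<^sup>2 - 1"] show ?thesis
    using q(1) q_ne by (simp add: e_coeff_def)
qed

lemma e_coeff_Suc_right: "e_coeff q a m n = q * e_coeff q a m (Suc n)"
  using q(1) q_ne by (simp add: e_coeff_def field_simps)

lemma f_coeff_xy_Suc:
  "f_coeff_xy q a (Suc m) n = - q / a + q\<^sup>2 * f_coeff_xy q a m n"
  "f_coeff_xy q a m (Suc n) = - q / a + q\<^sup>2 * f_coeff_xy q a m n"
proof -
  have "- q / a * (q\<^sup>2 * w - 1) / d = - q / a + q\<^sup>2 * (- q / a * (w - 1) / d)"
    if "d = q\<^sup>2 - 1" "d \<noteq> 0" for w d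
    using that(2) a by (simp add: field_simps) (simp add: that(1) algebra_simps power2_eq_square)
  from this[of "q\<^sup>2 - 1" "(q ^ m)\<^sup>2 * (q ^ n)\<^sup>2"]
  show "f_coeff_xy q a (Suc m) n = - q / a + q\<^sup>2 * f_coeff_xy q a m n"
    "f_coeff_xy q a m (Suc n) = - q / a + q\<^sup>2 * f_coeff_xy q a m n"
    using q_ne by (simp_all add: f_coeff_xy_def power_mult_distrib mult_ac)
qed

lemma f_coeff_s_Suc:
  "f_coeff_s q s (Suc m) n = q\<^sup>2 * f_coeff_s q s m n"
  "f_coeff_s q s m (Suc n) = s * (q ^ m)\<^sup>2 + q * f_coeff_s q s m n"
  using q_ne by (simp_all add: f_coeff_s_def power_mult_distrib field_simps)

lemma f_coeff_t_Suc: "f_coeff_t q t (Suc m) = t * (q ^ m) ^ 4 + q\<^sup>2 * f_coeff_t q t m"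
proof -
  have "t * (q * u)\<^sup>2 * ((q * u)\<^sup>2 - 1) / (q\<^sup>2 * d) = t * u ^ 4 + q\<^sup>2 * (t * u\<^sup>2 * (u\<^sup>2 - 1) / (q\<^sup>2 * d))"
    if "d = q\<^sup>2 - 1" "d \<noteq> 0" for u d
    using that(2) q(1) by (simp add: field_simps)
      (simp add: that(1) algebra_simps power2_eq_square power4_eq_xxxx)
  from this[of "q\<^sup>2 - 1" "q ^ m"] show ?thesis
    using q_ne by (simp add: f_coeff_t_def)
qed

lemma fam_gk_mult: "fam q (a, s, t) Gk (qmul q b c) = qmul q (fam q (a, s, t) Gk b) (fam q (a, s, t) Gk c)"
proof (rule clinear2_eqI[of "\<lambda>b c. fam q (a, s, t) Gk (qmul q b c)"
      "\<lambda>b c. qmul q (fam q (a, s, t) Gk b) (fam q (a, s, t) Gk c)"])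
  fix i j :: "nat \<times> nat"
  show "fam q (a, s, t) Gk (qmul q (Poly_Mapping.single i 1) (Poly_Mapping.single j 1)) =
    qmul q (fam q (a, s, t) Gk (Poly_Mapping.single i 1)) (fam q (a, s, t) Gk (Poly_Mapping.single j 1))"
    by (cases i; cases j)
      (simp add: fam_single qmul_single scalar_mult_single power_add power_mult_distrib mult_ac)
qed (simp_all add: clinear_def qmul_linear fam_linear)

lemma fam_gki_mult: "fam q (a, s, t) Gki (qmul q b c) = qmul q (fam q (a, s, t) Gki b) (fam q (a, s, t) Gki c)"
proof (rule clinear2_eqI[of "\<lambda>b c. fam q (a, s, t) Gki (qmul q b c)"
      "\<lambda>b c. qmul q (fam q (a, s, t) Gki b) (fam q (a, s, t) Gki c)"])
  fix i j :: "nat \<times> nat"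
  show "fam q (a, s, t) Gki (qmul q (Poly_Mapping.single i 1) (Poly_Mapping.single j 1)) =
    qmul q (fam q (a, s, t) Gki (Poly_Mapping.single i 1)) (fam q (a, s, t) Gki (Poly_Mapping.single j 1))"
    by (cases i; cases j)
      (simp add: fam_single qmul_single scalar_mult_single power_add power_mult_distrib mult_ac)
qed (simp_all add: clinear_def qmul_linear fam_linear)

lemma fam_one:
  "fam q (a, s, t) Gk 1 = 1" "fam q (a, s, t) Gki 1 = 1" "fam q (a, s, t) Ge 1 = 0" "fam q (a, s, t) Gf 1 = 0"
  unfolding qpoly_one by (simp_all add: fam_single e_coeff_0 f_coeff_0 f_coeff_t_0)

lemma fam_values:
  "fam q (a, s, t) Gk (qmono 1 0) = Poly_Mapping.single (1, 0) (inverse (q\<^sup>2))"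
  "fam q (a, s, t) Gk (qmono 0 1) = Poly_Mapping.single (0, 1) (inverse q)"
  "fam q (a, s, t) Gki (qmono 1 0) = Poly_Mapping.single (1, 0) (q\<^sup>2)"
  "fam q (a, s, t) Gki (qmono 0 1) = Poly_Mapping.single (0, 1) q"
  "fam q (a, s, t) Ge (qmono 1 0) = Poly_Mapping.single (0, 0) a"
  "fam q (a, s, t) Ge (qmono 0 1) = 0"
  "fam q (a, s, t) Gf (qmono 1 0) = Poly_Mapping.single (2, 0) (- q / a) + Poly_Mapping.single (0, 4) t"
  "fam q (a, s, t) Gf (qmono 0 1) = Poly_Mapping.single (1, 1) (- q / a) + Poly_Mapping.single (0, 3) s"
  by (simp_all add: fam_single field_simps e_coeff_0 e_coeff_Suc_left f_coeff_0 f_coeff_xy_Suc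
      f_coeff_s_Suc f_coeff_t_0 f_coeff_t_Suc numeral_2_eq_2 numeral_3_eq_3)

lemmas fam_expand = fam_single qmul_single qmul_linear fam_linear scalar_mult_single single_add distrib_left
  single_uminus single_diff

lemma fam_ge_leibniz:
  "fam q (a, s, t) Ge (qmul q b c) =
    qmul q b (fam q (a, s, t) Ge c) + qmul q (fam q (a, s, t) Ge b) (fam q (a, s, t) Gk c)"
proof (rule twisted_leibniz[of "fam q (a, s, t) Ge" "\<lambda>a. a" "fam q (a, s, t) Gk"])
  note lin = clinear_def qmul_linear fam_linear
  show "fam q (a, s, t) Ge (qmul q (qmono 1 0) b) = qmul q (qmono 1 0) (fam q (a, s, t) Ge b)
      + qmul q (fam q (a, s, t) Ge (qmono 1 0)) (fam q (a, s, t) Gk b)" (is "?f b = ?g b") for b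
  proof (rule clinear_qmono_eqI[of ?f ?g])
    fix m n
    show "fam q (a, s, t) Ge (qmul q (qmono 1 0) (qmono m n)) = qmul q (qmono 1 0) (fam q (a, s, t) Ge (qmono m n))
      + qmul q (fam q (a, s, t) Ge (qmono 1 0)) (fam q (a, s, t) Gk (qmono m n))"
      unfolding fam_values by (cases m) (simp_all add: fam_expand e_coeff_0 e_coeff_Suc_left)
  qed (simp_all add: lin distrib_left)
  show "fam q (a, s, t) Ge (qmul q (qmono 0 1) b) = qmul q (qmono 0 1) (fam q (a, s, t) Ge b)
      + qmul q (fam q (a, s, t) Ge (qmono 0 1)) (fam q (a, s, t) Gk b)" (is "?f b = ?g b") for b
  proof (rule clinear_qmono_eqI[of ?f ?g])
    fix m n
    show "fam q (a, s, t) Ge (qmul q (qmono 0 1) (qmono m n)) = qmul q (qmono 0 1) (fam q (a, s, t) Ge (qmono m n))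
      + qmul q (fam q (a, s, t) Ge (qmono 0 1)) (fam q (a, s, t) Gk (qmono m n))"
      unfolding fam_values
      by (cases m) (simp_all add: fam_expand e_coeff_0 e_coeff_Suc_right[of _ n] mult_ac)
  qed (simp_all add: lin distrib_left)
qed (simp_all add: fam_one fam_gk_mult clinear_fam clinear_id)

lemma fam_gf_leibniz:
  "fam q (a, s, t) Gf (qmul q b c) =
    qmul q (fam q (a, s, t) Gki b) (fam q (a, s, t) Gf c) + qmul q (fam q (a, s, t) Gf b) c"
proof (rule twisted_leibniz[of "fam q (a, s, t) Gf" "fam q (a, s, t) Gki" "\<lambda>a. a"])
  note lin = clinear_def qmul_linear fam_linear
  show "fam q (a, s, t) Gf (qmul q (qmono 1 0) b) = qmul q (fam q (a, s, t) Gki (qmono 1 0)) (fam q (a, s, t) Gf b)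
      + qmul q (fam q (a, s, t) Gf (qmono 1 0)) b" (is "?f b = ?g b") for b
  proof (rule clinear_qmono_eqI[of ?f ?g])
    fix m n
    show "fam q (a, s, t) Gf (qmul q (qmono 1 0) (qmono m n)) =
      qmul q (fam q (a, s, t) Gki (qmono 1 0)) (fam q (a, s, t) Gf (qmono m n))
      + qmul q (fam q (a, s, t) Gf (qmono 1 0)) (qmono m n)"
      unfolding fam_values
      by (cases m) (simp_all add: fam_expand f_coeff_xy_Suc(1)[of m] f_coeff_s_Suc(1)[of m]
        f_coeff_xy_Suc(1)[of "Suc _"] f_coeff_s_Suc(1)[of "Suc _"] f_coeff_xy_Suc(1)[of 0] f_coeff_s_Suc(1)[of 0]
        f_coeff_t_Suc[of "Suc _"] f_coeff_t_Suc[of 0] f_coeff_t_0 ac_simps power_mult power_add power_mult_distrib)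
  qed (simp_all add: lin distrib_left)
  show "fam q (a, s, t) Gf (qmul q (qmono 0 1) b) = qmul q (fam q (a, s, t) Gki (qmono 0 1)) (fam q (a, s, t) Gf b)
      + qmul q (fam q (a, s, t) Gf (qmono 0 1)) b" (is "?f b = ?g b") for b
  proof (rule clinear_qmono_eqI[of ?f ?g])
    fix m n
    show "fam q (a, s, t) Gf (qmul q (qmono 0 1) (qmono m n)) =
      qmul q (fam q (a, s, t) Gki (qmono 0 1)) (fam q (a, s, t) Gf (qmono m n))
      + qmul q (fam q (a, s, t) Gf (qmono 0 1)) (qmono m n)"
      unfolding fam_values
      by (cases m) (simp_all add: fam_expand f_coeff_xy_Suc(2) f_coeff_s_Suc(2) f_coeff_t_0
        ac_simps power_mult power_add power_mult_distrib power2_eq_square numeral_3_eq_3 right_diff_distrib)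
  qed (simp_all add: lin distrib_left)
qed (simp_all add: fam_one fam_gki_mult clinear_fam clinear_id)

lemma inverse_difference: "1 / (q - inverse q) = q / (q\<^sup>2 - 1)"
  using q(1) q_ne by (simp add: field_simps power2_eq_square)

lemma ef_diagonal_0:
  "f_coeff_xy q a 0 n * e_coeff q a (Suc 0) n = 1 / (q - inverse q) * (1 / q ^ n - q ^ n)"
proof -
  have "- q / a * (v\<^sup>2 - 1) / d * (a * q\<^sup>2 * d / (q\<^sup>2 * v * d)) = q / d * (1 / v - v)"
    if "v \<noteq> 0" "d \<noteq> 0" for v d
    using that q(1) a by (simp add: field_simps power2_eq_square)
  from this[of "q ^ n" "q\<^sup>2 - 1"] show ?thesis
    unfolding inverse_difference f_coeff_xy_def e_coeff_def using q(1) q_ne by simp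
qed

lemma ef_diagonal_Suc:
  "f_coeff_xy q a (Suc k) n * e_coeff q a (Suc (Suc k)) n - e_coeff q a (Suc k) n * f_coeff_xy q a k n
    = 1 / (q - inverse q) * (1 / ((q ^ Suc k)\<^sup>2 * q ^ n) - (q ^ Suc k)\<^sup>2 * q ^ n)"
proof -
  have "- q / a * ((q * u)\<^sup>2 * v\<^sup>2 - 1) / d * (a * q\<^sup>2 * ((q * (q * u))\<^sup>2 - 1) / ((q * (q * u))\<^sup>2 * v * d))
      - a * q\<^sup>2 * ((q * u)\<^sup>2 - 1) / ((q * u)\<^sup>2 * v * d) * (- q / a * (u\<^sup>2 * v\<^sup>2 - 1) / d)
      = q / d * (1 / ((q * u)\<^sup>2 * v) - (q * u)\<^sup>2 * v)"
    if "u \<noteq> 0" "v \<noteq> 0" "d = q\<^sup>2 - 1" "d \<noteq> 0" for u v d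
    using that(1,2,4) q(1) a
    by (simp add: divide_simps) (simp add: that(3) algebra_simps power2_eq_square power4_eq_xxxx)
  from this[of "q ^ k" "q ^ n" "q\<^sup>2 - 1"] show ?thesis
    unfolding inverse_difference f_coeff_xy_def e_coeff_def using q(1) q_ne by simp
qed

lemma ef_s:
  "f_coeff_s q s (Suc k) n * e_coeff q a (Suc k) (n + 2) = e_coeff q a (Suc k) n * f_coeff_s q s k n"
  using e_coeff_Suc_right[of "Suc k" n] e_coeff_Suc_right[of "Suc k" "Suc n"]
  by (simp add: f_coeff_s_Suc power2_eq_square)

lemma ef_t:
  "f_coeff_t q t (Suc k) * e_coeff q a k (n + 4) = e_coeff q a (Suc k) n * f_coeff_t q t k"
  unfolding f_coeff_t_def e_coeff_def using q(1) q_ne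
  by (simp add: divide_simps power_add) (algebra)

text \<open>In the commutator the terms with \<open>s\<close> and \<open>t\<close> cancel (\<open>ef_s\<close>, \<open>ef_t\<close>), and what is left is a
  multiple of the monomial itself.\<close>

lemma fam_ef:
  "fam q (a, s, t) Ge (fam q (a, s, t) Gf b) - fam q (a, s, t) Gf (fam q (a, s, t) Ge b) =
    scalar (1 / (q - inverse q)) * (fam q (a, s, t) Gk b - fam q (a, s, t) Gki b)" (is "?f b = ?g b")
proof (rule clinear_qmono_eqI[of ?f ?g])
  show "clinear ?f" "clinear ?g"
    by (intro clinear_minus clinear_times clinear_comp[OF clinear_fam clinear_fam] clinear_fam)+
  fix m n
  show "?f (qmono m n) = ?g (qmono m n)"
  proof (cases m)
    case 0
    then show ?thesis
      by (simp add: fam_single fam_linear scalar_mult_single e_coeff_0 f_coeff_t_0 ef_diagonal_0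
          flip: single_diff)
  next
    case (Suc k)
    have "?f (qmono m n) =
        Poly_Mapping.single (m, n) (f_coeff_xy q a (Suc k) n * e_coeff q a (Suc (Suc k)) n) +
        Poly_Mapping.single (k, n + 2) (f_coeff_s q s (Suc k) n * e_coeff q a (Suc k) (n + 2)) +
        Poly_Mapping.single (k - 1, n + 4) (f_coeff_t q t (Suc k) * e_coeff q a k (n + 4)) -
        (Poly_Mapping.single (m, n) (e_coeff q a (Suc k) n * f_coeff_xy q a k n) +
        Poly_Mapping.single (k, n + 2) (e_coeff q a (Suc k) n * f_coeff_s q s k n) +
        Poly_Mapping.single (k - 1, n + 4) (e_coeff q a (Suc k) n * f_coeff_t q t k))"
      by (simp add: Suc fam_single fam_linear scalar_mult_single distrib_left)
    also have "\<dots> = Poly_Mapping.single (m, n) (f_coeff_xy q a (Suc k) n * e_coeff q a (Suc (Suc k)) n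
        - e_coeff q a (Suc k) n * f_coeff_xy q a k n)"
      unfolding ef_s ef_t by (simp add: single_diff)
    also have "\<dots> = ?g (qmono m n)"
      unfolding ef_diagonal_Suc by (simp add: Suc fam_single scalar_mult_single flip: single_diff)
    finally show ?thesis .
  qed
qed

lemma fam_k_inverse:
  "fam q (a, s, t) Gki (fam q (a, s, t) Gk b) = b" "fam q (a, s, t) Gk (fam q (a, s, t) Gki b) = b"
  by (rule clinear_qmono_eqI[of _ "\<lambda>b. b"],
      use q(1) in \<open>simp_all add: clinear_comp[OF clinear_fam clinear_fam] clinear_id fam_single
        fam_linear scalar_mult_single\<close>)+

lemma fam_ke:
  "fam q (a, s, t) Gk (fam q (a, s, t) Ge b) = scalar (q\<^sup>2) * fam q (a, s, t) Ge (fam q (a, s, t) Gk b)"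
  (is "?f b = ?g b")
proof (rule clinear_qmono_eqI[of ?f ?g])
  show "clinear ?f" "clinear ?g"
    by (intro clinear_times clinear_comp[OF clinear_fam clinear_fam])+
  show "?f (qmono m n) = ?g (qmono m n)" for m n
    by (cases m) (simp_all add: fam_single fam_linear scalar_mult_single e_coeff_0,
        use q(1) in \<open>auto intro!: add_single_eqI simp: power_mult_distrib field_simps\<close>)
qed

lemma fam_kf:
  "fam q (a, s, t) Gk (fam q (a, s, t) Gf b) = scalar (inverse (q\<^sup>2)) * fam q (a, s, t) Gf (fam q (a, s, t) Gk b)"
  (is "?f b = ?g b")
proof (rule clinear_qmono_eqI[of ?f ?g])
  show "clinear ?f" "clinear ?g"
    by (intro clinear_times clinear_comp[OF clinear_fam clinear_fam])+
  show "?f (qmono m n) = ?g (qmono m n)" for m n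
    by (cases m) (simp_all add: fam_single fam_linear scalar_mult_single f_coeff_t_0 distrib_left,
        use q(1) in \<open>auto intro!: arg_cong2[of _ _ _ _ "(+)"] add_single_eqI
          simp: power_mult_distrib power_add field_simps power2_eq_square power4_eq_xxxx\<close>)
qed

lemma uq_action_fam: "uq_action q (fam q (a, s, t))"
  unfolding uq_action_iff
  by (simp add: clinear_fam fam_k_inverse fam_ke fam_kf fam_ef fam_gk_mult fam_gki_mult
      fam_ge_leibniz fam_gf_leibniz fam_one add.commute)

end

section \<open>Classification by weights\<close>

lemma uq_actionD:
  assumes "uq_action q T"
  shows "clinear (T g)"
    "T Gki (T Gk a) = a" "T Gk (T Gki a) = a"
    "T Gk (T Ge a) = scalar (q\<^sup>2) * T Ge (T Gk a)"
    "T Gk (T Gf a) = scalar (inverse (q\<^sup>2)) * T Gf (T Gk a)"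
    "T Ge (T Gf a) - T Gf (T Ge a) = scalar (1 / (q - inverse q)) * (T Gk a - T Gki a)"
    "T Gk (qmul q a b) = qmul q (T Gk a) (T Gk b)"
    "T Gki (qmul q a b) = qmul q (T Gki a) (T Gki b)"
    "T Ge (qmul q a b) = qmul q a (T Ge b) + qmul q (T Ge a) (T Gk b)"
    "T Gf (qmul q a b) = qmul q (T Gf a) b + qmul q (T Gki a) (T Gf b)"
    "T Gk 1 = 1" "T Gki 1 = 1" "T Ge 1 = 0" "T Gf 1 = 0"
  using assms unfolding uq_action_iff by simp_all

text \<open>Values on \<open>x\<close> and \<open>y\<close> propagate to all monomials by the product rules. The operator of \<open>k\<inverse>\<close>, which
  enters the rule for \<open>f\<close>, is determined as the inverse of that of \<open>k\<close>.\<close>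

lemma uq_action_eqI:
  assumes T: "uq_action q T" and T': "uq_action q T'"
    and gens: "\<And>g. g \<noteq> Gki \<Longrightarrow> T g (qmono 1 0) = T' g (qmono 1 0)"
      "\<And>g. g \<noteq> Gki \<Longrightarrow> T g (qmono 0 1) = T' g (qmono 0 1)"
  shows "T = T'"
proof -
  note D = uq_actionD[OF T] and D' = uq_actionD[OF T']
  have k: "T Gk a = T' Gk a" for a
    by (rule qpoly_generated[of "T Gk" "T' Gk" q, OF D(1) D'(1)]) (simp_all only: D D' gens uq_gen.distinct not_False_eq_True)
  have ki: "T Gki a = T' Gki a" for a
    using D(2)[of "T' Gki a"] k[of "T' Gki a"] D'(3)[of a] by simp
  have e: "T Ge a = T' Ge a" for a
    by (rule qpoly_generated[of "T Ge" "T' Ge" q, OF D(1) D'(1)])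
      (simp_all only: D(9,13) D'(9,13) k gens uq_gen.distinct not_False_eq_True)
  have f: "T Gf a = T' Gf a" for a
    by (rule qpoly_generated[of "T Gf" "T' Gf" q, OF D(1) D'(1)])
      (simp_all only: D(10,14) D'(10,14) ki gens uq_gen.distinct not_False_eq_True)
  have "T g a = T' g a" for g a
    by (cases g) (simp_all only: k ki e f)
  then show ?thesis by (intro ext)
qed

lemma qaut_k:
  assumes "uq_action q T"
  shows "qaut q (T Gk)"
proof -
  note D = uq_actionD[OF assms]
  have "bij (T Gk)"
    by (rule bijI') (metis D(2), metis D(3))
  then show ?thesis by (simp add: qaut_def D)
qed

lemma lookup_diagonal:
  assumes "clinear \<psi>"
    and "\<And>m n c. \<psi> (Poly_Mapping.single (m, n) c) = Poly_Mapping.single (m, n) (c * w m n)"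
  shows "coeff (\<psi> a) m n = w m n * coeff a m n"
proof (induction a rule: poly_mapping_additive_induct)
  case (single i c)
  then show ?case by (cases i) (simp add: assms(2) lookup_single when_def)
next
  case (add a b)
  then show ?case by (simp add: clinear_add[OF assms(1)] lookup_add distrib_left)
qed

lemma coeff_mult_x_0: "coeff (qmul q a (qmono 1 0)) 0 n = 0"
  and coeff_x_mult_0: "coeff (qmul q (qmono 1 0) a) 0 n = 0"
  by (induction a rule: poly_mapping_additive_induct)
    (auto simp: qmul_linear lookup_add qmul_single lookup_single when_def)

text \<open>Comparing coefficients in the relations, applied to \<open>x\<close>, \<open>y\<close> and \<open>yx = q xy\<close>, determines the weights
  of \<open>x\<close> and \<open>y\<close> and then everything except the three parameters.\<close>

theorem classification:
  assumes q: "q \<noteq> 0" "\<forall>n::nat. n > 0 \<longrightarrow> q ^ n \<noteq> 1" and T: "uq_action q T"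
    and ex: "coeff (T Ge (qmono 1 0)) 0 0 \<noteq> 0" and ey: "coeff (T Ge (qmono 0 1)) 0 0 = 0"
  shows "\<exists>a s t. a \<noteq> 0 \<and> T = fam q (a, s, t)"
proof -
  note D = uq_actionD[OF T]
  note inj = power_inj_of_not_root_of_unity[OF q]
  obtain \<alpha> \<beta> where ab: "\<alpha> \<noteq> 0" "\<beta> \<noteq> 0"
    and kx: "T Gk (qmono 1 0) = Poly_Mapping.single (1, 0) \<alpha>"
    and ky: "T Gk (qmono 0 1) = Poly_Mapping.single (0, 1) \<beta>"
    using automorphism_diagonal[OF q qaut_k[OF T]] by blast
  note k = diagonal_on_monomials[OF D(1) D(7) D(11) kx ky]
  have weight: "coeff (T Gk a) m n = \<alpha> ^ m * \<beta> ^ n * coeff a m n" for a m n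
    by (rule lookup_diagonal[OF D(1)]) (simp add: k mult.assoc)
  let ?a = "coeff (T Ge (qmono 1 0)) 0 0"
  have ex_weight: "\<alpha> ^ m * \<beta> ^ n * coeff (T Ge (qmono 1 0)) m n = q\<^sup>2 * \<alpha> * coeff (T Ge (qmono 1 0)) m n" for m n
    using D(4)[of "qmono 1 0"] weight[of "T Ge (qmono 1 0)" m n]
      clinear_single[OF D(1), of Ge "(1, 0)" \<alpha>]
    by (auto simp: kx[simplified] lookup_scalar_mult mult.assoc)
  \<comment> \<open>The constant term of \<open>e(x)\<close> has weight \<open>1\<close>, so \<open>q\<^sup>2 \<alpha> = 1\<close>.\<close>
  have \<alpha>: "\<alpha> = 1 / q\<^sup>2"
    using ex_weight[of 0 0] ex q(1) by (simp add: field_simps)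
  have "T Ge (qmul q (qmono 0 1) (qmono 1 0)) = scalar q * T Ge (qmul q (qmono 1 0) (qmono 0 1))"
    using clinear_single[OF D(1), of Ge "(1, 1)" q] by (simp add: qmul_single)
  then have "qmul q (qmono 0 1) (T Ge (qmono 1 0)) + scalar \<alpha> * qmul q (T Ge (qmono 0 1)) (qmono 1 0) =
      scalar q * (qmul q (qmono 1 0) (T Ge (qmono 0 1)) + scalar \<beta> * qmul q (T Ge (qmono 1 0)) (qmono 0 1))"
    unfolding D(9) kx ky qmul_linear(4)[symmetric] by (simp add: scalar_mult_single)
  \<comment> \<open>At \<open>y\<close> only the constant term of \<open>e(x)\<close> contributes, as that of \<open>e(y)\<close> is zero.\<close>
  from arg_cong[OF this, of "\<lambda>p. coeff p 0 1"]
  have "?a = q * (\<beta> * ?a)"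
    using coeff_y_mult[of q "T Ge (qmono 1 0)" 0 0] coeff_mult_y[of q "T Ge (qmono 1 0)" 0 0]
      coeff_mult_x_0[of q "T Ge (qmono 0 1)" 1] coeff_x_mult_0[of q "T Ge (qmono 0 1)" 1]
    by (simp add: lookup_add lookup_scalar_mult)
  then have \<beta>: "\<beta> = 1 / q"
    using ex q(1) by (simp add: field_simps)
  have w: "\<alpha> ^ m * \<beta> ^ n = 1 / q ^ (2 * m + n)" for m n
    using q(1) by (simp add: \<alpha> \<beta> power_add power_mult power_one_over)
  note weight_q = weight[unfolded w]
  have nonroot: "q ^ n \<noteq> 1" if "n > 0" for n
    using q(2) that by blast
  have e_x0: "T Ge (qmono 1 0) = Poly_Mapping.single (0, 0) ?a"
  proof (rule poly_mapping_eqI)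
    fix i :: "nat \<times> nat"
    obtain m n where i: "i = (m, n)" by (cases i)
    have "coeff (T Ge (qmono 1 0)) m n = 0" if "2 * m + n > 0"
    proof -
      have "1 / q ^ (2 * m + n) * coeff (T Ge (qmono 1 0)) m n = coeff (T Ge (qmono 1 0)) m n"
        using ex_weight[of m n, unfolded w] q(1) by (simp add: \<alpha>)
      then show ?thesis using nonroot[OF that] q(1) by (auto simp: field_simps)
    qed
    then show "Poly_Mapping.lookup (T Ge (qmono 1 0)) i = Poly_Mapping.lookup (Poly_Mapping.single (0, 0) ?a) i"
      by (cases m; cases n) (auto simp: i lookup_single when_def)
  qed
  define a0 where "a0 = ?a"
  have a0: "a0 \<noteq> 0" using ex by (simp add: a0_def)
  have e_x: "T Ge (qmono 1 0) = Poly_Mapping.single (0, 0) a0"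
    using e_x0 unfolding a0_def .
  \<comment> \<open>The weight of \<open>e(y)\<close> is \<open>q\<close>, which no monomial has.\<close>
  have e_y: "T Ge (qmono 0 1) = 0"
  proof (rule poly_mapping_eqI)
    fix i :: "nat \<times> nat"
    obtain m n where i: "i = (m, n)" by (cases i)
    have "1 / q ^ (2 * m + n) * coeff (T Ge (qmono 0 1)) m n = q * coeff (T Ge (qmono 0 1)) m n"
      using D(4)[of "qmono 0 1"] weight_q[of "T Ge (qmono 0 1)" m n]
        clinear_single[OF D(1), of Ge "(0, 1)" \<beta>] q(1)
      by (simp add: ky[simplified] lookup_scalar_mult \<beta> power2_eq_square)
    then have "coeff (T Ge (qmono 0 1)) m n = 0"
      using nonroot[of "2 * m + n + 1"] q(1) by (auto simp: field_simps)
    then show "Poly_Mapping.lookup (T Ge (qmono 0 1)) i = Poly_Mapping.lookup 0 i"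
      by (simp add: i)
  qed
  have f_weight_x: "coeff (T Gf (qmono 1 0)) m n = 0" if "2 * m + n \<noteq> 4" for m n
  proof -
    have "1 / q ^ (2 * m + n) * coeff (T Gf (qmono 1 0)) m n = 1 / q ^ 4 * coeff (T Gf (qmono 1 0)) m n"
      using D(5)[of "qmono 1 0"] weight_q[of "T Gf (qmono 1 0)" m n]
        clinear_single[OF D(1), of Gf "(1, 0)" \<alpha>] q(1)
      by (auto simp: kx[simplified] lookup_scalar_mult \<alpha> power2_eq_square power4_eq_xxxx
          inverse_eq_divide mult.assoc)
    then show ?thesis
      using inj[of "2 * m + n" 4] that q(1) by (auto simp: field_simps)
  qed
  have f_weight_y: "coeff (T Gf (qmono 0 1)) m n = 0" if "2 * m + n \<noteq> 3" for m n
  proof -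
    have "1 / q ^ (2 * m + n) * coeff (T Gf (qmono 0 1)) m n = 1 / q ^ 3 * coeff (T Gf (qmono 0 1)) m n"
      using D(5)[of "qmono 0 1"] weight_q[of "T Gf (qmono 0 1)" m n]
        clinear_single[OF D(1), of Gf "(0, 1)" \<beta>] q(1)
      by (auto simp: ky[simplified] lookup_scalar_mult \<beta> power2_eq_square power3_eq_cube
          inverse_eq_divide mult.assoc)
    then show ?thesis
      using inj[of "2 * m + n" 3] that q(1) by (auto simp: field_simps)
  qed
  define b c t where "b = coeff (T Gf (qmono 1 0)) 2 0" and "c = coeff (T Gf (qmono 1 0)) 1 2"
    and "t = coeff (T Gf (qmono 1 0)) 0 4"
  define d s where "d = coeff (T Gf (qmono 0 1)) 1 1" and "s = coeff (T Gf (qmono 0 1)) 0 3"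
  have f_x: "T Gf (qmono 1 0) =
      Poly_Mapping.single (2, 0) b + Poly_Mapping.single (1, 2) c + Poly_Mapping.single (0, 4) t"
  proof (rule poly_mapping_eqI)
    fix i :: "nat \<times> nat"
    obtain m n where i: "i = (m, n)" by (cases i)
    have "m = 2 \<and> n = 0 \<or> m = 1 \<and> n = 2 \<or> m = 0 \<and> n = 4 \<or> 2 * m + n \<noteq> 4" by presburger
    then consider "m = 2" "n = 0" | "m = 1" "n = 2" | "m = 0" "n = 4" | "2 * m + n \<noteq> 4" by blast
    then show "Poly_Mapping.lookup (T Gf (qmono 1 0)) i = Poly_Mapping.lookup
        (Poly_Mapping.single (2, 0) b + Poly_Mapping.single (1, 2) c + Poly_Mapping.single (0, 4) t) i"
      by cases (auto simp: i lookup_add lookup_single when_def b_def c_def t_def f_weight_x[simplified])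
  qed
  have f_y: "T Gf (qmono 0 1) = Poly_Mapping.single (1, 1) d + Poly_Mapping.single (0, 3) s"
  proof (rule poly_mapping_eqI)
    fix i :: "nat \<times> nat"
    obtain m n where i: "i = (m, n)" by (cases i)
    have "m = 1 \<and> n = 1 \<or> m = 0 \<and> n = 3 \<or> 2 * m + n \<noteq> 3" by presburger
    then consider "m = 1" "n = 1" | "m = 0" "n = 3" | "2 * m + n \<noteq> 3" by blast
    then show "Poly_Mapping.lookup (T Gf (qmono 0 1)) i = Poly_Mapping.lookup
        (Poly_Mapping.single (1, 1) d + Poly_Mapping.single (0, 3) s) i"
      by cases (auto simp: i lookup_add lookup_single when_def d_def s_def f_weight_y[simplified])
  qed
  have ki_x: "T Gki (qmono 1 0) = Poly_Mapping.single (1, 0) (q\<^sup>2)"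
    using D(2)[of "Poly_Mapping.single (1, 0) (q\<^sup>2)"] q(1) k[of 1 0 "q\<^sup>2"] by (simp add: \<alpha>)
  have ki_y: "T Gki (qmono 0 1) = Poly_Mapping.single (0, 1) q"
    using D(2)[of "Poly_Mapping.single (0, 1) q"] q(1) k[of 0 1 q] by (simp add: \<beta>)
  have "T Gf (qmul q (qmono 0 1) (qmono 1 0)) = scalar q * T Gf (qmul q (qmono 1 0) (qmono 0 1))"
    using clinear_single[OF D(1), of Gf "(1, 1)" q] by (simp add: qmul_single)
  then have rel: "qmul q (T Gf (qmono 0 1)) (qmono 1 0) + qmul q (Poly_Mapping.single (0, 1) q) (T Gf (qmono 1 0)) =
      scalar q * (qmul q (T Gf (qmono 1 0)) (qmono 0 1)
        + qmul q (Poly_Mapping.single (1, 0) (q\<^sup>2)) (T Gf (qmono 0 1)))"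
    unfolding D(10) ki_x ki_y .
  have q1: "q \<noteq> 1" "q\<^sup>2 \<noteq> 1" using nonroot[of 1] nonroot[of 2] by simp_all
  have "d * q + q * (b * q\<^sup>2) = q * (b + q\<^sup>2 * d)"
    using arg_cong[OF rel[unfolded f_x f_y], of "\<lambda>p. coeff p 2 1"]
    by (simp add: qmul_linear qmul_single lookup_add lookup_scalar_mult lookup_single when_def mult.assoc)
  then have "(b - d) * (q * (q\<^sup>2 - 1)) = 0" by (simp add: algebra_simps)
  then have db: "d = b" using q(1) q1 by simp
  have "s * q ^ 3 + q * (c * q) = q * (c + q\<^sup>2 * s)"
    using arg_cong[OF rel[unfolded f_x f_y], of "\<lambda>p. coeff p 1 3"]
    by (simp add: qmul_linear qmul_single lookup_add lookup_scalar_mult lookup_single when_def mult.assoc)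
  then have "c * (q * (q - 1)) = 0" by (simp add: algebra_simps power2_eq_square power3_eq_cube)
  then have c: "c = 0" using q(1) q1 by simp
  have e_yn: "T Ge (qmono 0 n) = 0" for n
  proof (induction n)
    case 0
    show ?case using D(13) by (simp add: qpoly_one)
  next
    case (Suc n)
    have "T Ge (qmono 0 (Suc n)) = T Ge (qmul q (qmono 0 1) (qmono 0 n))"
      by (simp add: qmul_single)
    then show ?case unfolding D(9) e_y Suc by (simp add: qmul_linear)
  qed
  have "T Ge (qmono 2 0) = T Ge (qmul q (qmono 1 0) (qmono 1 0))"
    by (simp add: qmul_single numeral_2_eq_2)
  then have e_xx: "T Ge (qmono 2 0) = Poly_Mapping.single (1, 0) (a0 * (1 + \<alpha>))"
    unfolding D(9) e_x kx by (simp add: qmul_single distrib_left flip: single_add)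
  have "T Ge (T Gf (qmono 1 0)) = Poly_Mapping.single (1, 0) (b * (a0 * (1 + \<alpha>)))"
    unfolding f_x c using clinear_single[OF D(1), of Ge "(2, 0)" b] clinear_single[OF D(1), of Ge "(0, 4)" t]
    by (simp add: clinear_add[OF D(1)] e_xx e_yn scalar_mult_single)
  moreover have "T Gf (T Ge (qmono 1 0)) = 0"
    using clinear_single[OF D(1), of Gf "(0, 0)" a0] D(14) unfolding e_x qpoly_one by simp
  ultimately have "(Poly_Mapping.single (1, 0) (b * (a0 * (1 + \<alpha>))) :: qpoly) =
      scalar (1 / (q - inverse q)) * (Poly_Mapping.single (1, 0) \<alpha> - Poly_Mapping.single (1, 0) (q\<^sup>2))"
    using D(6)[of "qmono 1 0"] unfolding kx ki_x by simp
  from arg_cong[OF this, of "\<lambda>p. coeff p 1 0"]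
  have eq: "b * (a0 * (1 + \<alpha>)) = 1 / (q - inverse q) * (\<alpha> - q\<^sup>2)"
    by (simp add: lookup_scalar_mult lookup_minus)
  \<comment> \<open>\<open>1 + q\<^sup>-\<^sup>2 = 0\<close> would make \<open>q\<close> a fourth root of unity.\<close>
  have "1 + \<alpha> \<noteq> 0"
  proof
    assume "1 + \<alpha> = 0"
    then have "q\<^sup>2 = - 1" using q(1) by (simp add: \<alpha> field_simps eq_neg_iff_add_eq_0)
    then have "q ^ 4 = 1" by (simp add: power4_eq_xxxx power2_eq_square)
    then show False using nonroot[of 4] by simp
  qed
  moreover have "1 / (q - inverse q) * (\<alpha> - q\<^sup>2) = - q * (1 + \<alpha>)"
    unfolding inverse_difference[OF q] using q(1) q1
    by (simp add: \<alpha> divide_simps) (simp add: algebra_simps power2_eq_square power4_eq_xxxx)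
  ultimately have "b * a0 = - q" using eq by (metis mult.assoc mult_right_cancel)
  then have b: "b = - q / a0" using a0 by (simp add: field_simps)
  have kx': "T Gk (qmono 1 0) = Poly_Mapping.single (1, 0) (inverse (q\<^sup>2))"
    and ky': "T Gk (qmono 0 1) = Poly_Mapping.single (0, 1) (inverse q)"
    unfolding kx ky \<alpha> \<beta> by (simp_all add: inverse_eq_divide)
  have f_x': "T Gf (qmono 1 0) = Poly_Mapping.single (2, 0) (- q / a0) + Poly_Mapping.single (0, 4) t"
    and f_y': "T Gf (qmono 0 1) = Poly_Mapping.single (1, 1) (- q / a0) + Poly_Mapping.single (0, 3) s"
    unfolding f_x f_y c db b by simp_all
  have "T = fam q (a0, s, t)"
  proof (rule uq_action_eqI[OF T uq_action_fam[OF q a0]])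
    fix g assume g: "g \<noteq> Gki"
    show "T g (qmono 1 0) = fam q (a0, s, t) g (qmono 1 0)"
      using g by (cases g) (simp_all only: fam_values[OF q a0] kx' e_x f_x' simp_thms)
    show "T g (qmono 0 1) = fam q (a0, s, t) g (qmono 0 1)"
      using g by (cases g) (simp_all only: fam_values[OF q a0] ky' e_y f_y' simp_thms)
  qed
  then show ?thesis using a0 by blast
qed

section \<open>The three-parameter family of structures\<close>

lemma represents_gen:
  assumes "represents q T \<pi>"
  shows "\<pi> (uq_class q (word [g])) (emb q a) = emb q (T g a)"
  using representsD[OF assms, of "word [g]" a] by (simp add: act_single)

lemma represents_unique:
  assumes "represents q T \<pi>" "represents q T' \<pi>"
  shows "T = T'"
proof (intro ext)
  fix g a
  show "T g a = T' g a"
    using represents_gen[OF assms(1), of g a] represents_gen[OF assms(2), of g a]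
    by (simp add: emb_eq_iff)
qed

lemma has_values_iff:
  assumes "represents q T \<pi>"
  shows "has_values q (a, s, t) \<pi> \<longleftrightarrow>
    T Gk (qmono 1 0) = Poly_Mapping.single (1, 0) (inverse (q\<^sup>2)) \<and>
    T Gk (qmono 0 1) = Poly_Mapping.single (0, 1) (inverse q) \<and>
    T Ge (qmono 1 0) = Poly_Mapping.single (0, 0) a \<and>
    T Ge (qmono 0 1) = 0 \<and>
    T Gf (qmono 1 0) = Poly_Mapping.single (2, 0) (- q / a) + Poly_Mapping.single (0, 4) t \<and>
    T Gf (qmono 0 1) = Poly_Mapping.single (1, 1) (- q / a) + Poly_Mapping.single (0, 3) s"
  unfolding has_values_def prod.case uq_k_def uq_e_def uq_f_def emb_x emb_y emb_monomial emb_one emb_zero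
    represents_gen[OF assms] emb_smult emb_add emb_eq_iff qpoly_one scalar_mult_single
  by (simp add: divide_inverse)

context
  fixes q :: complex
  assumes q: "q \<noteq> 0" "\<forall>n::nat. n > 0 \<longrightarrow> q ^ n \<noteq> 1"
begin

lemma has_values_imp_fam:
  assumes "a \<noteq> 0" "uq_action q T" "represents q T \<pi>" "has_values q (a, s, t) \<pi>"
  shows "T = fam q (a, s, t)"
proof (rule uq_action_eqI[OF assms(2) uq_action_fam[OF q assms(1)]])
  note v = assms(4)[unfolded has_values_iff[OF assms(3)]]
  fix g assume g: "g \<noteq> Gki"
  show "T g (qmono 1 0) = fam q (a, s, t) g (qmono 1 0)"
    using g by (cases g) (simp_all only: fam_values[OF q assms(1)] v simp_thms)
  show "T g (qmono 0 1) = fam q (a, s, t) g (qmono 0 1)"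
    using g by (cases g) (simp_all only: fam_values[OF q assms(1)] v simp_thms)
qed

lemma fam_has_values:
  assumes "a \<noteq> 0" "represents q (fam q (a, s, t)) \<pi>"
  shows "has_values q (a, s, t) \<pi>"
  unfolding has_values_iff[OF assms(2)] fam_values[OF q assms(1)] by simp

lemma unique_structure:
  assumes "p \<in> params"
  shows "\<exists>!\<pi>. \<pi> \<in> qp_structures q \<and> has_values q p \<pi>"
proof -
  obtain a s t where p: "p = (a, s, t)" and a: "a \<noteq> 0"
    using assms by (auto simp: params_def)
  obtain \<pi> where \<pi>: "\<pi> \<in> qp_structures q" "represents q (fam q p) \<pi>"
    using structure_of_action[OF uq_action_fam[OF q a]] p by blast
  show ?thesis
  proof (rule ex1I[of _ \<pi>])
    show "\<pi> \<in> qp_structures q \<and> has_values q p \<pi>"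
      using \<pi> fam_has_values[OF a] p by simp
  next
    fix \<pi>' assume \<pi>': "\<pi>' \<in> qp_structures q \<and> has_values q p \<pi>'"
    then obtain T where T: "uq_action q T" "represents q T \<pi>'"
      using action_of_structure by blast
    then have "T = fam q p"
      using has_values_imp_fam[OF a] \<pi>' p by blast
    then show "\<pi>' = \<pi>"
      using structure_eqI \<pi> \<pi>' T by blast
  qed
qed

lemma family_props:
  assumes "p \<in> params"
  shows "family q p \<in> qp_structures q" "has_values q p (family q p)" "represents q (fam q p) (family q p)"
proof -
  show 1: "family q p \<in> qp_structures q" "has_values q p (family q p)"
    using theI'[OF unique_structure[OF assms]] by (simp_all add: family_def)
  obtain a s t where p: "p = (a, s, t)" and a: "a \<noteq> 0"
    using assms by (auto simp: params_def)
  obtain T where T: "uq_action q T" "represents q T (family q p)"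
    using action_of_structure[OF 1(1)] by blast
  then show "represents q (fam q p) (family q p)"
    using has_values_imp_fam[OF a] 1 p by blast
qed

lemma family_inj: "inj_on (family q) params"
proof (rule inj_onI)
  fix p p' assume pp: "p \<in> params" "p' \<in> params" "family q p = family q p'"
  obtain a s t where p: "p = (a, s, t)" and a: "a \<noteq> 0"
    using pp(1) by (auto simp: params_def)
  obtain a' s' t' where p': "p' = (a', s', t')" and a': "a' \<noteq> 0"
    using pp(2) by (auto simp: params_def)
  have "represents q (fam q p) (family q p)"
    using pp(1) by (rule family_props)
  moreover have "represents q (fam q p') (family q p)"
    unfolding pp(3) using pp(2) by (rule family_props)
  ultimately have eq: "fam q p = fam q p'"
    by (rule represents_unique)
  have "a = a'" "t = t'" "s = s'"
    using arg_cong[OF eq, of "\<lambda>T. coeff (T Ge (qmono 1 0)) 0 0"]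
      arg_cong[OF eq, of "\<lambda>T. coeff (T Gf (qmono 1 0)) 0 4"]
      arg_cong[OF eq, of "\<lambda>T. coeff (T Gf (qmono 0 1)) 0 3"]
    unfolding p p' fam_values[OF q a] fam_values[OF q a']
    by (simp_all add: lookup_add lookup_single when_def)
  then show "p = p'" by (simp add: p p')
qed

lemma struct_S_eq: "struct_S q = family q ` params"
proof (intro equalityI subsetI)
  fix \<pi> assume \<pi>: "\<pi> \<in> struct_S q"
  then have st: "\<pi> \<in> qp_structures q" by (simp add: struct_S_def)
  obtain T where T: "uq_action q T" "represents q T \<pi>"
    using action_of_structure[OF st] by blast
  have "coeff (T Ge (qmono 1 0)) 0 0 \<noteq> 0" "coeff (T Ge (qmono 0 1)) 0 0 = 0"
    using \<pi> unfolding struct_S_def uq_e_def emb_x emb_y represents_gen[OF T(2)] hpart_eq_zero_iff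
      mem_Collect_eq by auto
  then obtain a s t where a: "a \<noteq> 0" and fam: "T = fam q (a, s, t)"
    using classification[OF q T(1)] by blast
  then have p: "(a, s, t) \<in> params" by (simp add: params_def)
  then have "\<pi> = family q (a, s, t)"
    using structure_eqI[OF st family_props(1)[OF p]] T(2) family_props(3)[OF p] fam by blast
  with p show "\<pi> \<in> family q ` params" by blast
next
  fix \<pi> assume "\<pi> \<in> family q ` params"
  then obtain a s t where a: "a \<noteq> 0" and \<pi>: "\<pi> = family q (a, s, t)" and p: "(a, s, t) \<in> params"
    by (auto simp: params_def)
  have rep: "represents q (fam q (a, s, t)) \<pi>" and st: "\<pi> \<in> qp_structures q"
    using family_props[OF p] by (simp_all add: \<pi>)
  show "\<pi> \<in> struct_S q"
    unfolding struct_S_def uq_e_def uq_f_def emb_x emb_y represents_gen[OF rep] hpart_eq_zero_iff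
      mem_Collect_eq fam_values[OF q a]
    using st a by (auto simp: lookup_add lookup_single when_def)
qed

end

section \<open>Isomorphisms as scalings of the generators\<close>

definition intertwines :: "(qpoly \<Rightarrow> qpoly) \<Rightarrow> (uq_gen \<Rightarrow> qpoly \<Rightarrow> qpoly) \<Rightarrow> (uq_gen \<Rightarrow> qpoly \<Rightarrow> qpoly) \<Rightarrow> bool" where
  "intertwines \<psi> T T' \<longleftrightarrow> (\<forall>g a. \<psi> (T g a) = T' g (\<psi> a))"

lemma intertwines_act:
  assumes "clinear \<psi>" "intertwines \<psi> T T'"
  shows "\<psi> (act T p a) = act T' p (\<psi> a)"
proof -
  have "\<psi> (foldr T w a) = foldr T' w (\<psi> a)" for w
    using assms(2) by (induction w) (simp_all add: intertwines_def)
  then show ?thesis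
    by (simp add: act_def clinear_lin_ext_commute[OF assms(1)])
qed

lemma alg_aut_of_qaut:
  assumes "qaut q \<psi>"
  defines "\<Psi> \<equiv> \<lambda>X. emb q (\<psi> (coord q X))"
  shows "\<Psi> \<in> alg_aut (qplane q)"
proof -
  have \<psi>: "clinear \<psi>" "\<And>a b. \<psi> (qmul q a b) = qmul q (\<psi> a) (\<psi> b)" "\<psi> 1 = 1" and bij: "bij \<psi>"
    using assms(1) by (auto simp: qaut_def)
  have \<Psi>: "\<Psi> (emb q a) = emb q (\<psi> a)" for a by (simp add: \<Psi>_def)
  have "\<Psi> \<in> ring_hom (qplane q) (qplane q)"
    by (rule ring_hom_memI)
      (auto simp: qplane_carrier emb_ops \<Psi> \<psi>(2,3) clinear_add[OF \<psi>(1)])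
  moreover have "\<forall>c. \<forall>x\<in>carrier (qplane q). \<Psi> (c \<odot>\<^bsub>qplane q\<^esub> x) = c \<odot>\<^bsub>qplane q\<^esub> \<Psi> x"
    by (auto simp: qplane_carrier emb_ops \<Psi> clinear_scalar[OF \<psi>(1)])
  moreover have "bij_betw \<Psi> (carrier (qplane q)) (carrier (qplane q))"
  proof (rule bij_betw_imageI)
    show "inj_on \<Psi> (carrier (qplane q))"
      using bij by (auto simp: inj_on_def qplane_carrier \<Psi> emb_eq_iff bij_def dest: injD)
    have "range \<psi> = UNIV" using bij by (simp add: bij_def)
    then have "range (\<lambda>a. emb q (\<psi> a)) = range (emb q)"
      by (metis image_image)
    then show "\<Psi> ` carrier (qplane q) = carrier (qplane q)"
      by (simp add: qplane_carrier image_image \<Psi>)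
  qed
  ultimately show ?thesis by (simp add: alg_aut_def alg_hom_def)
qed

lemma qaut_of_alg_aut:
  assumes "\<Psi> \<in> alg_aut (qplane q)"
  obtains \<psi> where "qaut q \<psi>" "\<And>a. \<Psi> (emb q a) = emb q (\<psi> a)"
proof -
  define \<psi> where "\<psi> a = coord q (\<Psi> (emb q a))" for a
  have hom: "\<Psi> \<in> ring_hom (qplane q) (qplane q)"
    and sm: "\<And>c x. x \<in> carrier (qplane q) \<Longrightarrow> \<Psi> (c \<odot>\<^bsub>qplane q\<^esub> x) = c \<odot>\<^bsub>qplane q\<^esub> \<Psi> x"
    and bij: "bij_betw \<Psi> (carrier (qplane q)) (carrier (qplane q))"
    using assms by (auto simp: alg_aut_def alg_hom_def)
  have \<Psi>: "\<Psi> (emb q a) = emb q (\<psi> a)" for a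
    unfolding \<psi>_def by (rule emb_coord[symmetric]) (rule ring_hom_closed[OF hom emb_carrier])
  have "emb q (\<psi> (a + b)) = emb q (\<psi> a + \<psi> b)" for a b
    using ring_hom_add[OF hom emb_carrier emb_carrier, of a b] by (simp add: emb_ops \<Psi>)
  moreover have "emb q (\<psi> (qmul q a b)) = emb q (qmul q (\<psi> a) (\<psi> b))" for a b
    using ring_hom_mult[OF hom emb_carrier emb_carrier, of a b] by (simp add: emb_ops \<Psi>)
  moreover have "emb q (\<psi> 1) = emb q 1"
    using ring_hom_one[OF hom] by (simp add: emb_ops \<Psi>)
  moreover have "emb q (\<psi> (scalar c * a)) = emb q (scalar c * \<psi> a)" for c a
    using sm[OF emb_carrier, of c a] by (simp add: emb_ops \<Psi>)
  moreover have "bij \<psi>"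
  proof (rule bijI')
    fix a b
    show "\<psi> a = \<psi> b \<longleftrightarrow> a = b"
    proof
      assume "\<psi> a = \<psi> b"
      then have "\<Psi> (emb q a) = \<Psi> (emb q b)" by (simp add: \<Psi>)
      then have "emb q a = emb q b"
        using bij by (auto simp: bij_betw_def dest: inj_onD)
      then show "a = b" by (simp add: emb_eq_iff)
    qed simp
  next
    fix b
    have "emb q b \<in> \<Psi> ` carrier (qplane q)"
      using bij by (simp add: bij_betw_def)
    then obtain a where "emb q b = \<Psi> (emb q a)"
      by (auto simp: qplane_carrier)
    then show "\<exists>a. b = \<psi> a" by (auto simp: \<Psi> emb_eq_iff)
  qed
  ultimately have "qaut q \<psi>"
    by (simp add: qaut_def clinear_def emb_eq_iff)
  with \<Psi> that show thesis by blast
qed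

text \<open>Intertwining the operators of the generators suffices, because the operators of all elements are
  linear combinations of compositions of these.\<close>

lemma isomorphic_iff_intertwines:
  assumes rep: "represents q T \<pi>" "represents q T' \<pi>'"
  shows "isomorphic_structures (uq_sl2 q) (qplane q) \<pi> \<pi>' \<longleftrightarrow> (\<exists>\<psi>. qaut q \<psi> \<and> intertwines \<psi> T T')"
proof
  assume "isomorphic_structures (uq_sl2 q) (qplane q) \<pi> \<pi>'"
  then obtain \<Psi> where \<Psi>: "\<Psi> \<in> alg_aut (qplane q)" and
    iso: "\<And>p a. \<Psi> (\<pi> (uq_class q p) (inv_into (carrier (qplane q)) \<Psi> (emb q a))) = \<pi>' (uq_class q p) (emb q a)"
    by (auto simp: isomorphic_structures_def uq_sl2_sel(1) qplane_carrier)
  obtain \<psi> where \<psi>: "qaut q \<psi>" "\<And>a. \<Psi> (emb q a) = emb q (\<psi> a)"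
    using qaut_of_alg_aut[OF \<Psi>] by blast
  have "\<psi> (T g a) = T' g (\<psi> a)" for g a
  proof -
    have "inj_on \<Psi> (carrier (qplane q))"
      using \<Psi> by (simp add: alg_aut_def bij_betw_def)
    then have "inv_into (carrier (qplane q)) \<Psi> (emb q (\<psi> a)) = emb q a"
      unfolding \<psi>(2)[symmetric] by (rule inv_into_f_f) simp
    with iso[of "word [g]" "\<psi> a"] show ?thesis
      by (simp add: represents_gen[OF rep(1)] represents_gen[OF rep(2)] \<psi>(2) emb_eq_iff)
  qed
  with \<psi>(1) show "\<exists>\<psi>. qaut q \<psi> \<and> intertwines \<psi> T T'"
    by (auto simp: intertwines_def)
next
  assume "\<exists>\<psi>. qaut q \<psi> \<and> intertwines \<psi> T T'"
  then obtain \<psi> where \<psi>: "qaut q \<psi>" "intertwines \<psi> T T'" by blast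
  define \<Psi> where "\<Psi> X = emb q (\<psi> (coord q X))" for X
  have aut: "\<Psi> \<in> alg_aut (qplane q)"
    unfolding \<Psi>_def[abs_def] using \<psi>(1) by (rule alg_aut_of_qaut)
  have lin: "clinear \<psi>" and bij: "bij \<psi>" using \<psi>(1) by (auto simp: qaut_def)
  have "\<Psi> (\<pi> (uq_class q p) (inv_into (carrier (qplane q)) \<Psi> (emb q a))) = \<pi>' (uq_class q p) (emb q a)" for p a
  proof -
    obtain b where b: "a = \<psi> b" using bij by (metis bij_pointE)
    have "inj_on \<Psi> (carrier (qplane q))"
      using aut by (simp add: alg_aut_def bij_betw_def)
    moreover have "\<Psi> (emb q b) = emb q a" by (simp add: \<Psi>_def b)
    ultimately have "inv_into (carrier (qplane q)) \<Psi> (emb q a) = emb q b"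
      by (metis emb_carrier inv_into_f_f)
    then show ?thesis
      by (simp add: representsD[OF rep(1)] representsD[OF rep(2)] \<Psi>_def b intertwines_act[OF lin \<psi>(2)])
  qed
  then have "\<forall>h\<in>carrier (uq_sl2 q). \<forall>X\<in>carrier (qplane q).
      \<Psi> (\<pi> h (inv_into (carrier (qplane q)) \<Psi> X)) = \<pi>' h X"
    by (auto simp: uq_sl2_sel(1) qplane_carrier)
  with aut show "isomorphic_structures (uq_sl2 q) (qplane q) \<pi> \<pi>'"
    unfolding isomorphic_structures_def by blast
qed

definition scaling :: "complex \<Rightarrow> complex \<Rightarrow> qpoly \<Rightarrow> qpoly" where
  "scaling \<alpha> \<beta> = lin_ext (Poly_Mapping.single 0) (\<lambda>(m, n). Poly_Mapping.single (m, n) (\<alpha> ^ m * \<beta> ^ n))"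

lemma clinear_scaling: "clinear (scaling \<alpha> \<beta>)"
  unfolding scaling_def by (rule clinear_lin_ext)

lemma scaling_single:
  "scaling \<alpha> \<beta> (Poly_Mapping.single (m, n) c) = Poly_Mapping.single (m, n) (c * (\<alpha> ^ m * \<beta> ^ n))"
  by (simp add: scaling_def scalar.lin_ext_single scalar_mult_single)

lemmas scaling_linear = clinear_add[OF clinear_scaling] clinear_scalar[OF clinear_scaling]

lemma scaling_inverse:
  assumes "\<alpha> \<noteq> 0" "\<beta> \<noteq> 0"
  shows "scaling \<alpha> \<beta> (scaling (1 / \<alpha>) (1 / \<beta>) a) = a"
  by (rule clinear_qmono_eqI[of "\<lambda>a. scaling \<alpha> \<beta> (scaling (1 / \<alpha>) (1 / \<beta>) a)" "\<lambda>a. a"])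
    (use assms in \<open>simp_all add: clinear_comp[OF clinear_scaling clinear_scaling] clinear_id scaling_single
      power_one_over\<close>)

lemma qaut_scaling:
  assumes "\<alpha> \<noteq> 0" "\<beta> \<noteq> 0"
  shows "qaut q (scaling \<alpha> \<beta>)"
proof -
  have "scaling \<alpha> \<beta> (qmul q a b) = qmul q (scaling \<alpha> \<beta> a) (scaling \<alpha> \<beta> b)" for a b
  proof (rule clinear2_eqI[of "\<lambda>a b. scaling \<alpha> \<beta> (qmul q a b)"
        "\<lambda>a b. qmul q (scaling \<alpha> \<beta> a) (scaling \<alpha> \<beta> b)"])
    fix i j :: "nat \<times> nat"
    show "scaling \<alpha> \<beta> (qmul q (Poly_Mapping.single i 1) (Poly_Mapping.single j 1)) =
        qmul q (scaling \<alpha> \<beta> (Poly_Mapping.single i 1)) (scaling \<alpha> \<beta> (Poly_Mapping.single j 1))"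
      by (cases i; cases j) (simp add: scaling_single qmul_single power_add mult_ac)
  qed (simp_all add: clinear_def qmul_linear scaling_linear)
  moreover have "scaling \<alpha> \<beta> 1 = 1"
    unfolding qpoly_one by (simp add: scaling_single)
  moreover have "bij (scaling \<alpha> \<beta>)"
    by (rule o_bij[of "scaling (1 / \<alpha>) (1 / \<beta>)"])
      (use scaling_inverse[of \<alpha> \<beta>] scaling_inverse[of "1 / \<alpha>" "1 / \<beta>"] assms in \<open>simp_all add: fun_eq_iff\<close>)
  ultimately show ?thesis by (simp add: qaut_def clinear_scaling)
qed

context
  fixes q :: complex
  assumes q: "q \<noteq> 0" "\<forall>n::nat. n > 0 \<longrightarrow> q ^ n \<noteq> 1"
begin

text \<open>The conditions on \<open>\<alpha>\<close> and \<open>\<beta>\<close> compare coefficients in \<open>\<psi>(e x) = e(\<psi> x)\<close>, \<open>\<psi>(f x) = f(\<psi> x)\<close> and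
  \<open>\<psi>(f y) = f(\<psi> y)\<close>. For the converse the coefficient formulas are homogeneous in the parameters, so
  the scaling intertwines the operators on every monomial.\<close>

lemma intertwiner_iff:
  assumes a: "a \<noteq> 0" and a': "a' \<noteq> 0"
  shows "(\<exists>\<psi>. qaut q \<psi> \<and> intertwines \<psi> (fam q (a, s, t)) (fam q (a', s', t'))) \<longleftrightarrow>
    (\<exists>\<alpha> \<beta>. \<alpha> \<noteq> 0 \<and> \<beta> \<noteq> 0 \<and> a = \<alpha> * a' \<and> s' = s * \<beta>\<^sup>2 \<and> \<alpha> * t' = t * \<beta> ^ 4)"
proof
  assume "\<exists>\<psi>. qaut q \<psi> \<and> intertwines \<psi> (fam q (a, s, t)) (fam q (a', s', t'))"
  then obtain \<psi> where \<psi>: "qaut q \<psi>" "intertwines \<psi> (fam q (a, s, t)) (fam q (a', s', t'))" by blast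
  have lin: "clinear \<psi>" and mult: "\<And>a b. \<psi> (qmul q a b) = qmul q (\<psi> a) (\<psi> b)" and one: "\<psi> 1 = 1"
    using \<psi>(1) by (auto simp: qaut_def)
  obtain \<alpha> \<beta> where ab: "\<alpha> \<noteq> 0" "\<beta> \<noteq> 0"
    and x: "\<psi> (qmono 1 0) = Poly_Mapping.single (1, 0) \<alpha>" and y: "\<psi> (qmono 0 1) = Poly_Mapping.single (0, 1) \<beta>"
    using automorphism_diagonal[OF q \<psi>(1)] by blast
  note diag = diagonal_on_monomials[OF lin mult one x y]
  have X: "\<psi> (fam q (a, s, t) g (qmono 1 0)) = scalar \<alpha> * fam q (a', s', t') g (qmono 1 0)" for g
    using \<psi>(2) clinear_single[OF clinear_fam, of q "(a', s', t')" g "(1, 0)" \<alpha>]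
    unfolding intertwines_def by (simp only: x)
  have Y: "\<psi> (fam q (a, s, t) g (qmono 0 1)) = scalar \<beta> * fam q (a', s', t') g (qmono 0 1)" for g
    using \<psi>(2) clinear_single[OF clinear_fam, of q "(a', s', t')" g "(0, 1)" \<beta>]
    unfolding intertwines_def by (simp only: y)
  note simps = fam_values[OF q a] fam_values[OF q a'] clinear_add[OF lin] diag
  have "a = \<alpha> * a'"
    using arg_cong[OF X[of Ge, unfolded simps], of "\<lambda>p. coeff p 0 0"]
    by (simp add: lookup_scalar_mult)
  moreover have "\<alpha> * t' = t * \<beta> ^ 4"
    using arg_cong[OF X[of Gf, unfolded simps], of "\<lambda>p. coeff p 0 4"]
    by (simp add: lookup_scalar_mult lookup_add lookup_single when_def)
  moreover have "s' * \<beta> = s * \<beta>\<^sup>2 * \<beta>"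
    using arg_cong[OF Y[of Gf, unfolded simps], of "\<lambda>p. coeff p 0 3"]
    by (auto simp: lookup_scalar_mult lookup_add lookup_single when_def power2_eq_square power3_eq_cube mult_ac)
  ultimately show "\<exists>\<alpha> \<beta>. \<alpha> \<noteq> 0 \<and> \<beta> \<noteq> 0 \<and> a = \<alpha> * a' \<and> s' = s * \<beta>\<^sup>2 \<and> \<alpha> * t' = t * \<beta> ^ 4"
    using ab by auto
next
  assume "\<exists>\<alpha> \<beta>. \<alpha> \<noteq> 0 \<and> \<beta> \<noteq> 0 \<and> a = \<alpha> * a' \<and> s' = s * \<beta>\<^sup>2 \<and> \<alpha> * t' = t * \<beta> ^ 4"
  then obtain \<alpha> \<beta> where ab: "\<alpha> \<noteq> 0" "\<beta> \<noteq> 0" and eq: "a = \<alpha> * a'" "s' = s * \<beta>\<^sup>2" "\<alpha> * t' = t * \<beta> ^ 4"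
    by blast
  have e: "e_coeff q a m n = \<alpha> * e_coeff q a' m n" for m n
    by (simp add: e_coeff_def eq)
  have xy: "\<alpha> * f_coeff_xy q a m n = f_coeff_xy q a' m n" for m n
    using ab a' by (simp add: f_coeff_xy_def eq)
  have s: "f_coeff_s q s' m n = \<beta>\<^sup>2 * f_coeff_s q s m n" for m n
    by (simp add: f_coeff_s_def eq)
  have t: "\<alpha> * f_coeff_t q t' m = \<beta> ^ 4 * f_coeff_t q t m" for m
  proof -
    have "\<alpha> * f_coeff_t q t' m = \<alpha> * t' * ((q ^ m)\<^sup>2 * ((q ^ m)\<^sup>2 - 1) / (q\<^sup>2 * (q\<^sup>2 - 1)))"
      by (simp add: f_coeff_t_def)
    then show ?thesis by (simp add: eq f_coeff_t_def)
  qed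
  let ?\<psi> = "scaling \<alpha> \<beta>"
  have "?\<psi> (fam q (a, s, t) g b) = fam q (a', s', t') g (?\<psi> b)" for g b
  proof (rule clinear_qmono_eqI[of "\<lambda>b. ?\<psi> (fam q (a, s, t) g b)" "\<lambda>b. fam q (a', s', t') g (?\<psi> b)"])
    fix m n
    show "?\<psi> (fam q (a, s, t) g (qmono m n)) = fam q (a', s', t') g (?\<psi> (qmono m n))"
    proof (cases g)
      case Ge
      have "e_coeff q a m n * (\<alpha> ^ (m - 1) * \<beta> ^ n) = \<alpha> ^ m * \<beta> ^ n * e_coeff q a' m n"
        by (cases m) (simp_all add: e e_coeff_0 mult_ac)
      then show ?thesis
        unfolding Ge by (simp only: fam_single scaling_single scaling_linear fam_mono.simps
            scalar_mult_single mult_1_left mult_1_right)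
    next
      case Gf
      have 1: "Poly_Mapping.single (m + 1, n) (f_coeff_xy q a m n * (\<alpha> ^ (m + 1) * \<beta> ^ n)) =
          Poly_Mapping.single (m + 1, n) (\<alpha> ^ m * \<beta> ^ n * f_coeff_xy q a' m n)"
        by (simp add: xy[symmetric] mult_ac)
      have 2: "Poly_Mapping.single (m, n + 2) (f_coeff_s q s m n * (\<alpha> ^ m * \<beta> ^ (n + 2))) =
          Poly_Mapping.single (m, n + 2) (\<alpha> ^ m * \<beta> ^ n * f_coeff_s q s' m n)"
        by (simp add: s power_add power2_eq_square mult_ac)
      have 3: "Poly_Mapping.single (m - 1, n + 4) (f_coeff_t q t m * (\<alpha> ^ (m - 1) * \<beta> ^ (n + 4))) =
          Poly_Mapping.single (m - 1, n + 4) (\<alpha> ^ m * \<beta> ^ n * f_coeff_t q t' m)"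
      proof (cases m)
        case 0
        then show ?thesis by (simp add: f_coeff_t_0)
      next
        case (Suc k)
        have "f_coeff_t q t m * (\<alpha> ^ k * \<beta> ^ (n + 4)) = \<alpha> ^ k * \<beta> ^ n * (\<beta> ^ 4 * f_coeff_t q t m)"
          by (simp add: power_add mult_ac)
        also have "\<dots> = \<alpha> ^ m * \<beta> ^ n * f_coeff_t q t' m"
          unfolding t[symmetric] by (simp only: Suc power_Suc mult_ac)
        finally show ?thesis by (simp only: Suc diff_Suc_1)
      qed
      show ?thesis
        unfolding Gf by (simp only: fam_single scaling_single scaling_linear fam_mono.simps
            scalar_mult_single distrib_left mult_1_left mult_1_right 1 2 3)
    qed (simp_all add: fam_single scaling_single scaling_linear scalar_mult_single mult_ac)
  qed (rule clinear_comp[OF clinear_scaling clinear_fam], rule clinear_comp[OF clinear_fam clinear_scaling])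
  then have "intertwines ?\<psi> (fam q (a, s, t)) (fam q (a', s', t'))"
    by (simp add: intertwines_def)
  with qaut_scaling[OF ab] show "\<exists>\<psi>. qaut q \<psi> \<and> intertwines \<psi> (fam q (a, s, t)) (fam q (a', s', t'))"
    by blast
qed

end

section \<open>Orbits in the parameter space\<close>

text \<open>The first parameter fixes \<open>\<alpha> = a/a'\<close>. If \<open>s \<noteq> 0\<close> then \<open>\<beta>\<close> must be a square root of \<open>s'/s\<close>, and the
  condition on \<open>t\<close> becomes equality of the invariant \<open>t/(a s\<^sup>2)\<close>. If \<open>s = 0\<close> and \<open>t \<noteq> 0\<close> then a fourth
  root of \<open>\<alpha> t'/t\<close> serves as \<open>\<beta>\<close>.\<close>

lemma orbit_iff:
  fixes a a' s s' t t' :: complex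
  assumes a: "a \<noteq> 0" and a': "a' \<noteq> 0"
  shows "(\<exists>\<alpha> \<beta>. \<alpha> \<noteq> 0 \<and> \<beta> \<noteq> 0 \<and> a = \<alpha> * a' \<and> s' = s * \<beta>\<^sup>2 \<and> \<alpha> * t' = t * \<beta> ^ 4) \<longleftrightarrow>
    (s = 0 \<longleftrightarrow> s' = 0) \<and> (t = 0 \<longleftrightarrow> t' = 0) \<and> (s \<noteq> 0 \<longrightarrow> t / (a * s\<^sup>2) = t' / (a' * s'\<^sup>2))"
  (is "?L \<longleftrightarrow> ?R")
proof
  assume ?L
  then obtain \<alpha> \<beta> where ab: "\<alpha> \<noteq> 0" "\<beta> \<noteq> 0" and eq: "a = \<alpha> * a'" "s' = s * \<beta>\<^sup>2" "\<alpha> * t' = t * \<beta> ^ 4"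
    by blast
  have "t' = t * \<beta> ^ 4 / \<alpha>" using ab eq(3) by (simp add: field_simps)
  moreover have "t = 0 \<longleftrightarrow> t' = 0" using eq(3) ab by (metis mult_eq_0_iff power_eq_0_iff)
  ultimately show ?R using ab a a' by (simp add: eq(1,2) field_simps power4_eq_xxxx power2_eq_square)
next
  assume R: ?R
  have sqrt: "\<exists>\<beta>. \<beta>\<^sup>2 = z" for z :: complex
    by (rule exI[of _ "csqrt z"]) simp
  let ?\<alpha> = "a / a'"
  consider "s \<noteq> 0" | "s = 0" "t \<noteq> 0" | "s = 0" "t = 0" by blast
  then show ?L
  proof cases
    case 1
    obtain \<beta> where \<beta>: "\<beta>\<^sup>2 = s' / s" using sqrt by blast
    then have "\<beta> \<noteq> 0" "s' = s * \<beta>\<^sup>2" using R 1 by auto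
    moreover have "\<beta> ^ 4 = (s' / s)\<^sup>2" unfolding \<beta>[symmetric] by (simp flip: power_mult)
    then have "?\<alpha> * t' = t * \<beta> ^ 4"
      using R 1 a a' by (simp add: field_simps)
    ultimately show ?thesis using a a' by (intro exI[of _ ?\<alpha>] exI[of _ \<beta>]) simp
  next
    case 2
    obtain \<gamma> where \<gamma>: "\<gamma>\<^sup>2 = ?\<alpha> * t' / t" using sqrt by blast
    obtain \<beta> where \<beta>: "\<beta>\<^sup>2 = \<gamma>" using sqrt by blast
    have "\<beta> ^ 4 = ?\<alpha> * t' / t" unfolding \<gamma>[symmetric] \<beta>[symmetric] by (simp flip: power_mult)
    moreover from this have "\<beta> \<noteq> 0" using R 2 a a' by auto
    ultimately show ?thesis using R 2 a a' by (intro exI[of _ ?\<alpha>] exI[of _ \<beta>]) simp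
  next
    case 3
    then show ?thesis using R a a' by (intro exI[of _ ?\<alpha>] exI[of _ 1]) simp
  qed
qed

lemma same_generic_subset_iff:
  "(\<exists>D \<in> generic_subsets. p \<in> D \<and> p' \<in> D) \<longleftrightarrow>
    p \<in> generic_domain \<and> p' \<in> generic_domain \<and> phi p = phi p'"
  by (auto simp: generic_subsets_def)

lemma same_subset_iff:
  assumes "a \<noteq> 0" "a' \<noteq> 0"
  shows "(\<exists>D \<in> generic_subsets \<union> special_subsets. (a, s, t) \<in> D \<and> (a', s', t') \<in> D) \<longleftrightarrow>
    (s = 0 \<longleftrightarrow> s' = 0) \<and> (t = 0 \<longleftrightarrow> t' = 0) \<and> (s \<noteq> 0 \<longrightarrow> t / (a * s\<^sup>2) = t' / (a' * s'\<^sup>2))"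
proof -
  have "(\<exists>D \<in> special_subsets. (a, s, t) \<in> D \<and> (a', s', t') \<in> D) \<longleftrightarrow>
      (s \<noteq> 0 \<and> t = 0 \<and> s' \<noteq> 0 \<and> t' = 0) \<or> (s = 0 \<and> t \<noteq> 0 \<and> s' = 0 \<and> t' \<noteq> 0) \<or>
      (s = 0 \<and> t = 0 \<and> s' = 0 \<and> t' = 0)"
    using assms by (simp add: special_subsets_def params_def)
  moreover have "(\<exists>D \<in> generic_subsets. (a, s, t) \<in> D \<and> (a', s', t') \<in> D) \<longleftrightarrow>
      s \<noteq> 0 \<and> t \<noteq> 0 \<and> s' \<noteq> 0 \<and> t' \<noteq> 0 \<and> phi (a, s, t) = phi (a', s', t')"
    using assms unfolding same_generic_subset_iff by (auto simp: generic_domain_def params_def)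
  ultimately show ?thesis
    by (auto simp: bex_Un phi_def)
qed

lemma partition_generic: "partition_on generic_domain generic_subsets"
  by (rule partition_onI) (auto simp: generic_subsets_def disjnt_def)

lemma partition_params: "partition_on params (generic_subsets \<union> special_subsets)"
proof (rule partition_onI)
  show "\<Union> (generic_subsets \<union> special_subsets) = params"
    unfolding Union_Un_distrib partition_onD1[OF partition_generic, symmetric]
    by (auto simp: special_subsets_def generic_domain_def params_def)
  have "(1, 1, 0) \<in> {(a\<^sub>0, s, t) \<in> params. s \<noteq> 0 \<and> t = 0}" "(1, 0, 1) \<in> {(a\<^sub>0, s, t) \<in> params. s = 0 \<and> t \<noteq> 0}"
    "(1, 0, 0) \<in> {(a\<^sub>0, s, t) \<in> params. s = 0 \<and> t = 0}"
    by (simp_all add: params_def)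
  then have "{(a\<^sub>0, s, t) \<in> params. s \<noteq> 0 \<and> t = 0} \<noteq> {}" "{(a\<^sub>0, s, t) \<in> params. s = 0 \<and> t \<noteq> 0} \<noteq> {}"
    "{(a\<^sub>0, s, t) \<in> params. s = 0 \<and> t = 0} \<noteq> {}"
    by blast+
  then show "{} \<notin> generic_subsets \<union> special_subsets"
    using partition_onD3[OF partition_generic] unfolding special_subsets_def by blast
  show "disjnt D D'" if "D \<in> generic_subsets \<union> special_subsets" "D' \<in> generic_subsets \<union> special_subsets" "D \<noteq> D'" for D D'
    using that by (auto simp: generic_subsets_def special_subsets_def generic_domain_def disjnt_def)
qed

text \<open>The points \<open>(1, 1, c)\<close> show that \<open>\<phi>\<close> takes every nonzero value \<open>c\<close>.\<close>

lemma uncountable_generic: "uncountable generic_subsets"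
proof
  let ?D = "\<lambda>c. {p \<in> generic_domain. phi p = c}"
  have sub: "- {0} \<subseteq> phi ` generic_domain"
  proof
    fix c :: complex assume "c \<in> - {0}"
    then show "c \<in> phi ` generic_domain"
      by (intro image_eqI[of _ _ "(1, 1, c)"]) (simp_all add: phi_def generic_domain_def params_def)
  qed
  have "inj_on ?D (- {0})"
  proof (rule inj_onI)
    fix c d assume "c \<in> - {0}" and eq: "?D c = ?D d"
    then obtain p where "p \<in> generic_domain" "phi p = c" using sub by blast
    then show "c = d" using eq by blast
  qed
  moreover assume "countable generic_subsets"
  then have "countable (?D ` (- {0}))"
    using sub by (rule_tac countable_subset) (auto simp: generic_subsets_def)
  ultimately have "countable (- {0 :: complex})"
    by (rule countable_image_inj_on[rotated])
  then have "countable (insert 0 (- {0 :: complex}))" by simp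
  moreover have "insert 0 (- {0}) = (UNIV :: complex set)" by blast
  ultimately show False
    using complex_non_denum uncountable_def[of "UNIV :: complex set"] by simp
qed

lemma card_special: "card special_subsets = 3"
proof -
  let ?A = "{(a\<^sub>0, s, t) \<in> params. s \<noteq> 0 \<and> t = 0}" and ?B = "{(a\<^sub>0, s, t) \<in> params. s = 0 \<and> t \<noteq> 0}"
    and ?C = "{(a\<^sub>0, s, t) \<in> params. s = 0 \<and> t = 0}"
  have "(1, 1, 0) \<in> ?A" "(1, 1, 0) \<notin> ?B" "(1, 1, 0) \<notin> ?C" "(1, 0, 1) \<in> ?B" "(1, 0, 1) \<notin> ?C"
    by (simp_all add: params_def)
  then have "?A \<noteq> ?B" "?A \<noteq> ?C" "?B \<noteq> ?C" by blast+
  then show ?thesis by (simp add: special_subsets_def)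
qed

lemma special_generic_disjoint: "generic_subsets \<inter> special_subsets = {}"
proof -
  have "D \<subseteq> generic_domain" "D \<noteq> {}" if "D \<in> generic_subsets" for D
    using that by (auto simp: generic_subsets_def)
  moreover have "D \<inter> generic_domain = {}" if "D \<in> special_subsets" for D
    using that by (auto simp: special_subsets_def generic_domain_def)
  ultimately show ?thesis by blast
qed

theorem theorem12:
  fixes q :: complex
  assumes "q \<noteq> 0" and "\<forall>n::nat. n > 0 \<longrightarrow> q ^ n \<noteq> 1"
  shows "(\<forall>p \<in> params. \<exists>!\<pi>. \<pi> \<in> qp_structures q \<and> has_values q p \<pi>) \<and>
    struct_S q = family q ` params \<and>
    inj_on (family q) params \<and>
    (\<forall>p \<in> params. \<forall>p' \<in> params.
       isomorphic_structures (uq_sl2 q) (qplane q) (family q p) (family q p') \<longleftrightarrow>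
         (\<exists>D \<in> generic_subsets \<union> special_subsets. p \<in> D \<and> p' \<in> D)) \<and>
    partition_on generic_domain generic_subsets \<and>
    uncountable generic_subsets \<and>
    (\<forall>D \<in> generic_subsets. family q ` D \<in> struct_S q // iso_rel_S q) \<and>
    inj_on (\<lambda>D. family q ` D) (generic_subsets \<union> special_subsets) \<and>
    (struct_S q // iso_rel_S q) - (\<lambda>D. family q ` D) ` generic_subsets =
      (\<lambda>D. family q ` D) ` special_subsets \<and>
    card ((struct_S q // iso_rel_S q) - (\<lambda>D. family q ` D) ` generic_subsets) = 3"
proof -
  let ?P = "generic_subsets \<union> special_subsets" and ?F = "\<lambda>D. family q ` D"
  have iso: "isomorphic_structures (uq_sl2 q) (qplane q) (family q p) (family q p') \<longleftrightarrow>
      (\<exists>D \<in> ?P. p \<in> D \<and> p' \<in> D)" if pp: "p \<in> params" "p' \<in> params" for p p'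
  proof -
    obtain a s t where p: "p = (a, s, t)" and a: "a \<noteq> 0"
      using pp(1) by (auto simp: params_def)
    obtain a' s' t' where p': "p' = (a', s', t')" and a': "a' \<noteq> 0"
      using pp(2) by (auto simp: params_def)
    show ?thesis
      using isomorphic_iff_intertwines[OF family_props(3)[OF assms pp(1)] family_props(3)[OF assms pp(2)]]
      unfolding p p' intertwiner_iff[OF assms a a'] orbit_iff[OF a a'] same_subset_iff[OF a a'] .
  qed
  have inj: "inj_on (family q) params" by (rule family_inj[OF assms])
  have sub: "D \<subseteq> params" "D \<noteq> {}" if "D \<in> ?P" for D
    using that partition_params unfolding partition_on_def by blast+
  have disj: "D = D'" if "D \<in> ?P" "D' \<in> ?P" "p \<in> D" "p \<in> D'" for D D' p
    using that partition_onD2[OF partition_params] unfolding disjoint_def by blast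
  have image: "iso_rel_S q `` {family q p} = ?F D" if "D \<in> ?P" "p \<in> D" for p D
  proof (intro equalityI subsetI)
    have p: "p \<in> params" using sub that by blast
    fix \<pi> assume "\<pi> \<in> iso_rel_S q `` {family q p}"
    then obtain p' where p': "p' \<in> params" "\<pi> = family q p'"
      "isomorphic_structures (uq_sl2 q) (qplane q) (family q p) (family q p')"
      by (auto simp: iso_rel_S_def struct_S_eq[OF assms])
    then obtain D' where "D' \<in> ?P" "p \<in> D'" "p' \<in> D'" using iso[OF p p'(1)] by blast
    with disj that p'(2) show "\<pi> \<in> ?F D" by blast
  next
    have p: "p \<in> params" using sub that by blast
    fix \<pi> assume "\<pi> \<in> ?F D"
    then obtain p' where p': "p' \<in> D" "\<pi> = family q p'" by blast
    then have "p' \<in> params" using sub that by blast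
    with iso[OF p this] p p' that show "\<pi> \<in> iso_rel_S q `` {family q p}"
      by (auto simp: iso_rel_S_def struct_S_eq[OF assms])
  qed
  \<comment> \<open>The family is injective on parameters and isomorphism is membership in a common block, so the
    isomorphism classes are exactly the images of the blocks.\<close>
  have quot: "struct_S q // iso_rel_S q = ?F ` ?P"
  proof (intro equalityI subsetI)
    fix C assume "C \<in> struct_S q // iso_rel_S q"
    then obtain p where p: "p \<in> params" "C = iso_rel_S q `` {family q p}"
      by (auto simp: quotient_def struct_S_eq[OF assms])
    then obtain D where "D \<in> ?P" "p \<in> D"
      using partition_onD1[OF partition_params] by blast
    with image p(2) show "C \<in> ?F ` ?P" by blast
  next
    fix C assume "C \<in> ?F ` ?P"
    then obtain D where D: "D \<in> ?P" "C = ?F D" by blast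
    then obtain p where p: "p \<in> D" using sub by blast
    with D sub have "family q p \<in> struct_S q" by (auto simp: struct_S_eq[OF assms])
    with image[OF D(1) p] D(2) show "C \<in> struct_S q // iso_rel_S q"
      by (auto simp: quotient_def)
  qed
  have inj_image: "inj_on ?F ?P"
    by (rule inj_onI) (metis inj inj_on_image_eq_iff sub(1))
  have rest: "(struct_S q // iso_rel_S q) - ?F ` generic_subsets = ?F ` special_subsets"
    unfolding quot image_Un
    using inj_on_image_Int[OF inj_image, of generic_subsets special_subsets] special_generic_disjoint
    by auto
  moreover have "card (?F ` special_subsets) = 3"
    using card_image[OF inj_on_subset[OF inj_image]] card_special by auto
  ultimately show ?thesis
    using unique_structure[OF assms] struct_S_eq[OF assms] inj iso partition_generic uncountable_generic
      quot inj_image by auto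
qed

end
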